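(* Let $P_1,P_2$ be fixed probability distributions on $[0,\infty)$ (not depending on $n$), let $m=m_n\to+\infty$ as $n\to\infty$, let $G_n=G(P_1,P_2,n,m)$ be the inhomogeneous random intersection graph on the vertex set $V=\{v_1,\dots,v_n\}$, and let $d(v_1)=d_{G_n}(v_1)$ be the degree of $v_1$ in $G_n$. Let $X_1$ and $Y_1$ denote random variables with distributions $P_1$ and $P_2$ respectively, and write $a_i=\mathbf{E}X_1^i$, $b_i=\mathbf{E}Y_1^i$. Then, as $n\to\infty$: (i) Assume that $m/n\to 0$ and that $\mathbf{E}X_1<\infty$. Then $\mathbf{P}(d(v_1)=0)=1-o(1)$. (ii) Assume that $m/n\to\beta$ for some $\beta\in(0,+\infty)$, and that $\mathbf{E}X_1^2<\infty$ and $\mathbf{E}Y_1<\infty$. Then $d(v_1)$ converges in distribution to the random variable $$d_*=\sum_{j=1}^{\Lambda_1}\tau_j,$$ where $\tau_1,\tau_2,\dots$ are independent and identically distributed random variables, independent of the random variable $\Lambda_1$, and where, for $r=0,1,2,\dots$, $$\mathbf{P}(\tau_1=r)=\frac{r+1}{\mathbf{E}\Lambda_2}\,\mathbf{P}(\Lambda_2=r+1)\qquad\text{and}\qquad \mathbf{P}(\Lambda_i=r)=\mathbf{E}\Big(e^{-\lambda_i}\frac{\lambda_i^r}{r!}\Big),\quad i=1,2,$$ with $\lambda_1=Y_1a_1\beta^{1/2}$ and $\lambda_2=X_1b_1\beta^{-1/2}$. (iii) Assume that $m/n\to+\infty$, and that $\mathbf{E}X_1^2<\infty$ and $\mathbf{E}Y_1<\infty$.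 Then $d(v_1)$ converges in distribution to a random variable $\Lambda_3$ having the probability distribution $$\mathbf{P}(\Lambda_3=r)=\mathbf{E}\Big(e^{-\lambda_3}\frac{\lambda_3^r}{r!}\Big),\qquad r=0,1,\dots,$$ with $\lambda_3=Y_1a_2b_1$.
   Context: The inhomogeneous random intersection graph $G(P_1,P_2,n,m)$ is defined as follows. Let $X_1,\dots,X_m,Y_1,\dots,Y_n$ be independent non-negative random variables such that each $X_i$ has distribution $P_1$ and each $Y_j$ has distribution $P_2$. Given the realized values $X=\{X_i\}_{i=1}^m$ and $Y=\{Y_j\}_{j=1}^n$, let $H_{X,Y}$ be the random bipartite graph with bipartition $V=\{v_1,\dots,v_n\}$, $W=\{w_1,\dots,w_m\}$, in which the edges $\{w_i,v_j\}$ are inserted independently for each $(i,j)\in[m]\times[n]$ with (conditional) probabilities $p_{ij}=\min\{1,X_iY_j(nm)^{-1/2}\}$. The graph $G(P_1,P_2,n,m)$ has vertex set $V$, and two distinct vertices $v',v''\in V$ are adjacent whenever they have a common neighbour in $H_{X,Y}$. The degree $d(v_j)$ is the number of vertices of $V$ adjacent to $v_j$ in $G(P_1,P_2,n,m)$. Conventions: $0^0=1$ and an empty sum equals $0$. In the degenerate case $\mathbf{E}\Lambda_2=0$ of part (ii) (i.e. $a_1b_1=0$) one has $\Lambda_1=0$ almost surely, and $d_*$ is understood to be $0$. *)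

theory Defs
  imports "HOL-Probability.Probability"
begin

section \<open>The inhomogeneous random intersection graph\<close>

text \<open>
  Vertex \<open>v\<^sub>j\<close> is represented by \<open>j \<in> {1..n}\<close> and attribute \<open>w\<^sub>i\<close> by \<open>i \<in> {1..m}\<close>.
  A bipartite graph is the set of pairs \<open>(i, j)\<close> with \<open>w\<^sub>i\<close> adjacent to \<open>v\<^sub>j\<close>; a graph on
  \<open>{1..n}\<close> is given by its set of two-element edges.
\<close>

definition edge_prob :: "nat \<Rightarrow> nat \<Rightarrow> real \<Rightarrow> real \<Rightarrow> real" where
  "edge_prob n m x y = min 1 (x * y * (real n * real m) powr (-1/2))"

definition bipartite_pmf ::
    "nat \<Rightarrow> nat \<Rightarrow> (nat \<Rightarrow> real) \<Rightarrow> (nat \<Rightarrow> real) \<Rightarrow> (nat \<times> nat) set pmf" where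
  "bipartite_pmf n m X Y =
     map_pmf (\<lambda>h. {e. h e})
       (Pi_pmf ({1..m} \<times> {1..n}) False (\<lambda>(i, j). bernoulli_pmf (edge_prob n m (X i) (Y j))))"

definition intersection_graph :: "nat \<Rightarrow> (nat \<times> nat) set \<Rightarrow> nat set set" where
  "intersection_graph n H =
     {{v, v'} | v v'. v \<in> {1..n} \<and> v' \<in> {1..n} \<and> v \<noteq> v' \<and> (\<exists>w. (w, v) \<in> H \<and> (w, v') \<in> H)}"

definition graph_degree :: "nat \<Rightarrow> nat set set \<Rightarrow> nat \<Rightarrow> nat" where
  "graph_degree n E v = card {u \<in> {1..n}. {v, u} \<in> E}"

definition weights :: "real measure \<Rightarrow> real measure \<Rightarrow> nat \<Rightarrow> nat \<Rightarrow>
    ((nat \<Rightarrow> real) \<times> (nat \<Rightarrow> real)) measure" where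
  "weights P1 P2 n m = (\<Pi>\<^sub>M i\<in>{1..m}. P1) \<Otimes>\<^sub>M (\<Pi>\<^sub>M j\<in>{1..n}. P2)"

text \<open>
  The law of \<open>G(P\<^sub>1, P\<^sub>2, n, m)\<close>: draw the weights \<open>(X, Y)\<close>, then the bipartite graph with
  its conditional law given \<open>(X, Y)\<close>. See \<open>rig_kernel_measurable\<close> for the measurability
  that the monadic bind presupposes.
\<close>

definition rig :: "real measure \<Rightarrow> real measure \<Rightarrow> nat \<Rightarrow> nat \<Rightarrow> nat set set measure" where
  "rig P1 P2 n m =
     weights P1 P2 n m \<bind>
       (\<lambda>(X, Y). measure_pmf (map_pmf (intersection_graph n) (bipartite_pmf n m X Y)))"


section \<open>The limit laws\<close>

text \<open>
  The law with \<open>P(\<Lambda> = r) = E (exp (-\<lambda>) * \<lambda> ^ r / r!)\<close> where \<open>\<lambda> = f Z\<close> and \<open>Z\<close> has law \<open>P\<close>.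
  It is meaningful when \<open>\<lambda>\<close> is almost surely nonnegative, see \<open>pmf_mixed_poisson\<close>.
\<close>

definition mixed_poisson :: "real measure \<Rightarrow> (real \<Rightarrow> real) \<Rightarrow> nat pmf" where
  "mixed_poisson P f = embed_pmf (\<lambda>r. \<integral>z. exp (- f z) * (f z ^ r / fact r) \<partial>P)"

text \<open>
  Meaningful when the expectation is finite and nonzero, see \<open>pmf_shifted_size_biased\<close>.
\<close>

definition shifted_size_biased :: "nat pmf \<Rightarrow> nat pmf" where
  "shifted_size_biased L =
     embed_pmf (\<lambda>r. real (r + 1) / measure_pmf.expectation L real * pmf L (r + 1))"

definition random_sum :: "nat \<times> (nat \<Rightarrow> nat) \<Rightarrow> nat" where
  "random_sum = (\<lambda>(k, t). \<Sum>j=1..k. t j)"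

text \<open>
  The law of \<open>\<tau>\<^sub>1 + \<dots> + \<tau>\<^sub>\<Lambda>\<close> on \<open>\<real>\<close>, realised on the product space on which \<open>\<Lambda>\<close> and
  the \<open>\<tau>\<^sub>j\<close> are the (independent) coordinates.
\<close>

definition random_sum_law :: "nat pmf \<Rightarrow> nat pmf \<Rightarrow> real measure" where
  "random_sum_law L T =
     distr (measure_pmf L \<Otimes>\<^sub>M (\<Pi>\<^sub>M j\<in>(UNIV :: nat set). measure_pmf T)) borel
       (\<lambda>\<omega>. real (random_sum \<omega>))"

definition d_star_law :: "nat pmf \<Rightarrow> nat pmf \<Rightarrow> real measure" where
  "d_star_law L1 L2 =
     (if measure_pmf.expectation L2 real = 0 then return borel 0
      else random_sum_law L1 (shifted_size_biased L2))"


section \<open>Well-definedness\<close>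

lemma finite_support_pmf_measurable:
  fixes K :: "'a \<Rightarrow> 'b pmf"
  assumes fin: "finite S" and supp: "\<And>x. x \<in> space M \<Longrightarrow> set_pmf (K x) \<subseteq> S"
    and meas: "\<And>s. s \<in> S \<Longrightarrow> (\<lambda>x. pmf (K x) s) \<in> borel_measurable M"
  shows "(\<lambda>x. measure_pmf (K x)) \<in> M \<rightarrow>\<^sub>M prob_algebra (count_space UNIV)"
proof (rule measurable_prob_algebraI)
  show "prob_space (measure_pmf (K x))" for x
    by (rule prob_space_measure_pmf)
  show "(\<lambda>x. measure_pmf (K x)) \<in> M \<rightarrow>\<^sub>M subprob_algebra (count_space UNIV)"
  proof (rule measurable_subprob_algebra)
    show "subprob_space (measure_pmf (K x))" for x
      by (rule prob_space_imp_subprob_space) (rule prob_space_measure_pmf)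
    show "sets (measure_pmf (K x)) = sets (count_space UNIV)" for x
      by simp
    fix A :: "'b set"
    have "emeasure (measure_pmf (K x)) A = ennreal (\<Sum>s\<in>A \<inter> S. pmf (K x) s)"
      if "x \<in> space M" for x
    proof -
      have "emeasure (measure_pmf (K x)) A = emeasure (measure_pmf (K x)) (A \<inter> S)"
        using supp[OF that]
        by (intro emeasure_eq_AE) (auto simp: AE_measure_pmf_iff)
      also have "\<dots> = ennreal (\<Sum>s\<in>A \<inter> S. pmf (K x) s)"
        using fin by (simp add: measure_pmf.emeasure_eq_measure measure_measure_pmf_finite)
      finally show ?thesis .
    qed
    moreover have "(\<lambda>x. ennreal (\<Sum>s\<in>A \<inter> S. pmf (K x) s)) \<in> borel_measurable M"
      using meas by (intro measurable_compose[OF _ measurable_ennreal] borel_measurable_sum) auto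
    ultimately show "(\<lambda>x. emeasure (measure_pmf (K x)) A) \<in> borel_measurable M"
      by (subst measurable_cong) auto
  qed
qed

lemma rig_kernel_measurable:
  assumes "sets P1 = sets borel" "sets P2 = sets borel"
  shows "(\<lambda>(X, Y). measure_pmf (map_pmf (intersection_graph n) (bipartite_pmf n m X Y)))
           \<in> weights P1 P2 n m \<rightarrow>\<^sub>M prob_algebra (count_space UNIV)"
proof -
  let ?I = "{1..m} \<times> {1..n}"
  let ?q = "\<lambda>(X, Y). \<lambda>(i, j). bernoulli_pmf (edge_prob n m (X i) (Y j))"
  let ?K = "\<lambda>\<omega>. Pi_pmf ?I False (?q \<omega>)"
  have "(\<lambda>\<omega>. measure_pmf (?K \<omega>)) \<in> weights P1 P2 n m \<rightarrow>\<^sub>M prob_algebra (count_space UNIV)"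
  proof (rule finite_support_pmf_measurable)
    show "finite (PiE_dflt ?I False (\<lambda>_. UNIV :: bool set))"
      by (intro finite_PiE_dflt) auto
    show "set_pmf (?K \<omega>) \<subseteq> PiE_dflt ?I False (\<lambda>_. UNIV)" for \<omega>
      using set_Pi_pmf_subset[of ?I False "?q \<omega>"] by (auto simp: PiE_dflt_def)
    fix s :: "nat \<times> nat \<Rightarrow> bool" assume s: "s \<in> PiE_dflt ?I False (\<lambda>_. UNIV)"
    define c where "c = (real n * real m) powr (-1/2)"
    have eq: "pmf (?K \<omega>) s = (\<Prod>e\<in>?I.
        (\<lambda>p. if s e then p else 1 - p)
          (min 1 (max 0 (min 1 (fst \<omega> (fst e) * snd \<omega> (snd e) * c)))))" for \<omega>
    proof -
      have "pmf (?K \<omega>) s = (\<Prod>e\<in>?I. pmf (?q \<omega> e) (s e))"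
        using s unfolding PiE_dflt_def by (intro pmf_Pi') (blast | simp)+
      also have "\<dots> = (\<Prod>e\<in>?I. (\<lambda>p. if s e then p else 1 - p)
          (min 1 (max 0 (min 1 (fst \<omega> (fst e) * snd \<omega> (snd e) * c)))))"
        unfolding c_def split_beta bernoulli_pmf.rep_eq edge_prob_def o_def by (rule refl)
      finally show ?thesis .
    qed
    show "(\<lambda>\<omega>. pmf (?K \<omega>) s) \<in> borel_measurable (weights P1 P2 n m)"
      unfolding eq weights_def
    proof (rule borel_measurable_prod)
      fix e assume "e \<in> ?I"
      then have e: "fst e \<in> {1..m}" "snd e \<in> {1..n}" by auto
      let ?W = "(\<Pi>\<^sub>M i\<in>{1..m}. P1) \<Otimes>\<^sub>M (\<Pi>\<^sub>M j\<in>{1..n}. P2)"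
      have [measurable]: "(\<lambda>\<omega>. fst \<omega> (fst e)) \<in> borel_measurable ?W"
        by (subst measurable_cong_sets[OF refl assms(1), symmetric])
          (rule measurable_compose[OF measurable_fst measurable_component_singleton[OF e(1)]])
      have [measurable]: "(\<lambda>\<omega>. snd \<omega> (snd e)) \<in> borel_measurable ?W"
        by (subst measurable_cong_sets[OF refl assms(2), symmetric])
          (rule measurable_compose[OF measurable_snd measurable_component_singleton[OF e(2)]])
      show "(\<lambda>\<omega>. (\<lambda>p. if s e then p else 1 - p)
            (min 1 (max 0 (min 1 (fst \<omega> (fst e) * snd \<omega> (snd e) * c)))))
        \<in> borel_measurable ?W"
        by (cases "s e") (simp_all only: if_True if_False, measurable)
    qed
  qed
  then have "(\<lambda>\<omega>. distr (measure_pmf (?K \<omega>)) (count_space UNIV) (\<lambda>h. intersection_graph n {e. h e}))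
      \<in> weights P1 P2 n m \<rightarrow>\<^sub>M prob_algebra (count_space UNIV)"
    by (rule measurable_compose) (rule measurable_distr_prob_space, simp)
  moreover have "measure_pmf (map_pmf (intersection_graph n) (bipartite_pmf n m (fst \<omega>) (snd \<omega>))) =
      distr (measure_pmf (?K \<omega>)) (count_space UNIV) (\<lambda>h. intersection_graph n {e. h e})" for \<omega>
    by (simp add: bipartite_pmf_def map_pmf_comp map_pmf_rep_eq split_beta)
  ultimately show ?thesis
    by (simp only: case_prod_beta')
qed

lemma prob_space_weights:
  assumes "prob_space P1" "prob_space P2"
  shows "prob_space (weights P1 P2 n m)"
  unfolding weights_def
  by (intro prob_space_pair prob_space_PiM assms)

lemma
  assumes "real_distribution P1" "real_distribution P2"
  shows prob_space_rig: "prob_space (rig P1 P2 n m)"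
    and sets_rig: "sets (rig P1 P2 n m) = UNIV"
proof -
  interpret P1: real_distribution P1 by fact
  interpret P2: real_distribution P2 by fact
  have w: "weights P1 P2 n m \<in> space (prob_algebra (weights P1 P2 n m))"
    by (simp add: space_prob_algebra prob_space_weights P1.prob_space_axioms P2.prob_space_axioms)
  have "rig P1 P2 n m \<in> space (prob_algebra (count_space UNIV))"
    unfolding rig_def
    by (rule measurable_space[OF measurable_bind_prob_space[OF measurable_ident_sets[OF refl]
            rig_kernel_measurable[OF P1.events_eq_borel P2.events_eq_borel]] w])
  then show "prob_space (rig P1 P2 n m)" "sets (rig P1 P2 n m) = UNIV"
    by (simp_all add: space_prob_algebra)
qed

lemma pmf_mixed_poisson:
  assumes "prob_space P" and [measurable]: "f \<in> borel_measurable P"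
    and nonneg: "AE z in P. 0 \<le> f z"
  shows "pmf (mixed_poisson P f) r = (\<integral>z. exp (- f z) * (f z ^ r / fact r) \<partial>P)"
    and "integrable P (\<lambda>z. exp (- f z) * (f z ^ r / fact r))"
proof -
  interpret prob_space P by fact
  let ?g = "\<lambda>r z. exp (- f z) * (f z ^ r / fact r)"
  have sums: "(\<lambda>r. ?g r z) sums 1" for z
    using sums_mult[OF exp_converges[of "f z"], of "exp (- f z)"]
    by (simp add: scaleR_conv_of_real divide_inverse mult_ac flip: exp_add)
  have bound: "?g r z \<le> 1" if "0 \<le> f z" for r z
    using sum_le_suminf[OF sums_summable[OF sums[of z]], of "{r}"] that sums_unique[OF sums[of z]]
    by simp
  have int: "integrable P (?g r)" for r
  proof (rule integrable_const_bound[where B = 1])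
    show "AE z in P. norm (?g r z) \<le> 1"
      using nonneg by eventually_elim (use bound in \<open>auto simp: abs_mult\<close>)
  qed simp
  then show "integrable P (?g r)" .
  have nn: "AE z in P. 0 \<le> ?g r z" for r
    using nonneg by eventually_elim auto
  have "(\<integral>\<^sup>+r. ennreal (\<integral>z. ?g r z \<partial>P) \<partial>count_space UNIV) = (\<Sum>r. ennreal (\<integral>z. ?g r z \<partial>P))"
    by (rule nn_integral_count_space_nat)
  also have "\<dots> = (\<Sum>r. \<integral>\<^sup>+z. ennreal (?g r z) \<partial>P)"
    by (subst nn_integral_eq_integral[OF int nn]) (rule refl)
  also have "\<dots> = (\<integral>\<^sup>+z. (\<Sum>r. ennreal (?g r z)) \<partial>P)"
    by (rule nn_integral_suminf[symmetric]) simp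
  also have "\<dots> = (\<integral>\<^sup>+z. 1 \<partial>P)"
  proof (rule nn_integral_cong_AE)
    show "AE z in P. (\<Sum>r. ennreal (?g r z)) = 1"
      using nonneg
    proof eventually_elim
      case (elim z)
      then show ?case
        by (subst suminf_ennreal2[OF _ sums_summable[OF sums]], simp)
          (simp only: sums_unique[OF sums, symmetric] ennreal_1)
    qed
  qed
  also have "\<dots> = 1"
    by (simp add: emeasure_space_1)
  finally show "pmf (mixed_poisson P f) r = (\<integral>z. ?g r z \<partial>P)"
    unfolding mixed_poisson_def
    by (intro pmf_embed_pmf integral_nonneg_AE nn)
qed

lemma
  assumes "prob_space P" and [measurable]: "f \<in> borel_measurable P"
    and nonneg: "AE z in P. 0 \<le> f z" and int: "integrable P f"
  shows integrable_mixed_poisson: "integrable (measure_pmf (mixed_poisson P f)) real"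
    and expectation_mixed_poisson:
      "measure_pmf.expectation (mixed_poisson P f) real = (\<integral>z. f z \<partial>P)"
proof -
  let ?g = "\<lambda>r z. exp (- f z) * (f z ^ r / fact r)"
  have sums: "(\<lambda>r. ?g r z * real r) sums f z" for z
  proof -
    have "(\<lambda>r. ?g r z) sums 1"
      using sums_mult[OF exp_converges[of "f z"], of "exp (- f z)"]
      by (simp add: scaleR_conv_of_real divide_inverse mult_ac flip: exp_add)
    then have "(\<lambda>r. f z * ?g r z) sums f z"
      using sums_mult[of "\<lambda>r. ?g r z" 1 "f z"] by simp
    moreover have "f z * ?g r z = ?g (Suc r) z * real (Suc r)" for r
      by (simp add: field_simps del: of_nat_Suc)
    ultimately have "(\<lambda>r. ?g (Suc r) z * real (Suc r)) sums f z"
      by (simp only:)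
    then show ?thesis
      using sums_Suc[of "\<lambda>r. ?g r z * real r" "f z"] by simp
  qed
  have nn: "AE z in P. 0 \<le> ?g r z" for r
    using nonneg by eventually_elim auto
  have "(\<integral>\<^sup>+r. ennreal (real r) \<partial>measure_pmf (mixed_poisson P f)) =
      (\<Sum>r. ennreal (\<integral>z. ?g r z \<partial>P) * ennreal (real r))"
    by (simp only: nn_integral_measure_pmf nn_integral_count_space_nat
        pmf_mixed_poisson(1)[OF assms(1-3)])
  also have "\<dots> = (\<Sum>r. \<integral>\<^sup>+z. ennreal (?g r z) * ennreal (real r) \<partial>P)"
    by (subst nn_integral_eq_integral[OF pmf_mixed_poisson(2)[OF assms(1-3)] nn, symmetric],
        subst nn_integral_multc) simp_all
  also have "\<dots> = (\<integral>\<^sup>+z. (\<Sum>r. ennreal (?g r z) * ennreal (real r)) \<partial>P)"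
    by (rule nn_integral_suminf[symmetric]) simp
  also have "\<dots> = (\<integral>\<^sup>+z. ennreal (f z) \<partial>P)"
  proof (rule nn_integral_cong_AE)
    show "AE z in P. (\<Sum>r. ennreal (?g r z) * ennreal (real r)) = ennreal (f z)"
      using nonneg
    proof eventually_elim
      case (elim z)
      have "(\<Sum>r. ennreal (?g r z) * ennreal (real r)) = (\<Sum>r. ennreal (?g r z * real r))"
        by (rule suminf_cong, rule ennreal_mult[symmetric]) (use elim in auto)
      also have "\<dots> = ennreal (f z)"
        by (subst suminf_ennreal2[OF _ sums_summable[OF sums]], use elim in simp)
          (simp only: sums_unique[OF sums, symmetric])
      finally show ?case .
    qed
  qed
  also have "\<dots> = ennreal (\<integral>z. f z \<partial>P)"
    by (rule nn_integral_eq_integral[OF int nonneg])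
  finally have *: "(\<integral>\<^sup>+r. ennreal (real r) \<partial>measure_pmf (mixed_poisson P f)) =
      ennreal (\<integral>z. f z \<partial>P)" .
  then show "integrable (measure_pmf (mixed_poisson P f)) real"
    by (intro integrableI_nonneg) auto
  show "measure_pmf.expectation (mixed_poisson P f) real = (\<integral>z. f z \<partial>P)"
    using * integral_nonneg_AE[OF nonneg] by (intro integral_eq_nn_integral[THEN trans]) auto
qed

lemma pmf_shifted_size_biased:
  assumes int: "integrable (measure_pmf L) real"
    and nz: "measure_pmf.expectation L real \<noteq> 0"
  shows "pmf (shifted_size_biased L) r =
           real (r + 1) / measure_pmf.expectation L real * pmf L (r + 1)"
proof -
  let ?E = "measure_pmf.expectation L real"
  have pos: "0 < ?E"
    using nz integral_nonneg_AE[of real "measure_pmf L"] by (auto simp: less_le)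
  have "ennreal ?E = (\<integral>\<^sup>+r. ennreal (real r) \<partial>measure_pmf L)"
    by (rule nn_integral_eq_integral[symmetric]) (use int in auto)
  also have "\<dots> = (\<Sum>r. ennreal (pmf L r) * ennreal (real r))"
    by (simp add: nn_integral_measure_pmf nn_integral_count_space_nat)
  also have "\<dots> = (\<Sum>r. ennreal (pmf L (Suc r)) * ennreal (real (Suc r)))"
    using suminf_offset[of "\<lambda>r. ennreal (pmf L r) * ennreal (real r)" 1]
    by simp
  finally have E: "ennreal ?E = (\<Sum>r. ennreal (pmf L (Suc r)) * ennreal (real (Suc r)))" .
  have "ennreal (real (r + 1) / ?E * pmf L (r + 1)) =
      ennreal (1 / ?E) * (ennreal (pmf L (Suc r)) * ennreal (real (Suc r)))" for r
  proof -
    have "real (r + 1) / ?E * pmf L (r + 1) = 1 / ?E * (pmf L (Suc r) * real (Suc r))"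
      by simp
    then show ?thesis
      using pos by (simp only: ennreal_mult pmf_nonneg of_nat_0_le_iff mult_nonneg_nonneg
          zero_le_divide_1_iff less_imp_le)
  qed
  then have "(\<integral>\<^sup>+r. ennreal (real (r + 1) / ?E * pmf L (r + 1)) \<partial>count_space UNIV) =
      (\<Sum>r. ennreal (1 / ?E) * (ennreal (pmf L (Suc r)) * ennreal (real (Suc r))))"
    by (simp only: nn_integral_count_space_nat)
  also have "\<dots> = ennreal (1 / ?E) * ennreal ?E"
    by (simp add: E)
  also have "\<dots> = 1"
    using pos by (simp flip: ennreal_mult)
  finally show ?thesis
    unfolding shifted_size_biased_def
    using pos by (intro pmf_embed_pmf) auto
qed

lemma measurable_random_sum [measurable]:
  "random_sum \<in> measure_pmf L \<Otimes>\<^sub>M (\<Pi>\<^sub>M j\<in>(UNIV :: nat set). measure_pmf T) \<rightarrow>\<^sub>M count_space UNIV"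
proof -
  have "(\<lambda>\<omega>. (\<lambda>k \<omega>. \<Sum>j=1..k. snd \<omega> j) (fst \<omega>) \<omega>)
      \<in> measure_pmf L \<Otimes>\<^sub>M (\<Pi>\<^sub>M j\<in>(UNIV :: nat set). measure_pmf T) \<rightarrow>\<^sub>M count_space UNIV"
    by measurable
  then show ?thesis
    by (simp add: random_sum_def split_beta)
qed

lemma real_distribution_random_sum_law: "real_distribution (random_sum_law L T)"
proof -
  interpret T: prob_space "\<Pi>\<^sub>M j\<in>(UNIV :: nat set). measure_pmf T"
    by (intro prob_space_PiM prob_space_measure_pmf)
  interpret prob_space "measure_pmf L \<Otimes>\<^sub>M (\<Pi>\<^sub>M j\<in>(UNIV :: nat set). measure_pmf T)"
    by (intro prob_space_pair prob_space_measure_pmf T.prob_space_axioms)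
  show ?thesis
    unfolding random_sum_law_def by (intro real_distribution_distr) measurable
qed

end

theory Submission
  imports Defs "HOL-Real_Asymp.Real_Asymp"
begin

text \<open>
  Write \<open>C\<^sub>j\<close> for the number of attributes shared by \<open>v\<^sub>1\<close> and \<open>v\<^sub>j\<close>. The degree of \<open>v\<^sub>1\<close> is
  \<open>d = \<Sum>\<^sub>j [C\<^sub>j > 0]\<close>, which depends on the attributes jointly, whereas the count
  with multiplicity \<open>S = \<Sum>\<^sub>j C\<^sub>j\<close> is a sum over attributes: given the vertex weights \<open>Y\<close>, the contributions of the \<open>m\<close>
  attributes to \<open>S\<close> are independent and identically distributed. Hence, for \<open>\<bar>z\<bar> \<le> 1\<close>,

    \<open>E (z ^ S | Y) = (1 - \<phi>) ^ m\<close>, where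
    \<open>\<phi> = E (q(X, Y\<^sub>1) (1 - \<Prod>\<^sub>j (1 - (1 - z) q(X, Y\<^sub>j))) | Y)\<close>

  and \<open>q(x, y)\<close> is the link probability. Replacing \<open>d\<close> by \<open>S\<close> costs at most twice \<open>E (S - d | Y)\<close>.
  Given \<open>Y\<close>, each \<open>C\<^sub>j\<close> is binomial, so with \<open>t\<^sub>j = E (C\<^sub>j | Y) \<le> a\<^sub>2 Y\<^sub>1 Y\<^sub>j / n\<close> this expectation is at most
  \<open>\<Sum>\<^sub>j (t\<^sub>j - 1 + exp (- t\<^sub>j))\<close>. The summands are at most \<open>t\<^sub>j\<close> and at most \<open>t\<^sub>j\<^sup>2\<close>; the first bound
  dominates with only a first moment of \<open>Y\<close>, and the second shows that the sum vanishes in the limit.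

  It remains to find the limit of \<open>m \<phi>\<close>. Put \<open>r = sqrt (m / n)\<close>. Up to truncation at 1, the product
  \<open>m q(x, Y\<^sub>1)\<close> is \<open>r x Y\<^sub>1\<close>, and \<open>r \<Sum>\<^sub>j q(x, Y\<^sub>j)\<close> is \<open>x\<close> times the average of the \<open>Y\<^sub>j\<close>, which converges
  to \<open>b\<^sub>1\<close> in mean by the weak law of large numbers. So \<open>m \<phi>\<close> is close to
  \<open>Y\<^sub>1 E (X r (1 - exp (- (1 - z) X b\<^sub>1 / r)))\<close>, and the three regimes differ only in the limit of
  \<open>r (1 - exp (- (1 - z) x b\<^sub>1 / r))\<close>: the same expression at \<open>r = sqrt \<beta>\<close> if \<open>m / n \<longlonglongrightarrow> \<beta>\<close>, and the linear
  function \<open>(1 - z) x b\<^sub>1\<close> if \<open>m / n\<close> tends to infinity. This is \<open>degree_generating_function_limit\<close>.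

  At \<open>z = exp (\<i> t)\<close> these are characteristic functions, so Levy's continuity theorem turns the
  convergence into weak convergence, once the limit is recognised as the characteristic function of
  the claimed law (\<open>char_d_star_law\<close> and \<open>mixed_poisson_generating_function\<close>). If \<open>m / n \<longlonglongrightarrow> 0\<close>, then
  \<open>z = 0\<close> suffices: \<open>d = 0\<close> exactly when \<open>S = 0\<close>, and \<open>\<bar>m \<phi>\<bar>\<close> is at most \<open>2 r Y\<^sub>1 E X\<close>
  (\<open>isolated_vertex_limit\<close>).
\<close>

section \<open>The degree of one vertex for given weights\<close>

text \<open>
  The version of \<open>expectation_prod_Pi_pmf\<close> for values that need not be nonnegative reals; generating
  functions at points of the unit circle require it.
\<close>

lemma expectation_prod_Pi_pmf_field:
  fixes f :: "'a \<Rightarrow> 'b \<Rightarrow> 'c :: {real_normed_field, banach, second_countable_topology}"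
  assumes fin: "finite A" and int: "\<And>x. x \<in> A \<Longrightarrow> finite (set_pmf (p x))"
  shows "measure_pmf.expectation (Pi_pmf A dflt p) (\<lambda>h. \<Prod>x\<in>A. f x (h x)) =
           (\<Prod>x\<in>A. measure_pmf.expectation (p x) (f x))"
proof -
  have comp: "map_pmf (\<lambda>h. h x) (Pi_pmf A dflt p) = p x" if "x \<in> A" for x
    using Pi_pmf_component[OF fin, of x dflt p] that by simp
  have int': "integrable (measure_pmf (Pi_pmf A dflt p)) (\<lambda>h. f x (h x))" if "x \<in> A" for x
    using integrable_measure_pmf_finite[OF int[OF that], of "f x"]
    unfolding comp[OF that, symmetric] by (simp only: integrable_map_pmf_eq)
  have "measure_pmf.expectation (Pi_pmf A dflt p) (\<lambda>h. \<Prod>x\<in>A. f x (h x)) =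
      (\<Prod>x\<in>A. measure_pmf.expectation (Pi_pmf A dflt p) (\<lambda>h. f x (h x)))"
    by (intro prob_space.indep_vars_lebesgue_integral[OF prob_space_measure_pmf] fin int'
        prob_space.indep_vars_compose2[OF prob_space_measure_pmf indep_vars_Pi_pmf[OF fin]]) auto
  also have "\<dots> = (\<Prod>x\<in>A. measure_pmf.expectation (p x) (f x))"
  proof (rule prod.cong[OF refl])
    fix x assume "x \<in> A"
    show "measure_pmf.expectation (Pi_pmf A dflt p) (\<lambda>h. f x (h x)) =
        measure_pmf.expectation (p x) (f x)"
      unfolding comp[OF \<open>x \<in> A\<close>, symmetric] by (simp only: integral_map_pmf)
  qed
  finally show ?thesis .
qed

lemma integral_bernoulli_pmf_vector:
  fixes f :: "bool \<Rightarrow> 'b :: {banach, second_countable_topology}"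
  assumes "0 \<le> p" "p \<le> 1"
  shows "measure_pmf.expectation (bernoulli_pmf p) f = p *\<^sub>R f True + (1 - p) *\<^sub>R f False"
  using assms by (subst integral_measure_pmf[of UNIV]) (auto simp: UNIV_bool)

definition link_pmf :: "nat \<Rightarrow> nat \<Rightarrow> (nat \<Rightarrow> nat \<Rightarrow> real) \<Rightarrow> (nat \<times> nat \<Rightarrow> bool) pmf" where
  "link_pmf n m p = Pi_pmf ({1..m} \<times> {1..n}) False (\<lambda>(i, j). bernoulli_pmf (p i j))"

definition shared_attributes :: "nat \<Rightarrow> (nat \<times> nat \<Rightarrow> bool) \<Rightarrow> nat \<Rightarrow> nat" where
  "shared_attributes m h j = (\<Sum>i=1..m. of_bool (h (i, 1) \<and> h (i, j)))"

lemma finite_set_link_pmf: "finite (set_pmf (link_pmf n m p))"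
proof (rule finite_subset)
  show "set_pmf (link_pmf n m p) \<subseteq> PiE_dflt ({1..m} \<times> {1..n}) False (\<lambda>_. UNIV)"
    unfolding link_pmf_def using set_Pi_pmf_subset[of "{1..m} \<times> {1..n}" False]
    by (fastforce simp: PiE_dflt_def)
qed (intro finite_PiE_dflt, auto)

lemma integrable_link_pmf [simp]:
  fixes f :: "_ \<Rightarrow> 'b :: {banach, second_countable_topology}"
  shows "integrable (measure_pmf (link_pmf n m p)) f"
  by (rule integrable_measure_pmf_finite[OF finite_set_link_pmf])

lemma shared_attributes_pos_iff:
  "0 < shared_attributes m h j \<longleftrightarrow> (\<exists>i\<in>{1..m}. h (i, 1) \<and> h (i, j))"
  unfolding shared_attributes_def neq0_conv[symmetric]
  by (subst sum_eq_0_iff) (simp_all del: neq0_conv)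

lemma graph_degree_eq_sum:
  assumes h: "h \<in> set_pmf (link_pmf n m p)"
  shows "graph_degree n (intersection_graph n {e. h e}) 1 =
           (\<Sum>j=2..n. of_bool (0 < shared_attributes m h j))"
proof -
  have supp: "w \<in> {1..m}" if "h (w, j)" for w j
    using h that set_Pi_pmf_subset[of "{1..m} \<times> {1..n}" False "\<lambda>(i, j). bernoulli_pmf (p i j)"]
    unfolding link_pmf_def by fastforce
  have "{u \<in> {1..n}. {1, u} \<in> intersection_graph n {e. h e}} =
      {u \<in> {2..n}. 0 < shared_attributes m h u}"
  proof (intro Collect_cong iffI; elim conjE)
    fix u assume u: "u \<in> {1..n}" "{1, u} \<in> intersection_graph n {e. h e}"
    then obtain w where "u \<noteq> 1" "h (w, 1)" "h (w, u)"
      unfolding intersection_graph_def by (auto simp: doubleton_eq_iff)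
    with u supp show "u \<in> {2..n} \<and> 0 < shared_attributes m h u"
      unfolding shared_attributes_pos_iff by auto
  next
    fix u assume u: "u \<in> {2..n}" "0 < shared_attributes m h u"
    then obtain w where "h (w, 1)" "h (w, u)"
      unfolding shared_attributes_pos_iff by blast
    then have "\<exists>w. (w, 1) \<in> {e. h e} \<and> (w, u) \<in> {e. h e}" by auto
    moreover have "1 \<in> {1..n}" "u \<in> {1..n}" "1 \<noteq> u" using u by auto
    ultimately show "u \<in> {1..n} \<and> {1, u} \<in> intersection_graph n {e. h e}"
      unfolding intersection_graph_def by blast
  qed
  then show ?thesis
    unfolding graph_degree_def by (simp add: sum.If_cases of_bool_def Int_def)
qed

text \<open>
  Rewriting the degree inside an expectation as the number of \<open>v\<^sub>j\<close> that share an attribute with \<open>v\<^sub>1\<close>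
  is legitimate because links outside the index rectangle have probability 0.
\<close>

lemma expectation_graph_degree:
  fixes f :: "nat \<Rightarrow> 'b :: {banach, second_countable_topology}"
  shows "measure_pmf.expectation (link_pmf n m p)
           (\<lambda>h. f (graph_degree n (intersection_graph n {e. h e}) 1)) =
         measure_pmf.expectation (link_pmf n m p)
           (\<lambda>h. f (\<Sum>j=2..n. of_bool (0 < shared_attributes m h j)))"
proof (rule integral_cong_AE)
  show "AE h in measure_pmf (link_pmf n m p).
      f (graph_degree n (intersection_graph n {e. h e}) 1) =
      f (\<Sum>j=2..n. of_bool (0 < shared_attributes m h j))"
  proof (rule AE_pmfI)
    fix h assume h: "h \<in> set_pmf (link_pmf n m p)"
    show "f (graph_degree n (intersection_graph n {e. h e}) 1) =
      f (\<Sum>j=2..n. of_bool (0 < shared_attributes m h j))"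
      by (simp only: graph_degree_eq_sum[OF h])
  qed
qed simp_all

text \<open>
  The rows of the link matrix are independent, and row \<open>i\<close> contributes
  \<open>\<Prod>\<^sub>j z\<^sub>j ^ [w\<^sub>i ~ v\<^sub>1 and w\<^sub>i ~ v\<^sub>j]\<close>. Allowing a different \<open>z\<^sub>j\<close> for each vertex yields both the
  generating function of \<open>S = \<Sum>\<^sub>j C\<^sub>j\<close> (all \<open>z\<^sub>j\<close> equal) and the probability of sharing no attribute
  with one given vertex (\<open>z\<^sub>j = 0\<close> for this vertex and 1 otherwise).
\<close>

lemma expectation_prod_shared_attributes:
  fixes z :: "nat \<Rightarrow> complex"
  assumes p: "\<And>i j. 0 \<le> p i j" "\<And>i j. p i j \<le> 1"
  shows "measure_pmf.expectation (link_pmf n m p) (\<lambda>h. \<Prod>j=2..n. z j ^ shared_attributes m h j) =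
           (\<Prod>i=1..m. 1 - p i 1 * (1 - (\<Prod>j=2..n. 1 - (1 - z j) * p i j)))"
proof (cases "n = 0")
  case True
  then show ?thesis by simp
next
  case False
  let ?I = "{1..m}" and ?J = "{2..n}"
  let ?L = "\<lambda>N i. of_bool (i \<in> N) :: complex"
  \<comment> \<open>Expand every row over the two cases of the link (i, 1). For a fixed set N of the rows with
    this link, the product over all rows is a product over all links.\<close>
  define F where "F N i j b = (if j = 1 then of_bool (b = (i \<in> N))
     else if i \<in> N \<and> b then z j else 1)" for N :: "nat set" and i j :: nat and b
  have J: "{1..n} = insert 1 ?J" using False by auto
  have row: "(\<Prod>j=1..n. F N i j (h (i, j))) =
      (if i \<in> N then of_bool (h (i, 1)) * (\<Prod>j\<in>?J. if h (i, j) then z j else 1)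
       else 1 - of_bool (h (i, 1)))" for N i h
    unfolding J by (subst prod.insert) (auto simp: F_def intro!: prod.cong)
  have rowE: "(\<Prod>j=1..n. measure_pmf.expectation (bernoulli_pmf (p i j)) (F N i j)) =
      (if i \<in> N then p i 1 * (\<Prod>j\<in>?J. 1 - (1 - z j) * p i j) else 1 - p i 1)" for N i
  proof -
    have first: "measure_pmf.expectation (bernoulli_pmf (p i 1)) (F N i 1) =
        (if i \<in> N then of_real (p i 1) else 1 - of_real (p i 1))"
      using p by (simp add: F_def integral_bernoulli_pmf_vector scaleR_conv_of_real)
    have other: "measure_pmf.expectation (bernoulli_pmf (p i j)) (F N i j) =
        (if i \<in> N then 1 - (1 - z j) * of_real (p i j) else 1)" if "j \<in> ?J" for j
    proof -
      have "j \<noteq> 1" using that by auto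
      then show ?thesis
        using p by (simp add: F_def integral_bernoulli_pmf_vector scaleR_conv_of_real algebra_simps)
    qed
    have "(\<Prod>j\<in>?J. measure_pmf.expectation (bernoulli_pmf (p i j)) (F N i j)) =
        (\<Prod>j\<in>?J. if i \<in> N then 1 - (1 - z j) * of_real (p i j) else 1)"
      by (rule prod.cong[OF refl other])
    then show ?thesis
      unfolding J by (subst prod.insert, simp, simp, simp only: first) simp
  qed
  have split: "(\<Prod>i\<in>?I. u i + v i) = (\<Sum>N\<in>Pow ?I. \<Prod>i\<in>?I. if i \<in> N then u i else v i)"
    for u v :: "nat \<Rightarrow> complex"
  proof -
    have "(\<Prod>i\<in>?I. if i \<in> N then u i else v i) = prod u N * prod v (?I - N)" if "N \<in> Pow ?I" for N
    proof -
      have "?I \<inter> {i. i \<in> N} = N" "?I \<inter> - {i. i \<in> N} = ?I - N" using that by auto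
      then show ?thesis by (simp add: prod.If_cases)
    qed
    then show ?thesis by (simp add: prod_add)
  qed
  have "(\<Prod>j\<in>?J. z j ^ shared_attributes m h j) =
      (\<Sum>N\<in>Pow ?I. \<Prod>e\<in>?I \<times> {1..n}. F N (fst e) (snd e) (h e))" for h
  proof -
    have "(\<Prod>j\<in>?J. z j ^ shared_attributes m h j) =
        (\<Prod>i\<in>?I. \<Prod>j\<in>?J. z j ^ of_bool (h (i, 1) \<and> h (i, j)))"
      unfolding shared_attributes_def power_sum by (rule prod.swap)
    also have "\<dots> = (\<Prod>i\<in>?I. of_bool (h (i, 1)) * (\<Prod>j\<in>?J. if h (i, j) then z j else 1) +
        (1 - of_bool (h (i, 1))))"
      by (intro prod.cong refl) (auto intro!: prod.cong)
    also have "\<dots> = (\<Sum>N\<in>Pow ?I. \<Prod>i\<in>?I. \<Prod>j=1..n. F N i j (h (i, j)))"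
      unfolding split row ..
    finally show ?thesis
      by (simp add: prod.cartesian_product split_beta)
  qed
  then have "measure_pmf.expectation (link_pmf n m p) (\<lambda>h. \<Prod>j\<in>?J. z j ^ shared_attributes m h j) =
      (\<Sum>N\<in>Pow ?I. measure_pmf.expectation (link_pmf n m p)
        (\<lambda>h. \<Prod>e\<in>?I \<times> {1..n}. F N (fst e) (snd e) (h e)))"
    by (simp add: Bochner_Integration.integral_sum)
  also have "\<dots> = (\<Sum>N\<in>Pow ?I. \<Prod>e\<in>?I \<times> {1..n}.
      measure_pmf.expectation (bernoulli_pmf (p (fst e) (snd e))) (F N (fst e) (snd e)))"
    unfolding link_pmf_def split_beta
    by (intro sum.cong refl expectation_prod_Pi_pmf_field finite_cartesian_product finite_atLeastAtMost)
      (rule finite_subset[OF subset_UNIV], simp)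
  also have "\<dots> = (\<Sum>N\<in>Pow ?I. \<Prod>i\<in>?I. \<Prod>j=1..n.
      measure_pmf.expectation (bernoulli_pmf (p i j)) (F N i j))"
    by (simp add: prod.cartesian_product split_beta)
  also have "\<dots> = (\<Prod>i\<in>?I. p i 1 * (\<Prod>j\<in>?J. 1 - (1 - z j) * p i j) + (1 - p i 1))"
    unfolding split rowE ..
  finally show ?thesis
    by (simp add: algebra_simps)
qed

lemma expectation_shared_attributes:
  assumes p: "\<And>i j. 0 \<le> p i j" "\<And>i j. p i j \<le> 1" and j: "j \<in> {2..n}"
  shows "measure_pmf.expectation (link_pmf n m p) (\<lambda>h. real (shared_attributes m h j)) =
           (\<Sum>i=1..m. p i 1 * p i j)"
proof -
  have "measure_pmf.expectation (link_pmf n m p) (\<lambda>h. of_bool (h (i, 1) \<and> h (i, j))) =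
      p i 1 * p i j" if i: "i \<in> {1..m}" for i
  proof -
    let ?I = "{1..m} \<times> {1..n}" and ?E = "{(i, 1), (i, j)}"
    have E: "?I \<inter> {e. e \<in> ?E} = ?E" using i j by auto
    have "(\<Prod>e\<in>?I. if e \<in> ?E then g e else 1) = g (i, 1) * g (i, j)" for g :: "_ \<Rightarrow> real"
    proof -
      have "(\<Prod>e\<in>?I. if e \<in> ?E then g e else 1) = prod g (?I \<inter> {e. e \<in> ?E})"
        by (subst prod.If_cases) auto
      then show ?thesis using j unfolding E by simp
    qed
    note pr = this
    have "measure_pmf.expectation (link_pmf n m p) (\<lambda>h. of_bool (h (i, 1) \<and> h (i, j))) =
        measure_pmf.expectation (link_pmf n m p)
          (\<lambda>h. \<Prod>e\<in>?I. (\<lambda>b. if e \<in> ?E then of_bool b else 1 :: real) (h e))"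
      unfolding pr by (simp add: of_bool_conj)
    also have "\<dots> = (\<Prod>e\<in>?I. measure_pmf.expectation (bernoulli_pmf (p (fst e) (snd e)))
        (\<lambda>b. if e \<in> ?E then of_bool b else 1))"
      unfolding link_pmf_def split_beta
      by (intro expectation_prod_Pi_pmf_field finite_cartesian_product finite_atLeastAtMost)
        (rule finite_subset[OF subset_UNIV], simp)
    also have "\<dots> = (\<Prod>e\<in>?I. if e \<in> ?E then p (fst e) (snd e) else 1)"
      using p by (intro prod.cong refl) simp
    also have "\<dots> = p i 1 * p i j"
      unfolding pr by simp
    finally show ?thesis .
  qed
  then show ?thesis
    by (simp add: shared_attributes_def of_nat_sum Bochner_Integration.integral_sum
        del: sum_of_bool_eq)
qed

text \<open>
  Two powers of \<open>z\<close> with \<open>\<bar>z\<bar> \<le> 1\<close> differ by at most 2, and \<open>c - [c > 0] \<ge> 1\<close> as soon as \<open>c \<ge> 2\<close>.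
\<close>

lemma norm_prod_of_bool_power_diff_le:
  fixes z :: complex
  assumes z: "norm z \<le> 1"
  shows "norm (z ^ (\<Sum>j\<in>J. of_bool (0 < c j)) - z ^ (\<Sum>j\<in>J. c j))
           \<le> 2 * (\<Sum>j\<in>J. real (c j) - of_bool (0 < c j))"
proof -
  have "norm (z ^ (\<Sum>j\<in>J. of_bool (0 < c j)) - z ^ (\<Sum>j\<in>J. c j)) =
      norm ((\<Prod>j\<in>J. z ^ of_bool (0 < c j)) - (\<Prod>j\<in>J. z ^ c j))"
    by (simp only: power_sum)
  also have "\<dots> \<le> (\<Sum>j\<in>J. norm (z ^ of_bool (0 < c j) - z ^ c j))"
    using z by (intro norm_prod_diff) (auto simp: norm_power power_le_one)
  also have "\<dots> \<le> (\<Sum>j\<in>J. 2 * (real (c j) - of_bool (0 < c j)))"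
  proof (rule sum_mono)
    fix j
    have le: "norm (z ^ of_bool (0 < c j) - z ^ c j) \<le> 1 + 1"
      by (rule order_trans[OF norm_triangle_ineq4])
        (use z in \<open>intro add_mono; simp only: norm_power; intro power_le_one; simp\<close>)
    show "norm (z ^ of_bool (0 < c j) - z ^ c j) \<le> 2 * (real (c j) - of_bool (0 < c j))"
    proof (cases "c j \<le> 1")
      case True
      then have "c j = 0 \<or> c j = 1" by auto
      then show ?thesis by auto
    next
      case False
      then show ?thesis using le by auto
    qed
  qed
  finally show ?thesis
    by (simp only: sum_distrib_left)
qed

text \<open>
  The right-hand side is twice the expected overcount
  \<open>E (\<Sum>\<^sub>j (C\<^sub>j - [C\<^sub>j > 0])) = \<Sum>\<^sub>j (E C\<^sub>j - 1 + P (C\<^sub>j = 0))\<close>.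
\<close>

lemma norm_expectation_degree_power_diff_le:
  fixes z :: complex
  assumes p: "\<And>i j. 0 \<le> p i j" "\<And>i j. p i j \<le> 1" and z: "norm z \<le> 1"
  shows "norm (measure_pmf.expectation (link_pmf n m p)
             (\<lambda>h. z ^ graph_degree n (intersection_graph n {e. h e}) 1) -
           (\<Prod>i=1..m. 1 - p i 1 * (1 - (\<Prod>j=2..n. 1 - (1 - z) * p i j))))
         \<le> 2 * (\<Sum>j=2..n. (\<Sum>i=1..m. p i 1 * p i j) - 1 + (\<Prod>i=1..m. 1 - p i 1 * p i j))"
proof -
  let ?E = "measure_pmf.expectation (link_pmf n m p)" and ?C = "shared_attributes m"
  let ?d = "\<lambda>h. \<Sum>j=2..n. of_bool (0 < ?C h j) :: nat"
  have zero: "?E (\<lambda>h. of_bool (0 < ?C h j)) = 1 - (\<Prod>i=1..m. 1 - p i 1 * p i j)"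
    if j: "j \<in> {2..n}" for j
  proof -
    \<comment> \<open>The product over k is then the indicator of sharing no attribute with vertex j.\<close>
    define w :: "nat \<Rightarrow> complex" where "w k = of_bool (k \<noteq> j)" for k
    have w: "(\<Prod>k=2..n. f k) = f j" if "\<And>k. k \<noteq> j \<Longrightarrow> f k = 1" for f :: "nat \<Rightarrow> complex"
      using prod.remove[OF _ j, of f] that by simp
    have "complex_of_real (?E (\<lambda>h. of_bool (0 < ?C h j))) =
        ?E (\<lambda>h. 1 - (\<Prod>k=2..n. w k ^ ?C h k))"
      by (subst integral_complex_of_real[symmetric], intro Bochner_Integration.integral_cong refl,
          subst w) (auto simp: w_def power_0_left)
    also have "\<dots> = 1 - ?E (\<lambda>h. \<Prod>k=2..n. w k ^ ?C h k)"
      by (subst Bochner_Integration.integral_diff) (simp_all add: measure_pmf.prob_space)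
    also have "\<dots> = complex_of_real (1 - (\<Prod>i=1..m. 1 - p i 1 * p i j))"
      by (subst expectation_prod_shared_attributes[OF p], subst w) (simp_all add: w_def)
    finally show ?thesis
      by (simp only: of_real_eq_iff)
  qed
  have "(\<Prod>i=1..m. 1 - p i 1 * (1 - (\<Prod>j=2..n. 1 - (1 - z) * p i j))) =
      ?E (\<lambda>h. z ^ (\<Sum>j=2..n. ?C h j))"
    by (simp only: power_sum expectation_prod_shared_attributes[OF p, where z = "\<lambda>_. z"])
  moreover have "?E (\<lambda>h. z ^ graph_degree n (intersection_graph n {e. h e}) 1) = ?E (\<lambda>h. z ^ ?d h)"
    by (rule expectation_graph_degree[where f = "\<lambda>k. z ^ k"])
  ultimately have "norm (?E (\<lambda>h. z ^ graph_degree n (intersection_graph n {e. h e}) 1) -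
        (\<Prod>i=1..m. 1 - p i 1 * (1 - (\<Prod>j=2..n. 1 - (1 - z) * p i j)))) =
      norm (?E (\<lambda>h. z ^ ?d h - z ^ (\<Sum>j=2..n. ?C h j)))"
    by simp
  also have "\<dots> \<le> ?E (\<lambda>h. norm (z ^ ?d h - z ^ (\<Sum>j=2..n. ?C h j)))"
    by (rule integral_norm_bound)
  also have "\<dots> \<le> ?E (\<lambda>h. 2 * (\<Sum>j=2..n. real (?C h j) - of_bool (0 < ?C h j)))"
    by (intro integral_mono norm_prod_of_bool_power_diff_le z) simp_all
  also have "\<dots> = 2 * (\<Sum>j=2..n. ?E (\<lambda>h. real (?C h j)) - ?E (\<lambda>h. of_bool (0 < ?C h j)))"
    by (simp add: Bochner_Integration.integral_sum del: sum_of_bool_eq)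
  also have "\<dots> = 2 * (\<Sum>j=2..n. (\<Sum>i=1..m. p i 1 * p i j) - (1 - (\<Prod>i=1..m. 1 - p i 1 * p i j)))"
    by (intro arg_cong2[where f = "(*)"] sum.cong refl)
      (simp only: expectation_shared_attributes[OF p] zero)
  finally show ?thesis
    by (simp add: algebra_simps)
qed

text \<open>
  Exact, because the degree vanishes if and only if all the numbers of shared attributes do.
\<close>

lemma expectation_degree_eq_0:
  assumes p: "\<And>i j. 0 \<le> p i j" "\<And>i j. p i j \<le> 1"
  shows "measure_pmf.expectation (link_pmf n m p)
           (\<lambda>h. 0 ^ graph_degree n (intersection_graph n {e. h e}) 1) =
         (\<Prod>i=1..m. 1 - p i 1 * (1 - (\<Prod>j=2..n. 1 - complex_of_real (p i j))))"
proof -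
  have "measure_pmf.expectation (link_pmf n m p)
           (\<lambda>h. 0 ^ graph_degree n (intersection_graph n {e. h e}) 1) =
        measure_pmf.expectation (link_pmf n m p)
           (\<lambda>h. \<Prod>j=2..n. (0 :: complex) ^ shared_attributes m h j)"
    unfolding expectation_graph_degree[where f = "\<lambda>k. 0 ^ k"]
    by (intro Bochner_Integration.integral_cong refl)
      (simp only: power_sum, auto simp: power_0_left intro!: prod.cong)
  then show ?thesis
    by (simp add: expectation_prod_shared_attributes[OF p, where z = "\<lambda>_. 0"])
qed

section \<open>Averaging over the attribute weights\<close>

text \<open>
  The clamping at 0 makes this a probability for all real weights, so that bounds on link probabilities
  need no side condition on the signs. It agrees with \<open>edge_prob\<close> as the parameter of a Bernoulli law.
\<close>

definition link_prob :: "real \<Rightarrow> real \<Rightarrow> real \<Rightarrow> real" where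
  "link_prob s x y = max 0 (min 1 (x * y / s))"

lemma link_prob_nonneg [simp]: "0 \<le> link_prob s x y"
  and link_prob_le_1 [simp]: "link_prob s x y \<le> 1"
  by (auto simp: link_prob_def)

lemma link_prob_le: "0 < s \<Longrightarrow> link_prob s x y \<le> \<bar>x\<bar> * \<bar>y\<bar> / s"
proof -
  assume "0 < s"
  have "x * y / s \<le> \<bar>x\<bar> * \<bar>y\<bar> / s"
    unfolding abs_mult[symmetric] using \<open>0 < s\<close> by (intro divide_right_mono) simp_all
  moreover have "0 \<le> \<bar>x\<bar> * \<bar>y\<bar> / s" using \<open>0 < s\<close> by simp
  ultimately show ?thesis unfolding link_prob_def by linarith
qed

lemma link_prob_measurable [measurable]:
  assumes [measurable]: "f \<in> borel_measurable M" "g \<in> borel_measurable M"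
  shows "(\<lambda>x. link_prob s (f x) (g x)) \<in> borel_measurable M"
  unfolding link_prob_def by measurable

lemma bipartite_pmf_eq_link_pmf:
  "bipartite_pmf n m X Y =
     map_pmf (\<lambda>h. {e. h e}) (link_pmf n m (\<lambda>i j. link_prob (sqrt (real n * real m)) (X i) (Y j)))"
proof -
  have "edge_prob n m x y = min 1 (x * y / sqrt (real n * real m))" for x y
  proof -
    have "(real n * real m) powr (-1/2) = inverse (sqrt (real n * real m))"
      using powr_minus[of "real n * real m" "1/2"] by (simp add: powr_half_sqrt)
    then show ?thesis by (simp only: edge_prob_def divide_inverse)
  qed
  then have "bernoulli_pmf (edge_prob n m x y) =
      bernoulli_pmf (link_prob (sqrt (real n * real m)) x y)" for x y
    by (intro pmf_eqI) (simp add: bernoulli_pmf.rep_eq link_prob_def)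
  then show ?thesis
    unfolding bipartite_pmf_def link_pmf_def by simp
qed

definition graph_mean :: "(nat set set \<Rightarrow> complex) \<Rightarrow> nat \<Rightarrow> nat \<Rightarrow>
    (nat \<Rightarrow> real) \<Rightarrow> (nat \<Rightarrow> real) \<Rightarrow> complex" where
  "graph_mean f n m X Y =
     measure_pmf.expectation (link_pmf n m (\<lambda>i j. link_prob (sqrt (real n * real m)) (X i) (Y j)))
       (\<lambda>h. f (intersection_graph n {e. h e}))"

lemma norm_graph_mean_le:
  assumes "\<And>E. norm (f E) \<le> B"
  shows "norm (graph_mean f n m X Y) \<le> B"
  unfolding graph_mean_def
  by (rule order_trans[OF integral_norm_bound])
    (intro measure_pmf.integral_le_const AE_pmfI assms, simp)

lemma
  assumes "real_distribution P1" "real_distribution P2"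
  shows borel_measurable_graph_mean:
      "(\<lambda>(X, Y). graph_mean f n m X Y) \<in> borel_measurable (weights P1 P2 n m)"
    and integrable_graph_mean:
      "(\<And>E. norm (f E) \<le> B) \<Longrightarrow>
        integrable (\<Pi>\<^sub>M j\<in>{1..n}. P2) (\<lambda>Y. \<integral>X. graph_mean f n m X Y \<partial>(\<Pi>\<^sub>M i\<in>{1..m}. P1))"
    and integral_rig:
      "(\<And>E. norm (f E) \<le> B) \<Longrightarrow>
        (\<integral>E. f E \<partial>rig P1 P2 n m) =
        (\<integral>Y. (\<integral>X. graph_mean f n m X Y \<partial>(\<Pi>\<^sub>M i\<in>{1..m}. P1)) \<partial>(\<Pi>\<^sub>M j\<in>{1..n}. P2))"
proof -
  interpret P1: real_distribution P1 by fact
  interpret P2: real_distribution P2 by fact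
  let ?W1 = "\<Pi>\<^sub>M i\<in>{1..m}. P1" and ?W2 = "\<Pi>\<^sub>M j\<in>{1..n}. P2"
  interpret W1: prob_space ?W1 by (intro prob_space_PiM P1.prob_space_axioms)
  interpret W2: prob_space ?W2 by (intro prob_space_PiM P2.prob_space_axioms)
  interpret W: pair_prob_space ?W1 ?W2 ..
  let ?K = "\<lambda>(X, Y). measure_pmf (map_pmf (intersection_graph n) (bipartite_pmf n m X Y))"
  have K: "?K \<in> weights P1 P2 n m \<rightarrow>\<^sub>M subprob_algebra (count_space UNIV)"
    by (rule measurable_prob_algebraD[OF rig_kernel_measurable]) simp_all
  have mean: "(\<integral>E. f E \<partial>?K \<omega>) = (case \<omega> of (X, Y) \<Rightarrow> graph_mean f n m X Y)"
    for f :: "nat set set \<Rightarrow> complex" and \<omega>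
    by (cases \<omega>) (simp add: bipartite_pmf_eq_link_pmf graph_mean_def)
  show meas: "(\<lambda>(X, Y). graph_mean f n m X Y) \<in> borel_measurable (weights P1 P2 n m)"
    for f :: "nat set set \<Rightarrow> complex"
    using measurable_compose[OF K integral_measurable_subprob_algebra, of f]
    by (simp add: mean)
  assume B: "\<And>E. norm (f E) \<le> B"
  have ReIm: "(\<integral>E. g (f E) \<partial>rig P1 P2 n m) = (\<integral>\<omega>. g (case \<omega> of (X, Y) \<Rightarrow> graph_mean f n m X Y) \<partial>weights P1 P2 n m)"
    if g: "bounded_linear g" "\<And>z. \<bar>g z\<bar> \<le> norm z" for g :: "complex \<Rightarrow> real"
  proof -
    have "(\<integral>E. g (f E) \<partial>rig P1 P2 n m) = (\<integral>\<omega>. (\<integral>E. g (f E) \<partial>?K \<omega>) \<partial>weights P1 P2 n m)"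
      unfolding rig_def
    proof (rule integral_bind[where K = "count_space UNIV" and B = B and B' = 1])
      show "\<bar>g (f E)\<bar> \<le> B" for E using order_trans[OF g(2) B] .
      show "finite_measure (weights P1 P2 n m)"
        unfolding weights_def by unfold_locales
      show "AE \<omega> in weights P1 P2 n m. emeasure (?K \<omega>) (space (?K \<omega>)) \<le> ennreal 1"
        by (auto simp: measure_pmf.emeasure_space_1)
    qed (use K in auto)
    moreover have "(\<integral>E. g (f E) \<partial>?K \<omega>) = g (\<integral>E. f E \<partial>?K \<omega>)" for \<omega>
    proof (rule integral_bounded_linear[OF g(1)])
      show "integrable (?K \<omega>) f"
        by (cases \<omega>) (auto intro!: measure_pmf.integrable_const_bound[where B = B] simp: B)
    qed
    ultimately show ?thesis by (simp only: mean)
  qed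
  have "integrable (rig P1 P2 n m) f"
  proof -
    interpret R: prob_space "rig P1 P2 n m" by (rule prob_space_rig) fact+
    show ?thesis
      using sets_rig[OF assms, of n m]
      by (intro R.integrable_const_bound[where B = B]) (auto simp: B measurable_def)
  qed
  moreover have intW: "integrable (?W1 \<Otimes>\<^sub>M ?W2) (\<lambda>(X, Y). graph_mean f n m X Y)"
    using meas[of f] unfolding weights_def
    by (intro W.integrable_const_bound[where B = B]) (auto intro!: norm_graph_mean_le B)
  moreover show "integrable ?W2 (\<lambda>Y. \<integral>X. graph_mean f n m X Y \<partial>?W1)"
    by (rule W.integrable_snd[OF intW])
  ultimately have "(\<integral>E. f E \<partial>rig P1 P2 n m) =
      (\<integral>(X, Y). graph_mean f n m X Y \<partial>weights P1 P2 n m)"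
    using ReIm[OF bounded_linear_Re abs_Re_le_cmod] ReIm[OF bounded_linear_Im abs_Im_le_cmod]
    by (intro complex_eqI) (simp_all add: weights_def)
  also have "\<dots> = (\<integral>Y. (\<integral>X. graph_mean f n m X Y \<partial>?W1) \<partial>?W2)"
    unfolding weights_def by (rule W.integral_snd[OF intW, symmetric])
  finally show "(\<integral>E. f E \<partial>rig P1 P2 n m) = (\<integral>Y. (\<integral>X. graph_mean f n m X Y \<partial>?W1) \<partial>?W2)" .
qed

lemma integral_prod_attribute_weights:
  fixes f :: "nat \<Rightarrow> real \<Rightarrow> 'b :: {real_normed_field, banach, second_countable_topology}"
  assumes "real_distribution P1" and "\<And>i. i \<in> I \<Longrightarrow> integrable P1 (f i)" and "finite I"
  shows "(\<integral>X. (\<Prod>i\<in>I. f i (X i)) \<partial>(\<Pi>\<^sub>M i\<in>I. P1)) = (\<Prod>i\<in>I. \<integral>x. f i x \<partial>P1)"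
proof -
  interpret P1: real_distribution P1 by fact
  interpret product_prob_space "\<lambda>_ :: nat. P1" ..
  show ?thesis using assms by (intro product_integral_prod)
qed

lemma
  fixes f :: "'a \<Rightarrow> 'b :: {banach, second_countable_topology}"
  assumes P: "prob_space P" and i: "i \<in> I" and f: "f \<in> borel_measurable P"
  shows integral_PiM_component: "(\<integral>X. f (X i) \<partial>(\<Pi>\<^sub>M i\<in>I. P)) = (\<integral>x. f x \<partial>P)"
    and integrable_PiM_component_iff:
      "integrable (\<Pi>\<^sub>M i\<in>I. P) (\<lambda>X. f (X i)) \<longleftrightarrow> integrable P f"
proof -
  have d: "distr (\<Pi>\<^sub>M i\<in>I. P) P (\<lambda>X. X i) = P"
    by (intro distr_PiM_component i P)
  have mi: "(\<lambda>X. X i) \<in> (\<Pi>\<^sub>M i\<in>I. P) \<rightarrow>\<^sub>M P" using i by simp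
  show "(\<integral>X. f (X i) \<partial>(\<Pi>\<^sub>M i\<in>I. P)) = (\<integral>x. f x \<partial>P)"
    using integral_distr[OF mi f] unfolding d by simp
  show "integrable (\<Pi>\<^sub>M i\<in>I. P) (\<lambda>X. f (X i)) \<longleftrightarrow> integrable P f"
    using integrable_distr_eq[OF mi f] unfolding d by simp
qed

text \<open>
  Two vertices of weights \<open>y\<close> and \<open>y'\<close> are both linked to a given attribute with this probability.
\<close>

definition path_prob :: "real measure \<Rightarrow> real \<Rightarrow> real \<Rightarrow> real \<Rightarrow> real" where
  "path_prob P1 s y y' = (\<integral>x. link_prob s x y * link_prob s x y' \<partial>P1)"

text \<open>
  This is \<open>\<phi>\<close> in the overview: 1 minus the generating function, given \<open>Y\<close>, of the contribution of a
  single attribute to \<open>S = \<Sum>\<^sub>j C\<^sub>j\<close>.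
\<close>

definition attribute_effect :: "real measure \<Rightarrow> real \<Rightarrow> nat \<Rightarrow> complex \<Rightarrow> (nat \<Rightarrow> real) \<Rightarrow> complex" where
  "attribute_effect P1 s n z Y =
     (\<integral>x. complex_of_real (link_prob s x (Y 1)) *
        (1 - (\<Prod>j=2..n. 1 - (1 - z) * complex_of_real (link_prob s x (Y j)))) \<partial>P1)"

text \<open>
  A convex combination of 1 and \<open>z\<close>.
\<close>

lemma norm_thin_le_1:
  fixes z :: complex
  assumes "norm z \<le> 1" "0 \<le> p" "p \<le> 1"
  shows "norm (1 - (1 - z) * of_real p) \<le> 1"
proof -
  have "1 - (1 - z) * of_real p = of_real (1 - p) + z * of_real p" by (simp add: algebra_simps)
  also have "norm \<dots> \<le> (1 - p) + 1 * p"
    by (intro order_trans[OF norm_triangle_ineq] add_mono)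
      (use assms in \<open>simp_all add: norm_mult mult_left_le_one_le del: of_real_diff\<close>)
  finally show ?thesis by simp
qed

lemma norm_attribute_factor_le_1:
  fixes z :: complex
  assumes z: "norm z \<le> 1"
  shows "norm (1 - complex_of_real (link_prob s x (Y 1)) *
    (1 - (\<Prod>j=2..n. 1 - (1 - z) * complex_of_real (link_prob s x (Y j))))) \<le> 1"
proof -
  have "norm (\<Prod>j=2..n. 1 - (1 - z) * link_prob s x (Y j)) \<le> (\<Prod>j=2..n. 1)"
    unfolding prod_norm[symmetric] by (intro prod_mono) (auto intro!: norm_thin_le_1 z)
  then show ?thesis
    using norm_thin_le_1[of "\<Prod>j=2..n. 1 - (1 - z) * link_prob s x (Y j)" "link_prob s x (Y 1)"]
    by (simp add: mult.commute)
qed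

lemma
  assumes P1: "real_distribution P1" and z: "norm z \<le> 1"
  shows integrable_attribute_factor:
    "integrable P1 (\<lambda>x. 1 - complex_of_real (link_prob s x (Y 1)) *
      (1 - (\<Prod>j=2..n. 1 - (1 - z) * complex_of_real (link_prob s x (Y j)))))" (is "integrable P1 ?u")
    and integral_attribute_factor:
    "(\<integral>x. 1 - complex_of_real (link_prob s x (Y 1)) *
      (1 - (\<Prod>j=2..n. 1 - (1 - z) * complex_of_real (link_prob s x (Y j)))) \<partial>P1) =
      1 - attribute_effect P1 s n z Y"
    and norm_one_minus_attribute_effect_le_1: "norm (1 - attribute_effect P1 s n z Y) \<le> 1"
proof -
  interpret P1: real_distribution P1 by fact
  show int_u: "integrable P1 ?u"
    by (intro P1.integrable_const_bound[where B = 1] AE_I2 norm_attribute_factor_le_1 z) simp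
  have "attribute_effect P1 s n z Y = (\<integral>x. 1 - ?u x \<partial>P1)"
    unfolding attribute_effect_def by simp
  also have "\<dots> = 1 - (\<integral>x. ?u x \<partial>P1)"
    using Bochner_Integration.integral_diff[OF P1.integrable_const[of 1] int_u] P1.prob_space
    by (simp only: lebesgue_integral_const scaleR_one)
  finally show E: "(\<integral>x. ?u x \<partial>P1) = 1 - attribute_effect P1 s n z Y"
    by (simp only: diff_diff_eq2 add_diff_cancel_left')
  show "norm (1 - attribute_effect P1 s n z Y) \<le> 1"
    unfolding E[symmetric]
    by (rule order_trans[OF integral_norm_bound])
      (intro P1.integral_le_const AE_I2 norm_attribute_factor_le_1 z integrable_norm int_u)
qed

text \<open>
  Averaging over the independent attribute weights turns the products over the attributes into \<open>m\<close>-th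
  powers. The summands on the right are the expected overcounts of binomial variables with parameters
  \<open>m\<close> and \<open>path_prob P1 s (Y 1) (Y j)\<close>.
\<close>

lemma norm_graph_mean_degree_diff_le:
  assumes P1: "real_distribution P1" and P2: "real_distribution P2"
    and Y: "Y \<in> space (\<Pi>\<^sub>M j\<in>{1..n}. P2)"
    and z: "norm z \<le> 1" and s: "s = sqrt (real n * real m)"
  shows "norm ((\<integral>X. graph_mean (\<lambda>E. z ^ graph_degree n E 1) n m X Y \<partial>(\<Pi>\<^sub>M i\<in>{1..m}. P1)) -
            (1 - attribute_effect P1 s n z Y) ^ m)
         \<le> 2 * (\<Sum>j=2..n. m * path_prob P1 s (Y 1) (Y j) - 1 + (1 - path_prob P1 s (Y 1) (Y j)) ^ m)"
proof -
  interpret P1: real_distribution P1 by fact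
  let ?W = "\<Pi>\<^sub>M i\<in>{1..m}. P1"
  interpret W: prob_space ?W by (intro prob_space_PiM P1.prob_space_axioms)
  have P1_UNIV: "measure P1 UNIV = 1" using P1.prob_space by simp
  let ?q = "link_prob s"
  have Xi: "(\<lambda>X. X i) \<in> borel_measurable ?W" if "i \<in> {1..m}" for i
    using measurable_component_singleton[OF that, of "\<lambda>_. P1"] by (simp cong: measurable_cong_sets)
  let ?G = "\<lambda>X. graph_mean (\<lambda>E. z ^ graph_degree n E 1) n m X Y"
  let ?u = "\<lambda>x. 1 - complex_of_real (?q x (Y 1)) *
      (1 - (\<Prod>j=2..n. 1 - (1 - z) * complex_of_real (?q x (Y j))))"
  let ?D = "\<lambda>X. 2 * (\<Sum>j=2..n. (\<Sum>i=1..m. ?q (X i) (Y 1) * ?q (X i) (Y j)) - 1 +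
      (\<Prod>i=1..m. 1 - ?q (X i) (Y 1) * ?q (X i) (Y j)))"
  have u1: "norm (?u x) \<le> 1" for x
    by (rule norm_attribute_factor_le_1[OF z])
  note int_u = integrable_attribute_factor[OF P1 z]
  have Eu: "(\<integral>X. (\<Prod>i=1..m. ?u (X i)) \<partial>?W) = (1 - attribute_effect P1 s n z Y) ^ m"
    by (subst integral_prod_attribute_weights[OF P1])
      (rule int_u, simp, unfold integral_attribute_factor[OF P1 z], simp)
  have int_q: "integrable P1 (\<lambda>x. ?q x (Y 1) * ?q x (Y j))" for j
    by (intro P1.integrable_const_bound[where B = 1] AE_I2) (auto intro!: mult_le_one)
  have sumq: "integrable ?W (\<lambda>X. ?q (X i) (Y 1) * ?q (X i) (Y j))"
    "(\<integral>X. ?q (X i) (Y 1) * ?q (X i) (Y j) \<partial>?W) = path_prob P1 s (Y 1) (Y j)"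
    if i: "i \<in> {1..m}" for i j
    unfolding path_prob_def
    using int_q[of j] integrable_PiM_component_iff[OF P1.prob_space_axioms i, of "\<lambda>x. ?q x (Y 1) * ?q x (Y j)"]
      integral_PiM_component[OF P1.prob_space_axioms i, of "\<lambda>x. ?q x (Y 1) * ?q x (Y j)"]
    by simp_all
  have prodq: "integrable ?W (\<lambda>X. \<Prod>i=1..m. 1 - ?q (X i) (Y 1) * ?q (X i) (Y j))"
    "(\<integral>X. (\<Prod>i=1..m. 1 - ?q (X i) (Y 1) * ?q (X i) (Y j)) \<partial>?W) = (1 - path_prob P1 s (Y 1) (Y j)) ^ m" for j
  proof -
    have q2: "\<bar>1 - ?q x (Y (Suc 0)) * ?q x (Y j)\<bar> \<le> 1" for x
      using mult_le_one[OF link_prob_le_1[of s x "Y (Suc 0)"] link_prob_nonneg[of s x "Y j"]]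
        mult_nonneg_nonneg[OF link_prob_nonneg[of s x "Y (Suc 0)"] link_prob_nonneg[of s x "Y j"]]
        link_prob_le_1[of s x "Y j"]
      by linarith
    show "integrable ?W (\<lambda>X. \<Prod>i=1..m. 1 - ?q (X i) (Y 1) * ?q (X i) (Y j))"
      by (intro W.integrable_const_bound[where B = 1] AE_I2)
        (auto simp: prod_norm[symmetric] abs_prod q2 intro!: prod_le_1 borel_measurable_prod
          borel_measurable_diff borel_measurable_times link_prob_measurable Xi)
    show "(\<integral>X. (\<Prod>i=1..m. 1 - ?q (X i) (Y 1) * ?q (X i) (Y j)) \<partial>?W) = (1 - path_prob P1 s (Y 1) (Y j)) ^ m"
      by (subst integral_prod_attribute_weights[OF P1])
        (use int_q in \<open>simp_all add: path_prob_def P1_UNIV\<close>)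
  qed
  have meas_G: "?G \<in> borel_measurable ?W"
    using measurable_compose[OF measurable_Pair2'[OF Y]
        borel_measurable_graph_mean[OF P1 P2, unfolded weights_def]]
    by simp
  have int_G: "integrable ?W ?G"
    by (intro W.integrable_const_bound[where B = 1] AE_I2 norm_graph_mean_le meas_G)
      (use z in \<open>simp add: norm_power power_le_one\<close>)
  have int_pu: "integrable ?W (\<lambda>X. \<Prod>i=1..m. ?u (X i))"
    by (intro W.integrable_const_bound[where B = 1] AE_I2)
      (auto simp: prod_norm[symmetric] intro!: prod_le_1 u1[simplified] borel_measurable_prod
          borel_measurable_diff borel_measurable_times link_prob_measurable Xi)
  have has_D: "has_bochner_integral ?W ?D (2 * (\<Sum>j=2..n. (\<Sum>i=1..m. path_prob P1 s (Y 1) (Y j)) - 1 +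
      (1 - path_prob P1 s (Y 1) (Y j)) ^ m))"
    by (intro has_bochner_integral_mult_right has_bochner_integral_add has_bochner_integral_diff
        has_bochner_integral_sum)
      (use sumq prodq W.prob_space W.integrable_const[of "1 :: real"] in
          \<open>auto simp: has_bochner_integral_iff\<close>)
  have "norm ((\<integral>X. ?G X \<partial>?W) - (1 - attribute_effect P1 s n z Y) ^ m) =
      norm (\<integral>X. ?G X - (\<Prod>i=1..m. ?u (X i)) \<partial>?W)"
    by (simp only: Bochner_Integration.integral_diff[OF int_G int_pu] Eu)
  also have "\<dots> \<le> (\<integral>X. norm (?G X - (\<Prod>i=1..m. ?u (X i))) \<partial>?W)"
    by (rule integral_norm_bound)
  also have "\<dots> \<le> (\<integral>X. ?D X \<partial>?W)"
    using int_G int_pu integrable.intros[OF has_D] unfolding graph_mean_def s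
    by (intro integral_mono) (auto intro!: norm_expectation_degree_power_diff_le[simplified] z)
  also have "\<dots> = 2 * (\<Sum>j=2..n. m * path_prob P1 s (Y 1) (Y j) - 1 + (1 - path_prob P1 s (Y 1) (Y j)) ^ m)"
    using has_bochner_integral_integral_eq[OF has_D] by simp
  finally show ?thesis .
qed

section \<open>Exponential estimates\<close>

lemma norm_exp_minus_diff_le:
  fixes a b :: complex
  assumes "0 \<le> Re a" "0 \<le> Re b"
  shows "norm (exp (- a) - exp (- b)) \<le> norm (a - b)"
proof -
  have "norm (exp (- a) - exp (- b)) \<le> 1 * norm (a - b)"
  proof (rule field_differentiable_bound[where S = "{z. 0 \<le> Re z}" and f' = "\<lambda>z. - exp (- z)"])
    show "convex {z. 0 \<le> Re z}" by (rule convex_halfspace_Re_ge)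
    show "((\<lambda>z. exp (- z)) has_field_derivative - exp (- z)) (at z within {z. 0 \<le> Re z})"
      for z :: complex by (auto intro!: derivative_eq_intros)
  qed (use assms in auto)
  then show ?thesis by simp
qed

lemma norm_one_minus_minus_exp_le:
  fixes w :: complex
  assumes w: "0 \<le> Re w"
  shows "norm (1 - w - exp (- w)) \<le> (norm w)\<^sup>2"
proof -
  let ?S = "{z. 0 \<le> Re z} \<inter> cball 0 (norm w)"
  have "norm ((1 - w - exp (- w)) - (1 - 0 - exp (- 0))) \<le> norm w * norm (w - 0)"
  proof (rule field_differentiable_bound[where S = ?S and f' = "\<lambda>z. exp (- z) - 1"])
    show "convex ?S" by (intro convex_Int convex_halfspace_Re_ge convex_cball)
    show "((\<lambda>z. 1 - z - exp (- z)) has_field_derivative exp (- z) - 1) (at z within ?S)"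
      for z by (auto intro!: derivative_eq_intros)
    fix z assume "z \<in> ?S"
    then show "norm (exp (- z) - 1) \<le> norm w"
      using norm_exp_minus_diff_le[of z 0] by auto
  qed (use w in auto)
  then show ?thesis by (simp add: power2_eq_square)
qed

text \<open>
  The exponential is split into \<open>k\<close> equal factors, which are compared with \<open>1 - \<phi>\<close> one by one. In this
  way the nonrandom \<open>c\<close>, and not \<open>\<phi>\<close>, appears in the quadratic error.
\<close>

lemma norm_power_minus_exp_le:
  fixes \<phi> c :: complex
  assumes "0 < k" "norm (1 - \<phi>) \<le> 1" "0 \<le> Re c"
  shows "norm ((1 - \<phi>) ^ k - exp (- c)) \<le> norm (of_nat k * \<phi> - c) + (norm c)\<^sup>2 / real k"
proof -
  have k: "complex_of_nat k \<noteq> 0" using assms by simp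
  let ?e = "exp (- (c / of_nat k))"
  have Re: "0 \<le> Re (c / of_nat k)" using assms by simp
  have "exp (- c) = ?e ^ k"
    using k by (simp flip: exp_of_nat_mult)
  moreover have "norm ?e \<le> 1" using Re by (simp add: norm_exp_eq_Re)
  ultimately have "norm ((1 - \<phi>) ^ k - exp (- c)) \<le> real k * norm ((1 - \<phi>) - ?e)"
    using norm_power_diff[of "1 - \<phi>" ?e k] assms by simp
  also have "(1 - \<phi>) - ?e = - (\<phi> - c / of_nat k) + (1 - c / of_nat k - ?e)" by simp
  also have "real k * norm \<dots> \<le> real k * (norm (\<phi> - c / of_nat k) + (norm (c / of_nat k))\<^sup>2)"
  proof (intro mult_left_mono order_trans[OF norm_triangle_ineq] add_mono)
    show "norm (1 - c / of_nat k - ?e) \<le> (norm (c / of_nat k))\<^sup>2"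
      by (rule norm_one_minus_minus_exp_le[OF Re])
  qed (simp_all only: norm_minus_cancel order_refl of_nat_0_le_iff)
  also have "\<dots> = real k * norm (\<phi> - c / of_nat k) + (norm c)\<^sup>2 / real k"
    using assms by (simp add: distrib_left norm_divide power_divide power2_eq_square)
  also have "real k * norm (\<phi> - c / of_nat k) = norm (of_nat k * (\<phi> - c / of_nat k))"
    by (simp add: norm_mult)
  also have "of_nat k * (\<phi> - c / of_nat k) = of_nat k * \<phi> - c"
    using k by (simp add: right_diff_distrib)
  finally show ?thesis .
qed

text \<open>
  The mean of \<open>N - [N > 0]\<close> for a Poisson variable \<open>N\<close> with mean \<open>t\<close>. The bound \<open>t\<close>
  below provides the dominating function and the bound \<open>t\<^sup>2\<close> the pointwise convergence.
\<close>

definition excess :: "real \<Rightarrow> real" where "excess t = t - 1 + exp (- t)"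

lemma excess_measurable [measurable]: "excess \<in> borel_measurable borel"
  unfolding excess_def[abs_def] by measurable

lemma excess_nonneg: "0 \<le> excess t"
  using exp_ge_add_one_self[of "- t"] by (simp add: excess_def)

lemma excess_le: "0 \<le> t \<Longrightarrow> excess t \<le> t"
  by (simp add: excess_def)

lemma excess_le_square:
  assumes "0 \<le> t"
  shows "excess t \<le> t\<^sup>2"
proof -
  have "exp (- t) \<le> 1 / (1 + t)"
    using exp_ge_add_one_self[of t] assms by (simp add: exp_minus field_simps)
  also have "\<dots> \<le> 1 - t + t\<^sup>2"
  proof -
    have "(1 - t + t\<^sup>2) * (1 + t) = 1 + t ^ 3" by (simp add: algebra_simps power2_eq_square power3_eq_cube)
    moreover have "0 \<le> t ^ 3" using assms by simp
    ultimately show ?thesis using assms by (simp add: pos_divide_le_eq)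
  qed
  finally show ?thesis by (simp add: excess_def)
qed

lemma excess_mono:
  assumes "0 \<le> s" "s \<le> t"
  shows "excess s \<le> excess t"
proof -
  have "exp (- s) - exp (- t) = exp (- s) * (1 - exp (- (t - s)))"
    by (simp add: right_diff_distrib flip: exp_add)
  also have "\<dots> \<le> 1 * (t - s)"
  proof (rule mult_mono)
    show "1 - exp (- (t - s)) \<le> t - s"
      using exp_ge_add_one_self[of "- (t - s)"] by linarith
  qed (use assms in auto)
  finally show ?thesis by (simp add: excess_def)
qed

lemma binomial_excess_le:
  assumes "0 \<le> g" "g \<le> 1"
  shows "real m * g - 1 + (1 - g) ^ m \<le> excess (real m * g)"
proof -
  have "(1 - g) ^ m \<le> exp (- g) ^ m"
    using assms exp_ge_add_one_self[of "- g"] by (intro power_mono) auto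
  also have "\<dots> = exp (- (real m * g))"
    by (simp flip: exp_of_nat_mult)
  finally show ?thesis by (simp add: excess_def)
qed

section \<open>The weak law of large numbers in mean\<close>

lemma (in prob_space) expectation_abs_le_sqrt:
  fixes Z :: "'a \<Rightarrow> real"
  assumes [measurable]: "integrable M Z" and sq: "integrable M (\<lambda>x. (Z x)\<^sup>2)"
  shows "expectation (\<lambda>x. \<bar>Z x\<bar>) \<le> sqrt (expectation (\<lambda>x. (Z x)\<^sup>2))"
proof (rule real_le_rsqrt)
  have "variance (\<lambda>x. \<bar>Z x\<bar>) = expectation (\<lambda>x. \<bar>Z x\<bar>\<^sup>2) - (expectation (\<lambda>x. \<bar>Z x\<bar>))\<^sup>2"
    using assms by (intro variance_eq) auto
  then show "(expectation (\<lambda>x. \<bar>Z x\<bar>))\<^sup>2 \<le> expectation (\<lambda>x. (Z x)\<^sup>2)"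
    using variance_positive[of "\<lambda>x. \<bar>Z x\<bar>"] by simp
qed

lemma integral_square_sum_centred_le:
  fixes c :: "real \<Rightarrow> real" and B :: real and I :: "nat set"
  assumes P: "real_distribution P" and [measurable]: "c \<in> borel_measurable borel"
    and B: "\<And>x. \<bar>c x\<bar> \<le> B" and c0: "(\<integral>x. c x \<partial>P) = 0" and I: "finite I"
  shows "(\<integral>Y. (\<Sum>j\<in>I. c (Y j))\<^sup>2 \<partial>(\<Pi>\<^sub>M j\<in>I. P)) \<le> card I * B\<^sup>2"
proof -
  interpret P: real_distribution P by fact
  let ?W = "\<Pi>\<^sub>M j\<in>I. P"
  interpret W: prob_space ?W by (intro prob_space_PiM P.prob_space_axioms)
  have [measurable]: "c \<in> borel_measurable P" by simp
  have int_c: "integrable P c"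
    by (intro P.integrable_const_bound[where B = B] AE_I2) (use B in auto)
  have prod_B: "\<bar>c x * c y\<bar> \<le> B\<^sup>2" for x y
    unfolding abs_mult power2_eq_square by (intro mult_mono B order_trans[OF abs_ge_zero B]) auto
  have int2: "integrable ?W (\<lambda>Y. c (Y j) * c (Y k))" if "j \<in> I" "k \<in> I" for j k
  proof (rule W.integrable_const_bound[where B = "B\<^sup>2"])
    have cj: "(\<lambda>Y. c (Y i)) \<in> borel_measurable ?W" if "i \<in> I" for i
      by (rule measurable_compose[OF measurable_component_singleton[OF that]]) simp
    show "(\<lambda>Y. c (Y j) * c (Y k)) \<in> borel_measurable ?W"
      by (intro borel_measurable_times cj that)
    show "AE Y in ?W. norm (c (Y j) * c (Y k)) \<le> B\<^sup>2"
      by (rule AE_I2) (simp only: real_norm_def prod_B)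
  qed
  have cross: "(\<integral>Y. c (Y j) * c (Y k) \<partial>?W) \<le> (if j = k then B\<^sup>2 else 0)"
    if j: "j \<in> I" and k: "k \<in> I" for j k
  proof (cases "j = k")
    case True
    then show ?thesis
      using W.integral_le_const[OF int2[OF j k], of "B\<^sup>2"] abs_le_D1[OF prod_B] by simp
  next
    case False
    let ?f = "\<lambda>i. if i \<in> {j, k} then c else (\<lambda>_. 1)"
    have "(\<Prod>i\<in>I. ?f i (Y i)) = c (Y j) * c (Y k)" for Y
    proof -
      have "(\<Prod>i\<in>I. ?f i (Y i)) = (\<Prod>i\<in>{j, k}. c (Y i))"
        using I j k by (intro prod.mono_neutral_cong_right) auto
      then show ?thesis using False by simp
    qed
    then have "(\<integral>Y. c (Y j) * c (Y k) \<partial>?W) = (\<integral>Y. (\<Prod>i\<in>I. ?f i (Y i)) \<partial>?W)" by simp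
    also have "\<dots> = (\<Prod>i\<in>I. \<integral>x. ?f i x \<partial>P)"
      using int_c I by (intro integral_prod_attribute_weights[OF P, of I ?f]) auto
    also have "\<dots> = 0"
      using I j c0 by (intro prod_zero bexI[of _ j]) auto
    finally show ?thesis using False by simp
  qed
  have "(\<integral>Y. (\<Sum>j\<in>I. c (Y j))\<^sup>2 \<partial>?W) = (\<Sum>j\<in>I. \<Sum>k\<in>I. \<integral>Y. c (Y j) * c (Y k) \<partial>?W)"
    unfolding power2_eq_square sum_product using int2
    by (simp add: Bochner_Integration.integral_sum)
  also have "\<dots> \<le> (\<Sum>j\<in>I. \<Sum>k\<in>I. if j = k then B\<^sup>2 else 0)"
    by (intro sum_mono cross)
  also have "\<dots> = card I * B\<^sup>2"
    using I by simp
  finally show ?thesis .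
qed

text \<open>
  Convergence in mean needs only a first moment: after truncation of the variables at \<open>K\<close> the variance
  of the average is of order \<open>K\<^sup>2 / n\<close>, and the truncation costs twice the tail expectation, which is
  small for large \<open>K\<close>. The index set starts at 2 because vertex 1 is singled out; the missing term
  contributes at most \<open>K / n\<close>.
\<close>

lemma weak_law_L1:
  assumes P: "real_distribution P" and int: "integrable P (\<lambda>x. x)"
  shows "(\<lambda>n. \<integral>Y. \<bar>(\<Sum>j=2..n. Y j) / real n - (\<integral>x. x \<partial>P)\<bar> \<partial>(\<Pi>\<^sub>M j\<in>{2..n}. P)) \<longlonglongrightarrow> 0"
proof -
  interpret P: real_distribution P by fact
  \<comment> \<open>Truncation to 0 outside the interval from -K to K.\<close>
  define t :: "nat \<Rightarrow> real \<Rightarrow> real" where "t K x = x * indicator {-real K..real K} x" for K x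
  have t_meas [measurable]: "t K \<in> borel_measurable borel" for K
    unfolding t_def[abs_def] by measurable
  have t_le: "\<bar>t K x\<bar> \<le> real K" for K x
    by (auto simp: t_def indicator_def)
  have t_int: "integrable P (t K)" for K
    by (intro P.integrable_const_bound[where B = "real K"] AE_I2) (auto simp: t_le)
  let ?b = "\<integral>x. x \<partial>P"
  have tail: "(\<lambda>K. \<integral>x. \<bar>x - t K x\<bar> \<partial>P) \<longlonglongrightarrow> (\<integral>x. 0 \<partial>P)"
  proof (rule integral_dominated_convergence[where w = "\<lambda>x. \<bar>x\<bar>"])
    show "AE x in P. (\<lambda>K. \<bar>x - t K x\<bar>) \<longlonglongrightarrow> 0"
    proof (rule AE_I2, rule tendsto_eventually)
      fix x
      have "\<forall>\<^sub>F K in sequentially. \<bar>x\<bar> \<le> real K"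
        by real_asymp
      then show "\<forall>\<^sub>F K in sequentially. \<bar>x - t K x\<bar> = 0"
        by eventually_elim (auto simp: t_def indicator_def)
    qed
    show "AE x in P. norm \<bar>x - t K x\<bar> \<le> \<bar>x\<bar>" for K
      by (auto simp: t_def indicator_def)
    show "integrable P (\<lambda>x. \<bar>x\<bar>)"
      using int by (rule integrable_abs)
    show "(\<lambda>x. \<bar>x - t K x\<bar>) \<in> borel_measurable P" for K
      by simp
  qed simp
  have bound: "(\<integral>Y. \<bar>(\<Sum>j=2..n. Y j) / real n - ?b\<bar> \<partial>(\<Pi>\<^sub>M j\<in>{2..n}. P))
      \<le> 2 * (\<integral>x. \<bar>x - t K x\<bar> \<partial>P) + (sqrt (real n * (2 * real K)\<^sup>2) / real n + real K / real n)"
    if n: "0 < n" for n K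
  proof -
    let ?W = "\<Pi>\<^sub>M j\<in>{2..n}. P"
    interpret W: prob_space ?W by (intro prob_space_PiM P.prob_space_axioms)
    define \<mu> where "\<mu> = (\<integral>x. t K x \<partial>P)"
    have \<mu>: "\<bar>\<mu>\<bar> \<le> real K"
      unfolding \<mu>_def by (rule order_trans[OF integral_abs_bound])
        (intro P.integral_le_const AE_I2 t_le integrable_abs t_int)
    have \<mu>b: "\<bar>?b - \<mu>\<bar> \<le> (\<integral>x. \<bar>x - t K x\<bar> \<partial>P)"
      unfolding \<mu>_def Bochner_Integration.integral_diff[OF int t_int, symmetric]
      by (rule integral_abs_bound)
    let ?c = "\<lambda>x. t K x - \<mu>"
    have c: "\<bar>?c x\<bar> \<le> 2 * real K" for x using t_le[of K x] \<mu> by linarith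
    have cm: "integrable ?W (\<lambda>Y. (\<Sum>j=2..n. ?c (Y j)))" "integrable ?W (\<lambda>Y. (\<Sum>j=2..n. ?c (Y j))\<^sup>2)"
    proof -
      have *: "\<bar>\<Sum>j=2..n. ?c (Y j)\<bar> \<le> real n * (2 * real K)" for Y
      proof -
        have "\<bar>\<Sum>j=2..n. ?c (Y j)\<bar> \<le> (\<Sum>j=2..n. 2 * real K)"
          by (rule order_trans[OF sum_abs]) (intro sum_mono c)
        also have "\<dots> \<le> real n * (2 * real K)"
          by (simp add: mult_right_mono)
        finally show ?thesis .
      qed
      show "integrable ?W (\<lambda>Y. (\<Sum>j=2..n. ?c (Y j)))"
        by (intro W.integrable_const_bound AE_I2) (auto intro: *)
      show "integrable ?W (\<lambda>Y. (\<Sum>j=2..n. ?c (Y j))\<^sup>2)"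
        by (intro W.integrable_const_bound[where B = "(real n * (2 * real K))\<^sup>2"] AE_I2)
          (auto intro!: power2_le_iff_abs_le[THEN iffD2] *)
    qed
    have "(\<integral>Y. \<bar>\<Sum>j=2..n. ?c (Y j)\<bar> \<partial>?W) \<le> sqrt (\<integral>Y. (\<Sum>j=2..n. ?c (Y j))\<^sup>2 \<partial>?W)"
      by (rule W.expectation_abs_le_sqrt[OF cm])
    also have "\<dots> \<le> sqrt (real n * (2 * real K)\<^sup>2)"
    proof (rule real_sqrt_le_mono)
      have "(\<integral>x. ?c x \<partial>P) = 0"
        using t_int P.prob_space by (simp add: \<mu>_def)
      then have "(\<integral>Y. (\<Sum>j=2..n. ?c (Y j))\<^sup>2 \<partial>?W) \<le> card {2..n} * (2 * real K)\<^sup>2"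
        by (intro integral_square_sum_centred_le P c) auto
      also have "\<dots> \<le> real n * (2 * real K)\<^sup>2"
        by (intro mult_right_mono) auto
      finally show "(\<integral>Y. (\<Sum>j=2..n. ?c (Y j))\<^sup>2 \<partial>?W) \<le> real n * (2 * real K)\<^sup>2" .
    qed
    finally have L2: "(\<integral>Y. \<bar>\<Sum>j=2..n. ?c (Y j)\<bar> \<partial>?W) \<le> sqrt (real n * (2 * real K)\<^sup>2)" .
    have comp: "integrable ?W (\<lambda>Y. \<bar>Y j - t K (Y j)\<bar>)"
      "(\<integral>Y. \<bar>Y j - t K (Y j)\<bar> \<partial>?W) = (\<integral>x. \<bar>x - t K x\<bar> \<partial>P)" if j: "j \<in> {2..n}" for j
    proof -
      have i: "integrable P (\<lambda>x. \<bar>x - t K x\<bar>)"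
        by (intro integrable_abs Bochner_Integration.integrable_diff int t_int)
      show "integrable ?W (\<lambda>Y. \<bar>Y j - t K (Y j)\<bar>)"
        using i integrable_PiM_component_iff[OF P.prob_space_axioms j borel_measurable_integrable[OF i]]
        by simp
      show "(\<integral>Y. \<bar>Y j - t K (Y j)\<bar> \<partial>?W) = (\<integral>x. \<bar>x - t K x\<bar> \<partial>P)"
        by (rule integral_PiM_component[OF P.prob_space_axioms j borel_measurable_integrable[OF i]])
    qed
    let ?E = "\<integral>x. \<bar>x - t K x\<bar> \<partial>P"
    let ?R = "\<lambda>Y. (\<Sum>j=2..n. \<bar>Y j - t K (Y j)\<bar>) / real n +
        \<bar>\<Sum>j=2..n. ?c (Y j)\<bar> / real n + (real K / real n + ?E)"
    have has_R: "has_bochner_integral ?W ?R ((\<Sum>j=2..n. ?E) / real n +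
          (\<integral>Y. \<bar>\<Sum>j=2..n. ?c (Y j)\<bar> \<partial>?W) / real n + (real K / real n + ?E))"
        using comp integrable_abs[OF cm(1)] W.prob_space
        by (intro has_bochner_integral_add has_bochner_integral_divide_zero has_bochner_integral_sum)
          (simp_all only: has_bochner_integral_iff lebesgue_integral_const W.integrable_const
            scaleR_one simp_thms)
    have "(\<integral>Y. \<bar>(\<Sum>j=2..n. Y j) / real n - ?b\<bar> \<partial>?W) \<le> (\<integral>Y. ?R Y \<partial>?W)"
    proof (rule integral_mono)
      show "integrable ?W (\<lambda>Y. \<bar>(\<Sum>j=2..n. Y j) / real n - ?b\<bar>)"
        using int integrable_PiM_component_iff[OF P.prob_space_axioms _ borel_measurable_integrable[OF int],
            of _ "{2..n}"]
        by (intro integrable_abs Bochner_Integration.integrable_diff integrable_divide_zero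
            Bochner_Integration.integrable_sum W.integrable_const) (simp only:)
      show "integrable ?W ?R"
        by (rule integrable.intros[OF has_R])
      fix Y :: "nat \<Rightarrow> real"
      have "(\<Sum>j=2..n. Y j) = (\<Sum>j=2..n. Y j - t K (Y j)) + (\<Sum>j=2..n. ?c (Y j)) + real (n - 1) * \<mu>"
        by (simp add: sum_subtractf)
      then have "(\<Sum>j=2..n. Y j) / real n - ?b = (\<Sum>j=2..n. Y j - t K (Y j)) / real n +
          (\<Sum>j=2..n. ?c (Y j)) / real n + (- \<mu> / real n + (\<mu> - ?b))"
      proof -
        assume S: "(\<Sum>j=2..n. Y j) = (\<Sum>j=2..n. Y j - t K (Y j)) + (\<Sum>j=2..n. ?c (Y j)) + real (n - 1) * \<mu>"
        have "real (n - 1) * \<mu> / real n = \<mu> - \<mu> / real n"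
          using n by (simp add: field_simps of_nat_diff)
        then show ?thesis
          unfolding S add_divide_distrib by simp
      qed
      moreover have "\<bar>(\<Sum>j=2..n. Y j - t K (Y j)) / real n\<bar> \<le> (\<Sum>j=2..n. \<bar>Y j - t K (Y j)\<bar>) / real n"
        using n by (simp add: abs_divide divide_right_mono sum_abs)
      moreover have "\<bar>(\<Sum>j=2..n. ?c (Y j)) / real n\<bar> = \<bar>\<Sum>j=2..n. ?c (Y j)\<bar> / real n"
        by (simp add: abs_divide)
      moreover have "\<bar>- \<mu> / real n\<bar> \<le> real K / real n"
        using \<mu> by (simp add: abs_divide divide_right_mono)
      ultimately show "\<bar>(\<Sum>j=2..n. Y j) / real n - ?b\<bar> \<le> ?R Y"
        using \<mu>b by linarith
    qed
    also have "\<dots> = (\<Sum>j=2..n. ?E) / real n + (\<integral>Y. \<bar>\<Sum>j=2..n. ?c (Y j)\<bar> \<partial>?W) / real n +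
        (real K / real n + ?E)"
      by (rule has_bochner_integral_integral_eq[OF has_R])
    also have "\<dots> \<le> ?E + sqrt (real n * (2 * real K)\<^sup>2) / real n + (real K / real n + ?E)"
    proof (intro add_mono divide_right_mono L2)
      have "0 \<le> ?E" by simp
      then have "(\<Sum>j=2..n. ?E) \<le> real n * ?E"
        by (simp add: mult_right_mono)
      then show "(\<Sum>j=2..n. ?E) / real n \<le> ?E"
        using n by (simp add: field_simps)
    qed auto
    finally show ?thesis by simp
  qed
  show ?thesis
  proof (rule LIMSEQ_I)
    fix e :: real assume e: "0 < e"
    then have "\<forall>\<^sub>F K in sequentially. (\<integral>x. \<bar>x - t K x\<bar> \<partial>P) < e / 4"
      using tail by (intro order_tendstoD) auto
    then obtain K where K: "(\<integral>x. \<bar>x - t K x\<bar> \<partial>P) < e / 4"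
      by (auto dest: eventually_happens)
    have "(\<lambda>n. sqrt (real n * (2 * real K)\<^sup>2) / real n + real K / real n) \<longlonglongrightarrow> 0"
    proof -
      have "(\<lambda>n. sqrt (real n) / real n * (2 * real K) + real K * (1 / real n)) \<longlonglongrightarrow> 0 * (2 * real K) + real K * 0"
        by (intro tendsto_intros; real_asymp)
      then show ?thesis by (simp add: real_sqrt_mult)
    qed
    then have "\<forall>\<^sub>F n in sequentially. sqrt (real n * (2 * real K)\<^sup>2) / real n + real K / real n < e / 2"
      using e by (intro order_tendstoD) auto
    then have "\<forall>\<^sub>F n in sequentially.
        norm ((\<integral>Y. \<bar>(\<Sum>j=2..n. Y j) / real n - ?b\<bar> \<partial>(\<Pi>\<^sub>M j\<in>{2..n}. P)) - 0) < e"
      using eventually_gt_at_top[of 0]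
    proof eventually_elim
      case (elim n)
      have "0 \<le> (\<integral>Y. \<bar>(\<Sum>j=2..n. Y j) / real n - ?b\<bar> \<partial>(\<Pi>\<^sub>M j\<in>{2..n}. P))" by simp
      then show ?case
        using bound[OF elim(2), of K] elim(1) K unfolding real_norm_def diff_zero by linarith
    qed
    then show "\<exists>N. \<forall>n\<ge>N. norm ((\<integral>Y. \<bar>(\<Sum>j=2..n. Y j) / real n - ?b\<bar> \<partial>(\<Pi>\<^sub>M j\<in>{2..n}. P)) - 0) < e"
      by (simp add: eventually_sequentially)
  qed
qed

section \<open>The rescaled link probabilities\<close>

text \<open>
  In this locale \<open>s\<close> is the normalisation \<open>sqrt (n m)\<close> of the link probabilities and \<open>r = sqrt (m / n)\<close>,
  so that \<open>s = n r\<close> and \<open>m = r s\<close>.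
\<close>

locale sparse_weights =
  fixes P1 P2 :: "real measure" and m :: "nat \<Rightarrow> nat"
  assumes P1: "real_distribution P1" and P1_nonneg: "AE x in P1. 0 \<le> x"
    and P2: "real_distribution P2" and P2_nonneg: "AE y in P2. 0 \<le> y"
    and m_infinity: "filterlim m at_top sequentially"
    and sq: "integrable P1 (\<lambda>x. x\<^sup>2)" and int_P2: "integrable P2 (\<lambda>y. y)"
begin

sublocale P1: real_distribution P1 by (rule P1)
sublocale P2: real_distribution P2 by (rule P2)

definition a2 :: real where "a2 = (\<integral>x. x\<^sup>2 \<partial>P1)"
definition b1 :: real where "b1 = (\<integral>y. y \<partial>P2)"
definition s :: "nat \<Rightarrow> real" where "s n = sqrt (real n * real (m n))"
definition r :: "nat \<Rightarrow> real" where "r n = sqrt (real (m n) / real n)"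

abbreviation q :: "nat \<Rightarrow> real \<Rightarrow> real \<Rightarrow> real" where "q n \<equiv> link_prob (s n)"

lemma int_P1: "integrable P1 (\<lambda>x. x)"
  by (rule P1.square_integrable_imp_integrable[OF _ sq]) simp

lemma int_abs_P2: "integrable P2 (\<lambda>y. \<bar>y\<bar>)"
  using int_P2 by (rule integrable_abs)

lemma b1_nonneg: "0 \<le> b1"
  unfolding b1_def by (rule integral_nonneg_AE[OF P2_nonneg])

lemma a2_nonneg: "0 \<le> a2"
  unfolding a2_def by simp

lemma eventually_pos: "\<forall>\<^sub>F n in sequentially. 0 < n \<and> 0 < m n"
  using eventually_gt_at_top[of 0] eventually_compose_filterlim[OF eventually_gt_at_top[of 0] m_infinity]
  by eventually_elim auto

lemma
  assumes "0 < n" "0 < m n"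
  shows s_pos: "0 < s n" and r_pos: "0 < r n"
    and s_eq: "s n = real n * r n" and m_eq: "real (m n) = r n * s n"
    and s_sq: "(s n)\<^sup>2 = real n * real (m n)"
proof -
  show "0 < s n" "0 < r n" using assms by (simp_all add: s_def r_def)
  have "real n = sqrt (real n) * sqrt (real n)" by simp
  then show s: "s n = real n * r n"
    using assms by (simp add: s_def r_def real_sqrt_mult real_sqrt_divide field_simps)
  show "(s n)\<^sup>2 = real n * real (m n)"
    by (simp add: s_def)
  then show "real (m n) = r n * s n"
    using assms by (simp add: power2_eq_square) (simp add: s)
qed

lemma s_at_top: "filterlim s at_top sequentially"
proof -
  have "\<forall>\<^sub>F n in sequentially. sqrt (real n) \<le> s n"
    using eventually_pos
  proof eventually_elim
    case (elim n)
    then have "real n * 1 \<le> real n * real (m n)" by (intro mult_left_mono) auto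
    then show ?case unfolding s_def by (intro real_sqrt_le_mono) simp
  qed
  moreover have "filterlim (\<lambda>n. sqrt (real n)) at_top sequentially"
    by real_asymp
  ultimately show ?thesis
    by (rule filterlim_at_top_mono[rotated])
qed

lemma s_mult_q_le:
  assumes "0 < n" "0 < m n"
  shows "s n * q n x y \<le> \<bar>x\<bar> * \<bar>y\<bar>"
  using link_prob_le[of "s n" x y] s_pos[OF assms] by (simp add: field_simps)

lemma q_tendsto_0: "0 \<le> x \<Longrightarrow> 0 \<le> y \<Longrightarrow> (\<lambda>n. q n x y) \<longlonglongrightarrow> 0"
proof (rule tendsto_sandwich[OF _ _ tendsto_const])
  show "\<forall>\<^sub>F n in sequentially. q n x y \<le> \<bar>x\<bar> * \<bar>y\<bar> / s n"
    using eventually_pos by eventually_elim (intro link_prob_le s_pos, auto)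
  show "(\<lambda>n. \<bar>x\<bar> * \<bar>y\<bar> / s n) \<longlonglongrightarrow> 0"
    by (rule tendsto_divide_0[OF tendsto_const filterlim_at_top_imp_at_infinity[OF s_at_top]])
qed auto

text \<open>
  The truncation at 1 is inactive as soon as \<open>s\<close> exceeds \<open>x y\<close>.
\<close>

lemma eventually_s_mult_q:
  assumes "0 \<le> x" "0 \<le> y"
  shows "\<forall>\<^sub>F n in sequentially. s n * q n x y = x * y"
  using eventually_pos filterlim_at_top[THEN iffD1, OF s_at_top, rule_format, of "x * y"]
proof eventually_elim
  case (elim n)
  then have "0 < s n" using s_pos by auto
  with elim assms show ?case by (simp add: link_prob_def)
qed

text \<open>
  The weight \<open>y\<close> of one vertex contributes \<open>r q(x, y)\<close> to \<open>r \<Sum>\<^sub>j q(x, Y\<^sub>j)\<close>, ideally \<open>x y / n\<close>. The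
  second summand measures the loss by truncation at 1. The first one is the error of replacing
  \<open>1 - (1 - z) q\<close> by \<open>exp (- (1 - z) q)\<close>, multiplied by \<open>r\<close>. Multiplied by \<open>n\<close>, the whole is dominated
  by \<open>x\<^sup>2 y\<close> and tends to 0.
\<close>

definition truncation_error :: "nat \<Rightarrow> real \<Rightarrow> real \<Rightarrow> real" where
  "truncation_error n x y = \<bar>x\<bar> * (4 * r n * (q n x y)\<^sup>2 + 2 * \<bar>x * y / real n - r n * q n x y\<bar>)"

lemma truncation_error_measurable [measurable]:
  assumes [measurable]: "f \<in> borel_measurable M" "g \<in> borel_measurable M"
  shows "(\<lambda>z. truncation_error n (f z) (g z)) \<in> borel_measurable M"
  unfolding truncation_error_def by measurable

lemma truncation_error_nonneg: "0 \<le> truncation_error n x y"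
  unfolding truncation_error_def r_def by (intro mult_nonneg_nonneg add_nonneg_nonneg) auto

lemma n_truncation_error_eq:
  assumes "0 < n" "0 < m n"
  shows "real n * truncation_error n x y = \<bar>x\<bar> * (4 * (s n * q n x y) * q n x y + 2 * \<bar>x * y - s n * q n x y\<bar>)"
proof -
  have "real n * \<bar>x * y / real n - r n * q n x y\<bar> = \<bar>real n * (x * y / real n - r n * q n x y)\<bar>"
    by (simp add: abs_mult)
  also have "real n * (x * y / real n - r n * q n x y) = x * y - s n * q n x y"
    using assms by (simp add: s_eq algebra_simps)
  finally show ?thesis
    unfolding truncation_error_def using assms by (simp add: s_eq algebra_simps power2_eq_square)
qed

lemma n_truncation_error_le:
  assumes "0 < n" "0 < m n"
  shows "real n * truncation_error n x y \<le> 8 * x\<^sup>2 * \<bar>y\<bar>"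
proof -
  have sq: "s n * q n x y \<le> \<bar>x\<bar> * \<bar>y\<bar>" "0 \<le> s n * q n x y"
    using s_mult_q_le[OF assms] s_pos[OF assms] by simp_all
  have "\<bar>x * y - s n * q n x y\<bar> \<le> \<bar>x\<bar> * \<bar>y\<bar> + \<bar>x\<bar> * \<bar>y\<bar>"
    using sq by (intro order_trans[OF abs_triangle_ineq4] add_mono) (simp_all add: abs_mult)
  moreover have "(s n * q n x y) * q n x y \<le> (\<bar>x\<bar> * \<bar>y\<bar>) * 1"
    by (intro mult_mono sq) auto
  ultimately have "\<bar>x\<bar> * (4 * (s n * q n x y) * q n x y + 2 * \<bar>x * y - s n * q n x y\<bar>)
      \<le> \<bar>x\<bar> * (4 * (\<bar>x\<bar> * \<bar>y\<bar>) + 2 * (\<bar>x\<bar> * \<bar>y\<bar> + \<bar>x\<bar> * \<bar>y\<bar>))"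
    by (intro mult_left_mono) (auto simp: mult.assoc)
  also have "\<dots> = 8 * x\<^sup>2 * \<bar>y\<bar>"
  proof -
    have "x\<^sup>2 = \<bar>x\<bar> * \<bar>x\<bar>" by (simp add: power2_eq_square)
    then show ?thesis by (simp only:) (simp only: algebra_simps)
  qed
  finally show ?thesis
    by (simp only: n_truncation_error_eq[OF assms])
qed

lemma n_truncation_error_tendsto_0:
  assumes "0 \<le> x" "0 \<le> y"
  shows "(\<lambda>n. real n * truncation_error n x y) \<longlonglongrightarrow> 0"
proof (rule Lim_transform_eventually)
  show "(\<lambda>n. \<bar>x\<bar> * (4 * (x * y) * q n x y)) \<longlonglongrightarrow> 0"
    using tendsto_mult_right_zero[OF tendsto_mult_right_zero[OF q_tendsto_0[OF assms], of "4 * (x * y)"], of "\<bar>x\<bar>"] .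
  show "\<forall>\<^sub>F n in sequentially. \<bar>x\<bar> * (4 * (x * y) * q n x y) = real n * truncation_error n x y"
    using eventually_pos eventually_s_mult_q[OF assms]
    by eventually_elim (simp add: n_truncation_error_eq)
qed

definition mean_truncation_error :: "nat \<Rightarrow> real \<Rightarrow> real" where "mean_truncation_error n y = (\<integral>x. truncation_error n x y \<partial>P1)"

lemma mean_truncation_error_measurable [measurable]: "mean_truncation_error n \<in> borel_measurable borel"
  unfolding mean_truncation_error_def[abs_def]
  by (intro P1.borel_measurable_lebesgue_integral) (simp add: split_beta)

lemma mean_truncation_error_nonneg: "0 \<le> mean_truncation_error n y"
  unfolding mean_truncation_error_def by (intro integral_nonneg_AE AE_I2 truncation_error_nonneg)

lemma integrable_truncation_error:
  assumes "0 < n" "0 < m n"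
  shows "integrable P1 (\<lambda>x. truncation_error n x y)"
proof (rule Bochner_Integration.integrable_bound)
  show "integrable P1 (\<lambda>x. (8 * \<bar>y\<bar> / real n) * x\<^sup>2)"
    using sq by simp
  show "AE x in P1. norm (truncation_error n x y) \<le> norm ((8 * \<bar>y\<bar> / real n) * x\<^sup>2)"
    using n_truncation_error_le[OF assms, of _ y] assms by (intro AE_I2) (simp add: truncation_error_nonneg field_simps abs_mult)
qed simp

lemma n_mean_truncation_error_le:
  assumes "0 < n" "0 < m n"
  shows "real n * mean_truncation_error n y \<le> 8 * a2 * \<bar>y\<bar>"
proof -
  have "real n * mean_truncation_error n y = (\<integral>x. real n * truncation_error n x y \<partial>P1)"
    by (simp add: mean_truncation_error_def)
  also have "\<dots> \<le> (\<integral>x. (8 * \<bar>y\<bar>) * x\<^sup>2 \<partial>P1)"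
    using n_truncation_error_le[OF assms] by (intro integral_mono) (auto simp: integrable_truncation_error assms sq mult_ac)
  finally show ?thesis by (simp add: a2_def mult_ac)
qed

lemma n_mean_truncation_error_tendsto_0:
  assumes "0 \<le> y"
  shows "(\<lambda>n. real n * mean_truncation_error n y) \<longlonglongrightarrow> 0"
proof -
  obtain N where N: "\<And>n. n \<ge> N \<Longrightarrow> 0 < n \<and> 0 < m n"
    using eventually_pos by (auto simp: eventually_sequentially)
  \<comment> \<open>The domination holds only for positive n and m n, hence the shift by N.\<close>
  have "(\<lambda>n. \<integral>x. real (n + N) * truncation_error (n + N) x y \<partial>P1) \<longlonglongrightarrow> (\<integral>x. 0 \<partial>P1)"
  proof (rule integral_dominated_convergence[where w = "\<lambda>x. 8 * x\<^sup>2 * \<bar>y\<bar>"])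
    show "AE x in P1. (\<lambda>n. real (n + N) * truncation_error (n + N) x y) \<longlonglongrightarrow> 0"
      using P1_nonneg by eventually_elim (rule LIMSEQ_ignore_initial_segment[OF n_truncation_error_tendsto_0[OF _ assms]])
    show "AE x in P1. norm (real (n + N) * truncation_error (n + N) x y) \<le> 8 * x\<^sup>2 * \<bar>y\<bar>" for n
      using n_truncation_error_le[of "n + N"] N[of "n + N"] by (intro AE_I2) (simp add: truncation_error_nonneg abs_mult)
  qed (use sq in simp_all)
  then have "(\<lambda>n. real (n + N) * mean_truncation_error (n + N) y) \<longlonglongrightarrow> 0"
    by (simp add: mean_truncation_error_def)
  then show ?thesis by (rule LIMSEQ_offset)
qed

end

section \<open>The limit of the generating function of the degree\<close>

text \<open>
  The regimes of \<open>m / n\<close> enter only through the function \<open>\<psi>\<close>.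
\<close>

locale sparse_weights_limit = sparse_weights +
  fixes z :: complex and \<psi> :: "real \<Rightarrow> complex"
  assumes z: "norm z \<le> 1" and \<psi>_measurable [measurable]: "\<psi> \<in> borel_measurable borel"
    and \<psi>_limit: "\<And>x. 0 \<le> x \<Longrightarrow>
      (\<lambda>n. complex_of_real (r n) * (1 - exp (- ((1 - z) * complex_of_real (x * b1 / r n))))) \<longlonglongrightarrow> \<psi> x"
begin

text \<open>
  The asymptotic generating function of the number of vertices that an attribute of weight \<open>x\<close> is linked
  to, a Poisson variable with mean \<open>x b\<^sub>1 / r\<close>.
\<close>

definition attribute_gf :: "nat \<Rightarrow> real \<Rightarrow> complex" where
  "attribute_gf n x = exp (- ((1 - z) * complex_of_real (x * b1 / r n)))"

text \<open>
  The limit of \<open>m \<phi>\<close> for \<open>Y\<^sub>1 = y\<close> is \<open>y \<kappa>\<close>.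
\<close>

definition \<kappa> :: complex where "\<kappa> = (\<integral>x. complex_of_real x * \<psi> x \<partial>P1)"

definition effect_error :: "nat \<Rightarrow> real \<Rightarrow> real" where
  "effect_error n y = (\<integral>x. norm (complex_of_real (real (m n) * q n x y) * (1 - attribute_gf n x) -
      complex_of_real y * (complex_of_real x * \<psi> x)) \<partial>P1)"

lemma attribute_gf_measurable [measurable]: "attribute_gf n \<in> borel_measurable borel"
  unfolding attribute_gf_def[abs_def] by measurable

lemma Re_one_minus_z: "0 \<le> Re (1 - z)"
  using z complex_Re_le_cmod[of z] by simp

lemma norm_one_minus_z: "norm (1 - z) \<le> 2"
  using norm_triangle_ineq4[of 1 z] z by simp

lemma Re_thin_nonneg: "0 \<le> t \<Longrightarrow> 0 \<le> Re ((1 - z) * complex_of_real t)"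
  using Re_one_minus_z by simp

lemma norm_attribute_gf_le_1:
  assumes "0 \<le> x" "0 < n" "0 < m n"
  shows "norm (attribute_gf n x) \<le> 1"
  unfolding attribute_gf_def norm_exp_eq_Re
  using Re_thin_nonneg[of "x * b1 / r n"] assms b1_nonneg r_pos[OF assms(2,3)] by simp

lemma norm_r_attribute_gf_le:
  assumes "0 \<le> x" "0 < n" "0 < m n"
  shows "norm (complex_of_real (r n) * (1 - attribute_gf n x)) \<le> 2 * b1 * x"
proof -
  note r = r_pos[OF assms(2,3)]
  have "norm (1 - attribute_gf n x) \<le> norm ((1 - z) * complex_of_real (x * b1 / r n))"
    using norm_exp_minus_diff_le[of 0 "(1 - z) * complex_of_real (x * b1 / r n)"]
      Re_thin_nonneg[of "x * b1 / r n"] assms b1_nonneg r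
    unfolding attribute_gf_def norm_minus_commute[of 0] by simp
  also have "\<dots> = norm (1 - z) * (x * b1 / r n)"
    using assms b1_nonneg r by (simp only: norm_mult norm_of_real) simp
  also have "\<dots> \<le> 2 * (x * b1 / r n)"
    using assms b1_nonneg r by (intro mult_right_mono norm_one_minus_z) simp
  finally have "r n * norm (1 - attribute_gf n x) \<le> r n * (2 * (x * b1 / r n))"
    using r by (intro mult_left_mono) auto
  then show ?thesis
    using r by (simp add: norm_mult mult_ac)
qed

lemma \<psi>_limit': "0 \<le> x \<Longrightarrow> (\<lambda>n. complex_of_real (r n) * (1 - attribute_gf n x)) \<longlonglongrightarrow> \<psi> x"
  unfolding attribute_gf_def by (rule \<psi>_limit)

lemma norm_\<psi>_le:
  assumes "0 \<le> x"
  shows "norm (\<psi> x) \<le> 2 * b1 * x"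
proof (rule tendsto_upperbound[OF tendsto_norm[OF \<psi>_limit'[OF assms]]])
  show "\<forall>\<^sub>F n in sequentially. norm (complex_of_real (r n) * (1 - attribute_gf n x)) \<le> 2 * b1 * x"
    using eventually_pos by eventually_elim (rule norm_r_attribute_gf_le[OF assms], auto)
qed simp

lemma Re_\<psi>_nonneg:
  assumes "0 \<le> x"
  shows "0 \<le> Re (\<psi> x)"
proof (rule tendsto_lowerbound[OF tendsto_Re[OF \<psi>_limit'[OF assms]]])
  show "\<forall>\<^sub>F n in sequentially. 0 \<le> Re (complex_of_real (r n) * (1 - attribute_gf n x))"
    using eventually_pos
  proof eventually_elim
    case (elim n)
    then have "Re (attribute_gf n x) \<le> 1"
      using norm_attribute_gf_le_1[OF assms] complex_Re_le_cmod[of "attribute_gf n x"] by (meson order_trans)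
    then show ?case using r_pos[of n] elim by simp
  qed
qed simp

lemma integrable_\<psi>: "integrable P1 (\<lambda>x. complex_of_real x * \<psi> x)"
proof (rule Bochner_Integration.integrable_bound)
  show "integrable P1 (\<lambda>x. 2 * b1 * x\<^sup>2)" using sq by simp
  show "AE x in P1. norm (complex_of_real x * \<psi> x) \<le> norm (2 * b1 * x\<^sup>2)"
    using P1_nonneg
  proof eventually_elim
    case (elim x)
    have "x * norm (\<psi> x) \<le> x * (2 * b1 * x)"
      by (intro mult_left_mono norm_\<psi>_le elim)
    then show ?case
      using elim b1_nonneg by (simp add: norm_mult power2_eq_square mult_ac)
  qed
qed simp

lemma Re_\<kappa>_nonneg: "0 \<le> Re \<kappa>"
proof -
  have "Re \<kappa> = (\<integral>x. Re (complex_of_real x * \<psi> x) \<partial>P1)"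
    unfolding \<kappa>_def by (rule integral_Re[OF integrable_\<psi>, symmetric])
  moreover have "AE x in P1. 0 \<le> Re (complex_of_real x * \<psi> x)"
    using P1_nonneg by eventually_elim (simp add: Re_\<psi>_nonneg)
  ultimately show ?thesis by (simp only: integral_nonneg_AE)
qed

lemma effect_error_integrand_le:
  assumes n: "0 < n" "0 < m n" and x: "0 \<le> x"
  shows "norm (complex_of_real (real (m n) * q n x y) * (1 - attribute_gf n x) -
      complex_of_real y * (complex_of_real x * \<psi> x)) \<le> 4 * b1 * x\<^sup>2 * \<bar>y\<bar>"
proof -
  have "norm (complex_of_real (real (m n) * q n x y) * (1 - attribute_gf n x)) =
      (s n * q n x y) * norm (complex_of_real (r n) * (1 - attribute_gf n x))"
    using s_pos[OF n] r_pos[OF n] by (simp add: norm_mult m_eq[OF n] mult_ac)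
  also have "\<dots> \<le> (\<bar>x\<bar> * \<bar>y\<bar>) * (2 * b1 * x)"
    by (rule mult_mono[OF s_mult_q_le[OF n] norm_r_attribute_gf_le[OF x n]]) simp_all
  finally have 1: "norm (complex_of_real (real (m n) * q n x y) * (1 - attribute_gf n x)) \<le> (\<bar>x\<bar> * \<bar>y\<bar>) * (2 * b1 * x)" .
  have "norm (complex_of_real y * (complex_of_real x * \<psi> x)) = (\<bar>x\<bar> * \<bar>y\<bar>) * norm (\<psi> x)"
    by (simp add: norm_mult mult_ac)
  also have "\<dots> \<le> (\<bar>x\<bar> * \<bar>y\<bar>) * (2 * b1 * x)"
    by (intro mult_left_mono norm_\<psi>_le x) auto
  finally have "norm (complex_of_real (real (m n) * q n x y) * (1 - attribute_gf n x) -
      complex_of_real y * (complex_of_real x * \<psi> x)) \<le> (\<bar>x\<bar> * \<bar>y\<bar>) * (2 * b1 * x) + (\<bar>x\<bar> * \<bar>y\<bar>) * (2 * b1 * x)"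
    by (intro order_trans[OF norm_triangle_ineq4] add_mono 1)
  also have "\<dots> = 4 * b1 * x\<^sup>2 * \<bar>y\<bar>"
    using x by (simp add: power2_eq_square mult_ac)
  finally show ?thesis .
qed

lemma integrable_effect_error_integrand:
  assumes n: "0 < n" "0 < m n"
  shows "integrable P1 (\<lambda>x. complex_of_real (real (m n) * q n x y) * (1 - attribute_gf n x) -
      complex_of_real y * (complex_of_real x * \<psi> x))"
proof (rule Bochner_Integration.integrable_bound)
  show "integrable P1 (\<lambda>x. 4 * b1 * x\<^sup>2 * \<bar>y\<bar>)" using sq by simp
  show "AE x in P1. norm (complex_of_real (real (m n) * q n x y) * (1 - attribute_gf n x) -
      complex_of_real y * (complex_of_real x * \<psi> x)) \<le> norm (4 * b1 * x\<^sup>2 * \<bar>y\<bar>)"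
    using P1_nonneg
    by eventually_elim (rule order_trans[OF effect_error_integrand_le[OF n]], simp_all add: b1_nonneg)
qed simp

lemma effect_error_nonneg: "0 \<le> effect_error n y"
  unfolding effect_error_def by simp

lemma effect_error_measurable [measurable]: "effect_error n \<in> borel_measurable borel"
  unfolding effect_error_def[abs_def]
  by (intro P1.borel_measurable_lebesgue_integral) (simp add: split_beta)

lemma effect_error_tendsto_0:
  assumes y: "0 \<le> y"
  shows "(\<lambda>n. effect_error n y) \<longlonglongrightarrow> 0"
proof -
  obtain N where N: "\<And>n. n \<ge> N \<Longrightarrow> 0 < n \<and> 0 < m n"
    using eventually_pos by (auto simp: eventually_sequentially)
  let ?f = "\<lambda>n x. norm (complex_of_real (real (m n) * q n x y) * (1 - attribute_gf n x) -
      complex_of_real y * (complex_of_real x * \<psi> x))"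
  have lim: "(\<lambda>n. ?f n x) \<longlonglongrightarrow> 0" if x: "0 \<le> x" for x
  proof (rule Lim_transform_eventually)
    have "(\<lambda>n. norm (complex_of_real (x * y) * (complex_of_real (r n) * (1 - attribute_gf n x)) -
        complex_of_real (x * y) * \<psi> x)) \<longlonglongrightarrow> norm (complex_of_real (x * y) * \<psi> x - complex_of_real (x * y) * \<psi> x)"
      by (intro tendsto_intros \<psi>_limit' x)
    then show "(\<lambda>n. norm (complex_of_real (x * y) * (complex_of_real (r n) * (1 - attribute_gf n x)) -
        complex_of_real (x * y) * \<psi> x)) \<longlonglongrightarrow> 0" by simp
    show "\<forall>\<^sub>F n in sequentially. norm (complex_of_real (x * y) * (complex_of_real (r n) * (1 - attribute_gf n x)) -
        complex_of_real (x * y) * \<psi> x) = ?f n x"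
      using eventually_pos eventually_s_mult_q[OF x y]
    proof eventually_elim
      case (elim n)
      then have "real (m n) * q n x y = r n * (x * y)"
        by (simp add: m_eq mult.assoc)
      then show ?case by (simp add: mult_ac)
    qed
  qed
  have "(\<lambda>n. \<integral>x. ?f (n + N) x \<partial>P1) \<longlonglongrightarrow> (\<integral>x. 0 \<partial>P1)"
  proof (rule integral_dominated_convergence[where w = "\<lambda>x. 4 * b1 * x\<^sup>2 * \<bar>y\<bar>"])
    show "AE x in P1. (\<lambda>n. ?f (n + N) x) \<longlonglongrightarrow> 0"
      using P1_nonneg by eventually_elim (rule LIMSEQ_ignore_initial_segment[OF lim])
    show "AE x in P1. norm (?f (n + N) x) \<le> 4 * b1 * x\<^sup>2 * \<bar>y\<bar>" for n
      using P1_nonneg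
    proof eventually_elim
      case (elim x)
      then show ?case
        using effect_error_integrand_le[of "n + N" x y] N[of "n + N"] by simp
    qed
  qed (use sq in simp_all)
  then have "(\<lambda>n. effect_error (n + N) y) \<longlonglongrightarrow> 0"
    by (simp only: effect_error_def Bochner_Integration.integral_zero)
  then show ?thesis by (rule LIMSEQ_offset)
qed

text \<open>
  Both factors \<open>1 - (1 - z) q\<close> and \<open>exp (- (1 - z) q)\<close> have modulus at most 1, so the errors of the
  replacement add up; then the exponent is compared with its limit.
\<close>

lemma norm_prod_minus_attribute_gf_le:
  assumes n: "0 < n" "0 < m n" and x: "0 \<le> x"
  shows "norm ((\<Prod>j=2..n. 1 - (1 - z) * complex_of_real (q n x (Y j))) - attribute_gf n x)
    \<le> (\<Sum>j=2..n. 4 * (q n x (Y j))\<^sup>2) + 2 * \<bar>(\<Sum>j=2..n. q n x (Y j)) - x * b1 / r n\<bar>"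
proof -
  let ?\<zeta> = "1 - z" and ?q = "\<lambda>j. q n x (Y j)"
  let ?S = "\<Sum>j=2..n. ?q j"
  have "norm ((\<Prod>j=2..n. 1 - ?\<zeta> * complex_of_real (?q j)) - (\<Prod>j=2..n. exp (- (?\<zeta> * complex_of_real (?q j)))))
      \<le> (\<Sum>j=2..n. norm (1 - ?\<zeta> * complex_of_real (?q j) - exp (- (?\<zeta> * complex_of_real (?q j)))))"
    by (intro norm_prod_diff norm_thin_le_1 z)
      (use Re_thin_nonneg[OF link_prob_nonneg] in \<open>simp_all add: norm_exp_eq_Re\<close>)
  also have "\<dots> \<le> (\<Sum>j=2..n. 4 * (?q j)\<^sup>2)"
  proof (rule sum_mono)
    fix j
    have "norm (1 - ?\<zeta> * complex_of_real (?q j) - exp (- (?\<zeta> * complex_of_real (?q j))))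
        \<le> (norm (?\<zeta> * complex_of_real (?q j)))\<^sup>2"
      by (intro norm_one_minus_minus_exp_le Re_thin_nonneg) simp
    also have "\<dots> = (norm ?\<zeta>)\<^sup>2 * (?q j)\<^sup>2"
      by (simp add: norm_mult power_mult_distrib)
    also have "\<dots> \<le> 2\<^sup>2 * (?q j)\<^sup>2"
      by (intro mult_right_mono power_mono norm_one_minus_z) auto
    finally show "norm (1 - ?\<zeta> * complex_of_real (?q j) - exp (- (?\<zeta> * complex_of_real (?q j)))) \<le> 4 * (?q j)\<^sup>2"
      by simp
  qed
  finally have 1: "norm ((\<Prod>j=2..n. 1 - ?\<zeta> * complex_of_real (?q j)) - exp (- (?\<zeta> * complex_of_real ?S)))
      \<le> (\<Sum>j=2..n. 4 * (?q j)\<^sup>2)"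
    by (simp add: exp_sum sum_distrib_left sum_negf[symmetric])
  have "norm (exp (- (?\<zeta> * complex_of_real ?S)) - attribute_gf n x) \<le>
      norm (?\<zeta> * complex_of_real ?S - ?\<zeta> * complex_of_real (x * b1 / r n))"
    unfolding attribute_gf_def using r_pos[OF n] b1_nonneg x
    by (intro norm_exp_minus_diff_le Re_thin_nonneg sum_nonneg) auto
  also have "\<dots> = norm ?\<zeta> * \<bar>?S - x * b1 / r n\<bar>"
    by (simp only: right_diff_distrib[symmetric] norm_mult of_real_diff[symmetric] norm_of_real)
  also have "\<dots> \<le> 2 * \<bar>?S - x * b1 / r n\<bar>"
    by (intro mult_right_mono norm_one_minus_z) auto
  finally have 2: "norm (exp (- (?\<zeta> * complex_of_real ?S)) - attribute_gf n x) \<le> 2 * \<bar>?S - x * b1 / r n\<bar>" .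
  show ?thesis
    using norm_triangle_mono[OF 1 2] by simp
qed

text \<open>
  The bound \<open>r x y\<close> on \<open>m q(x, y)\<close> is large when \<open>m / n\<close> is. Its factor \<open>r\<close> is paired with the error of
  the product, which is small even after multiplication by \<open>r\<close>; so one estimate serves all regimes.
\<close>

lemma norm_effect_integrand_le:
  assumes n: "0 < n" "0 < m n" and x: "0 \<le> x"
  shows "norm (complex_of_real (real (m n) * q n x y) *
      ((\<Prod>j=2..n. 1 - (1 - z) * complex_of_real (q n x (Y j))) - attribute_gf n x))
    \<le> \<bar>y\<bar> * ((\<Sum>j=2..n. truncation_error n x (Y j)) + 2 * x\<^sup>2 * \<bar>(\<Sum>j=2..n. Y j) / real n - b1\<bar>)"
proof -
  let ?q = "\<lambda>j. q n x (Y j)" and ?U = "\<Prod>j=2..n. 1 - (1 - z) * complex_of_real (q n x (Y j))"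
  note r = r_pos[OF n]
  have A: "r n * \<bar>(\<Sum>j=2..n. ?q j) - x * b1 / r n\<bar>
      \<le> (\<Sum>j=2..n. \<bar>x * Y j / real n - r n * ?q j\<bar>) + x * \<bar>(\<Sum>j=2..n. Y j) / real n - b1\<bar>"
  proof -
    have "r n * \<bar>(\<Sum>j=2..n. ?q j) - x * b1 / r n\<bar> = \<bar>r n * ((\<Sum>j=2..n. ?q j) - x * b1 / r n)\<bar>"
      using r by (simp add: abs_mult)
    also have "\<bar>r n * ((\<Sum>j=2..n. ?q j) - x * b1 / r n)\<bar> = \<bar>
        - (\<Sum>j=2..n. x * Y j / real n - r n * ?q j) + x * ((\<Sum>j=2..n. Y j) / real n - b1)\<bar>"
      using r by (intro arg_cong[where f = abs]) (simp add: sum_subtractf sum_distrib_left sum_divide_distrib right_diff_distrib)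
    also have "\<dots> \<le> \<bar>\<Sum>j=2..n. x * Y j / real n - r n * ?q j\<bar> + \<bar>x * ((\<Sum>j=2..n. Y j) / real n - b1)\<bar>"
      by (rule order_trans[OF abs_triangle_ineq]) simp
    also have "\<dots> \<le> (\<Sum>j=2..n. \<bar>x * Y j / real n - r n * ?q j\<bar>) + x * \<bar>(\<Sum>j=2..n. Y j) / real n - b1\<bar>"
      using x by (intro add_mono sum_abs) (simp add: abs_mult)
    finally show ?thesis .
  qed
  have "norm (complex_of_real (real (m n) * q n x y) * (?U - attribute_gf n x)) = (s n * q n x y) * (r n * norm (?U - attribute_gf n x))"
    using s_pos[OF n] r by (simp add: norm_mult m_eq[OF n] mult_ac)
  also have "\<dots> \<le> (\<bar>x\<bar> * \<bar>y\<bar>) * (r n * ((\<Sum>j=2..n. 4 * (?q j)\<^sup>2) + 2 * \<bar>(\<Sum>j=2..n. ?q j) - x * b1 / r n\<bar>))"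
    using r by (intro mult_mono[OF s_mult_q_le[OF n]] mult_left_mono norm_prod_minus_attribute_gf_le n x) simp_all
  also have "\<dots> \<le> (\<bar>x\<bar> * \<bar>y\<bar>) * ((\<Sum>j=2..n. 4 * r n * (?q j)\<^sup>2) +
      2 * ((\<Sum>j=2..n. \<bar>x * Y j / real n - r n * ?q j\<bar>) + x * \<bar>(\<Sum>j=2..n. Y j) / real n - b1\<bar>))"
  proof (intro mult_left_mono)
    have "r n * (\<Sum>j=2..n. 4 * (?q j)\<^sup>2) = (\<Sum>j=2..n. 4 * r n * (?q j)\<^sup>2)"
      by (simp add: sum_distrib_left mult_ac)
    then show "r n * ((\<Sum>j=2..n. 4 * (?q j)\<^sup>2) + 2 * \<bar>(\<Sum>j=2..n. ?q j) - x * b1 / r n\<bar>)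
      \<le> (\<Sum>j=2..n. 4 * r n * (?q j)\<^sup>2) +
        2 * ((\<Sum>j=2..n. \<bar>x * Y j / real n - r n * ?q j\<bar>) + x * \<bar>(\<Sum>j=2..n. Y j) / real n - b1\<bar>)"
      using A unfolding distrib_left mult.left_commute[of "r n" "2 :: real"] by linarith
  qed simp
  also have "\<dots> = \<bar>y\<bar> * ((\<Sum>j=2..n. truncation_error n x (Y j)) + 2 * x\<^sup>2 * \<bar>(\<Sum>j=2..n. Y j) / real n - b1\<bar>)"
    using x by (simp add: truncation_error_def sum.distrib sum_distrib_left power2_eq_square algebra_simps)
  finally show ?thesis .
qed

lemma norm_effect_minus_\<kappa>_le:
  assumes n: "0 < n" "0 < m n"
  shows "norm (real (m n) * attribute_effect P1 (s n) n z Y - complex_of_real (Y 1) * \<kappa>)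
    \<le> \<bar>Y 1\<bar> * (\<Sum>j=2..n. mean_truncation_error n (Y j)) + 2 * \<bar>Y 1\<bar> * a2 * \<bar>(\<Sum>j=2..n. Y j) / real n - b1\<bar> + effect_error n (Y 1)"
proof -
  let ?U = "\<lambda>x. \<Prod>j=2..n. 1 - (1 - z) * complex_of_real (q n x (Y j))"
  let ?mq = "\<lambda>x. complex_of_real (real (m n) * q n x (Y 1))"
  let ?f = "\<lambda>x. ?mq x * (1 - ?U x)" and ?k = "\<lambda>x. complex_of_real (Y 1) * (complex_of_real x * \<psi> x)"
  let ?A = "\<bar>(\<Sum>j=2..n. Y j) / real n - b1\<bar>"
  let ?g = "\<lambda>x. \<bar>Y 1\<bar> * ((\<Sum>j=2..n. truncation_error n x (Y j)) + 2 * x\<^sup>2 * ?A)"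
  let ?t = "\<lambda>x. norm (?mq x * (1 - attribute_gf n x) - ?k x)"
  have int_f: "integrable P1 ?f"
  proof -
    have "integrable P1 (\<lambda>x. complex_of_real (real (m n)) * (1 - (1 - complex_of_real (q n x (Y 1)) * (1 - ?U x))))"
      by (intro integrable_mult_right Bochner_Integration.integrable_diff
          integrable_attribute_factor[OF P1 z] P1.integrable_const)
    then show ?thesis by (simp add: mult.assoc)
  qed
  have f: "(\<integral>x. ?f x \<partial>P1) = real (m n) * attribute_effect P1 (s n) n z Y"
    unfolding attribute_effect_def by (simp add: mult.assoc)
  have int_k: "integrable P1 ?k" using integrable_\<psi> by simp
  have k: "(\<integral>x. ?k x \<partial>P1) = complex_of_real (Y 1) * \<kappa>"
    unfolding \<kappa>_def by simp
  have int_t: "integrable P1 ?t" by (intro integrable_norm integrable_effect_error_integrand n)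
  have has_g: "has_bochner_integral P1 ?g (\<bar>Y 1\<bar> * ((\<Sum>j=2..n. mean_truncation_error n (Y j)) + 2 * a2 * ?A))"
    unfolding mean_truncation_error_def a2_def
    by (intro has_bochner_integral_mult_right has_bochner_integral_add has_bochner_integral_sum
        has_bochner_integral_mult_left has_bochner_integral_integrable integrable_truncation_error n sq)
  have "norm (real (m n) * attribute_effect P1 (s n) n z Y - complex_of_real (Y 1) * \<kappa>) =
      norm (\<integral>x. ?f x - ?k x \<partial>P1)"
    by (simp only: Bochner_Integration.integral_diff[OF int_f int_k] f k)
  also have "\<dots> \<le> (\<integral>x. norm (?f x - ?k x) \<partial>P1)"
    by (rule integral_norm_bound)
  also have "\<dots> \<le> (\<integral>x. ?g x + ?t x \<partial>P1)"
  proof (rule integral_mono_AE)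
    show "integrable P1 (\<lambda>x. norm (?f x - ?k x))"
      by (intro integrable_norm Bochner_Integration.integrable_diff int_f int_k)
    show "integrable P1 (\<lambda>x. ?g x + ?t x)"
      by (intro Bochner_Integration.integrable_add integrable.intros[OF has_g] int_t)
    show "AE x in P1. norm (?f x - ?k x) \<le> ?g x + ?t x"
      using P1_nonneg
    proof eventually_elim
      case (elim x)
      have e: "?f x - ?k x = - (?mq x * (?U x - attribute_gf n x)) + (?mq x * (1 - attribute_gf n x) - ?k x)"
        by (simp add: algebra_simps)
      have "norm (?f x - ?k x) \<le> norm (?mq x * (?U x - attribute_gf n x)) + ?t x"
        unfolding e by (rule order_trans[OF norm_triangle_ineq]) (simp only: norm_minus_cancel order_refl)
      also have "\<dots> \<le> ?g x + ?t x"
        by (intro add_right_mono norm_effect_integrand_le n elim)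
      finally show ?case .
    qed
  qed
  also have "\<dots> = \<bar>Y 1\<bar> * ((\<Sum>j=2..n. mean_truncation_error n (Y j)) + 2 * a2 * ?A) + effect_error n (Y 1)"
    using has_bochner_integral_integral_eq[OF has_g]
    by (subst Bochner_Integration.integral_add[OF integrable.intros[OF has_g] int_t]) (simp only: effect_error_def)
  finally show ?thesis
    by (simp add: algebra_simps)
qed

text \<open>
  The part of the error that is due to a single vertex of weight \<open>u\<close>, when \<open>v\<^sub>1\<close> has weight \<open>y\<close>: the
  overcount by attributes shared repeatedly, and the truncation.
\<close>

definition vertex_error :: "nat \<Rightarrow> real \<Rightarrow> real \<Rightarrow> real" where
  "vertex_error n y u = 2 * excess (a2 * \<bar>y\<bar> * \<bar>u\<bar> / real n) + \<bar>y\<bar> * mean_truncation_error n u"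

definition deviation :: "nat \<Rightarrow> real \<Rightarrow> (nat \<Rightarrow> real) \<Rightarrow> real" where
  "deviation n y Y = (\<Sum>j=2..n. vertex_error n y (Y j)) + 2 * \<bar>y\<bar> * a2 * \<bar>(\<Sum>j=2..n. Y j) / real n - b1\<bar> +
     (effect_error n y + (norm (complex_of_real y * \<kappa>))\<^sup>2 / real (m n))"

lemma vertex_error_nonneg: "0 \<le> vertex_error n y u"
  unfolding vertex_error_def by (intro add_nonneg_nonneg mult_nonneg_nonneg excess_nonneg mean_truncation_error_nonneg) auto

lemma vertex_error_measurable [measurable]:
  assumes [measurable]: "f \<in> borel_measurable M" "g \<in> borel_measurable M"
  shows "(\<lambda>x. vertex_error n (f x) (g x)) \<in> borel_measurable M"
  unfolding vertex_error_def by measurable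

lemma deviation_nonneg: "0 \<le> deviation n y Y"
  unfolding deviation_def
  by (intro add_nonneg_nonneg sum_nonneg vertex_error_nonneg effect_error_nonneg mult_nonneg_nonneg divide_nonneg_nonneg a2_nonneg) auto

lemma norm_min_deviation_le: "norm (min 2 (deviation n y Y)) \<le> 2"
  using deviation_nonneg[of n y Y] by (simp add: abs_if min_def)

lemma path_prob_le:
  assumes n: "0 < n" "0 < m n"
  shows "real (m n) * path_prob P1 (s n) y u \<le> a2 * \<bar>y\<bar> * \<bar>u\<bar> / real n"
    and path_prob_nonneg: "0 \<le> path_prob P1 (s n) y u"
    and path_prob_le_1: "path_prob P1 (s n) y u \<le> 1"
proof -
  have int: "integrable P1 (\<lambda>x. q n x y * q n x u)"
    by (intro P1.integrable_const_bound[where B = 1] AE_I2) (auto intro!: mult_le_one)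
  show "0 \<le> path_prob P1 (s n) y u"
    unfolding path_prob_def by simp
  show "path_prob P1 (s n) y u \<le> 1"
    unfolding path_prob_def by (intro P1.integral_le_const int AE_I2 mult_le_one) auto
  have "path_prob P1 (s n) y u \<le> (\<integral>x. \<bar>y\<bar> * \<bar>u\<bar> / (s n)\<^sup>2 * x\<^sup>2 \<partial>P1)"
    unfolding path_prob_def
  proof (intro integral_mono int)
    fix x
    have "q n x y * q n x u \<le> (\<bar>x\<bar> * \<bar>y\<bar> / s n) * (\<bar>x\<bar> * \<bar>u\<bar> / s n)"
      using s_pos[OF n] by (intro mult_mono link_prob_le) auto
    also have "\<dots> = \<bar>y\<bar> * \<bar>u\<bar> / (s n)\<^sup>2 * (\<bar>x\<bar> * \<bar>x\<bar>)"
      by (simp add: power2_eq_square mult_ac del: abs_mult_self_eq)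
    finally show "q n x y * q n x u \<le> \<bar>y\<bar> * \<bar>u\<bar> / (s n)\<^sup>2 * x\<^sup>2"
      by (simp add: power2_eq_square)
  qed (use sq in simp)
  also have "\<dots> = \<bar>y\<bar> * \<bar>u\<bar> / (s n)\<^sup>2 * a2"
    by (simp add: a2_def)
  finally have "real (m n) * path_prob P1 (s n) y u \<le> real (m n) * (\<bar>y\<bar> * \<bar>u\<bar> / (s n)\<^sup>2 * a2)"
    by (intro mult_left_mono) auto
  also have "\<dots> = a2 * \<bar>y\<bar> * \<bar>u\<bar> / real n"
    using n by (simp add: s_sq[OF n])
  finally show "real (m n) * path_prob P1 (s n) y u \<le> a2 * \<bar>y\<bar> * \<bar>u\<bar> / real n" .
qed

definition conditional_gf :: "nat \<Rightarrow> (nat \<Rightarrow> real) \<Rightarrow> complex" where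
  "conditional_gf n Y = (\<integral>X. graph_mean (\<lambda>E. z ^ graph_degree n E 1) n (m n) X Y \<partial>(\<Pi>\<^sub>M i\<in>{1..m n}. P1))"

lemma norm_z_power_le_1: "norm (z ^ k) \<le> 1"
  using z by (simp add: norm_power power_le_one)

lemma norm_conditional_gf_le_1: "norm (conditional_gf n Y) \<le> 1"
proof -
  interpret W: prob_space "\<Pi>\<^sub>M i\<in>{1..m n}. P1" by (intro prob_space_PiM P1.prob_space_axioms)
  show ?thesis
    unfolding conditional_gf_def
  proof (cases "integrable (\<Pi>\<^sub>M i\<in>{1..m n}. P1) (\<lambda>X. graph_mean (\<lambda>E. z ^ graph_degree n E 1) n (m n) X Y)")
    case True
    then show "norm (\<integral>X. graph_mean (\<lambda>E. z ^ graph_degree n E 1) n (m n) X Y \<partial>(\<Pi>\<^sub>M i\<in>{1..m n}. P1)) \<le> 1"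
      by (intro order_trans[OF integral_norm_bound] W.integral_le_const integrable_norm AE_I2
          norm_graph_mean_le norm_z_power_le_1)
  qed (simp add: not_integrable_integral_eq)
qed

lemma norm_exp_\<kappa>_le_1: "0 \<le> y \<Longrightarrow> norm (exp (- (complex_of_real y * \<kappa>))) \<le> 1"
  using Re_\<kappa>_nonneg by (simp add: norm_exp_eq_Re)

lemma norm_conditional_gf_minus_exp_le:
  assumes n: "0 < n" "0 < m n" and Y: "Y \<in> space (\<Pi>\<^sub>M j\<in>{1..n}. P2)" and Y1: "0 \<le> Y 1"
  shows "norm (conditional_gf n Y - exp (- (complex_of_real (Y 1) * \<kappa>))) \<le> min 2 (deviation n (Y 1) Y)"
proof -
  let ?\<phi> = "attribute_effect P1 (s n) n z Y" and ?c = "complex_of_real (Y 1) * \<kappa>"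
  let ?g = "\<lambda>j. path_prob P1 (s n) (Y 1) (Y j)"
  have "norm (conditional_gf n Y - (1 - ?\<phi>) ^ m n) \<le> 2 * (\<Sum>j=2..n. m n * ?g j - 1 + (1 - ?g j) ^ m n)"
    unfolding conditional_gf_def by (rule norm_graph_mean_degree_diff_le[OF P1 P2 Y z]) (simp add: s_def)
  also have "\<dots> \<le> 2 * (\<Sum>j=2..n. excess (a2 * \<bar>Y 1\<bar> * \<bar>Y j\<bar> / real n))"
  proof (intro mult_left_mono sum_mono)
    fix j
    have "m n * ?g j - 1 + (1 - ?g j) ^ m n \<le> excess (m n * ?g j)"
      by (intro binomial_excess_le path_prob_nonneg path_prob_le_1 n)
    also have "\<dots> \<le> excess (a2 * \<bar>Y 1\<bar> * \<bar>Y j\<bar> / real n)"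
      by (intro excess_mono path_prob_le n mult_nonneg_nonneg path_prob_nonneg) simp
    finally show "m n * ?g j - 1 + (1 - ?g j) ^ m n \<le> excess (a2 * \<bar>Y 1\<bar> * \<bar>Y j\<bar> / real n)" .
  qed simp
  finally have 1: "norm (conditional_gf n Y - (1 - ?\<phi>) ^ m n) \<le> 2 * (\<Sum>j=2..n. excess (a2 * \<bar>Y 1\<bar> * \<bar>Y j\<bar> / real n))" .
  have "norm ((1 - ?\<phi>) ^ m n - exp (- ?c)) \<le> norm (of_nat (m n) * ?\<phi> - ?c) + (norm ?c)\<^sup>2 / real (m n)"
    using Re_\<kappa>_nonneg Y1 n by (intro norm_power_minus_exp_le norm_one_minus_attribute_effect_le_1 P1 z) simp_all
  also have "norm (of_nat (m n) * ?\<phi> - ?c) \<le>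
      \<bar>Y 1\<bar> * (\<Sum>j=2..n. mean_truncation_error n (Y j)) + 2 * \<bar>Y 1\<bar> * a2 * \<bar>(\<Sum>j=2..n. Y j) / real n - b1\<bar> + effect_error n (Y 1)"
    using norm_effect_minus_\<kappa>_le[OF n, of Y] by simp
  finally have 2: "norm ((1 - ?\<phi>) ^ m n - exp (- ?c)) \<le>
      \<bar>Y 1\<bar> * (\<Sum>j=2..n. mean_truncation_error n (Y j)) + 2 * \<bar>Y 1\<bar> * a2 * \<bar>(\<Sum>j=2..n. Y j) / real n - b1\<bar> + effect_error n (Y 1) +
      (norm ?c)\<^sup>2 / real (m n)"
    by simp
  have "norm (conditional_gf n Y - exp (- ?c)) \<le> norm (conditional_gf n Y - (1 - ?\<phi>) ^ m n) + norm ((1 - ?\<phi>) ^ m n - exp (- ?c))"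
    using norm_triangle_ineq[of "conditional_gf n Y - (1 - ?\<phi>) ^ m n" "(1 - ?\<phi>) ^ m n - exp (- ?c)"] by simp
  also have "\<dots> \<le> deviation n (Y 1) Y"
    unfolding deviation_def vertex_error_def sum.distrib sum_distrib_left[symmetric] using 1 2 by linarith
  finally have "norm (conditional_gf n Y - exp (- ?c)) \<le> deviation n (Y 1) Y" .
  moreover have "norm (conditional_gf n Y - exp (- ?c)) \<le> 1 + 1"
    by (intro order_trans[OF norm_triangle_ineq4] add_mono norm_conditional_gf_le_1 norm_exp_\<kappa>_le_1 Y1)
  ultimately show ?thesis by simp
qed

lemma n_vertex_error_le:
  assumes n: "0 < n" "0 < m n"
  shows "real n * vertex_error n y u \<le> 10 * a2 * \<bar>y\<bar> * \<bar>u\<bar>"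
proof -
  have "real n * excess (a2 * \<bar>y\<bar> * \<bar>u\<bar> / real n) \<le> real n * (a2 * \<bar>y\<bar> * \<bar>u\<bar> / real n)"
    using a2_nonneg by (intro mult_left_mono excess_le) auto
  moreover have "\<bar>y\<bar> * (real n * mean_truncation_error n u) \<le> \<bar>y\<bar> * (8 * a2 * \<bar>u\<bar>)"
    by (intro mult_left_mono n_mean_truncation_error_le n) auto
  ultimately show ?thesis
    using n by (simp add: vertex_error_def algebra_simps)
qed

lemma integrable_vertex_error:
  assumes n: "0 < n" "0 < m n"
  shows "integrable P2 (vertex_error n y)"
proof (rule Bochner_Integration.integrable_bound)
  show "integrable P2 (\<lambda>u. 10 * a2 * \<bar>y\<bar> / real n * \<bar>u\<bar>)"
    using int_abs_P2 by simp
  show "AE u in P2. norm (vertex_error n y u) \<le> norm (10 * a2 * \<bar>y\<bar> / real n * \<bar>u\<bar>)"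
    using n_vertex_error_le[OF n, of y] n a2_nonneg by (intro AE_I2) (simp add: vertex_error_nonneg field_simps abs_mult)
qed simp

lemma n_vertex_error_tendsto_0:
  assumes u: "0 \<le> u"
  shows "(\<lambda>n. real n * vertex_error n y u) \<longlonglongrightarrow> 0"
proof -
  let ?a = "a2 * \<bar>y\<bar> * \<bar>u\<bar>"
  have "(\<lambda>n. real n * excess (?a / real n)) \<longlonglongrightarrow> 0"
  proof (rule tendsto_sandwich[OF _ _ tendsto_const])
    show "\<forall>\<^sub>F n in sequentially. 0 \<le> real n * excess (?a / real n)"
      by (simp add: excess_nonneg)
    show "\<forall>\<^sub>F n in sequentially. real n * excess (?a / real n) \<le> ?a\<^sup>2 * (1 / real n)"
      using eventually_gt_at_top[of 0]
    proof eventually_elim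
      case (elim n)
      have "real n * excess (?a / real n) \<le> real n * (?a / real n)\<^sup>2"
        using a2_nonneg by (intro mult_left_mono excess_le_square) auto
      then show ?case using elim by (simp add: power2_eq_square)
    qed
    have "(\<lambda>n. ?a\<^sup>2 * (1 / real n)) \<longlonglongrightarrow> ?a\<^sup>2 * 0"
      by (intro tendsto_intros lim_1_over_n)
    then show "(\<lambda>n. ?a\<^sup>2 * (1 / real n)) \<longlonglongrightarrow> 0" by simp
  qed
  then have "(\<lambda>n. 2 * (real n * excess (?a / real n)) + \<bar>y\<bar> * (real n * mean_truncation_error n u)) \<longlonglongrightarrow> 2 * 0 + \<bar>y\<bar> * 0"
    by (intro tendsto_intros n_mean_truncation_error_tendsto_0 u)
  then show ?thesis by (simp add: vertex_error_def algebra_simps)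
qed

lemma n_integral_vertex_error_tendsto_0: "(\<lambda>n. real n * (\<integral>u. vertex_error n y u \<partial>P2)) \<longlonglongrightarrow> 0"
proof -
  obtain N where N: "\<And>n. n \<ge> N \<Longrightarrow> 0 < n \<and> 0 < m n"
    using eventually_pos by (auto simp: eventually_sequentially)
  have "(\<lambda>n. \<integral>u. real (n + N) * vertex_error (n + N) y u \<partial>P2) \<longlonglongrightarrow> (\<integral>u. 0 \<partial>P2)"
  proof (rule integral_dominated_convergence[where w = "\<lambda>u. 10 * a2 * \<bar>y\<bar> * \<bar>u\<bar>"])
    show "AE u in P2. (\<lambda>n. real (n + N) * vertex_error (n + N) y u) \<longlonglongrightarrow> 0"
      using P2_nonneg by eventually_elim (rule LIMSEQ_ignore_initial_segment[OF n_vertex_error_tendsto_0])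
    show "AE u in P2. norm (real (n + N) * vertex_error (n + N) y u) \<le> 10 * a2 * \<bar>y\<bar> * \<bar>u\<bar>" for n
      using n_vertex_error_le[of "n + N" y] N[of "n + N"] by (intro AE_I2) (simp add: vertex_error_nonneg abs_mult)
  qed (use int_abs_P2 in simp_all)
  then have "(\<lambda>n. real (n + N) * (\<integral>u. vertex_error (n + N) y u \<partial>P2)) \<longlonglongrightarrow> 0"
    by simp
  then show ?thesis by (rule LIMSEQ_offset)
qed

text \<open>
  For a fixed weight of \<open>v\<^sub>1\<close> the mean of the deviation tends to 0. The minimum with 2 makes the
  convergence bounded in this weight: the deviation itself is quadratic in it, and the second moment of
  the vertex weights may be infinite.
\<close>

lemma mean_deviation_tendsto_0:
  assumes y: "0 \<le> y"
  shows "(\<lambda>n. \<integral>Y. min 2 (deviation n y Y) \<partial>(\<Pi>\<^sub>M j\<in>{2..n}. P2)) \<longlonglongrightarrow> 0"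
proof (rule tendsto_sandwich[OF _ _ tendsto_const])
  let ?W = "\<lambda>n. \<Pi>\<^sub>M j\<in>{2..n}. P2"
  let ?L = "\<lambda>n. \<integral>Y. \<bar>(\<Sum>j=2..n. Y j) / real n - b1\<bar> \<partial>?W n"
  let ?c = "complex_of_real y * \<kappa>"
  show "\<forall>\<^sub>F n in sequentially. 0 \<le> (\<integral>Y. min 2 (deviation n y Y) \<partial>?W n)"
    by (intro always_eventually allI integral_nonneg_AE AE_I2) (simp add: deviation_nonneg)
  show "\<forall>\<^sub>F n in sequentially. (\<integral>Y. min 2 (deviation n y Y) \<partial>?W n) \<le>
      real n * (\<integral>u. vertex_error n y u \<partial>P2) + 2 * y * a2 * ?L n + (effect_error n y + (norm ?c)\<^sup>2 / real (m n))"
    using eventually_pos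
  proof eventually_elim
    case (elim n)
    then have n: "0 < n" "0 < m n" by auto
    interpret W: prob_space "?W n" by (intro prob_space_PiM P2.prob_space_axioms)
    have compF: "has_bochner_integral (?W n) (\<lambda>Y. vertex_error n y (Y j)) (\<integral>u. vertex_error n y u \<partial>P2)" if j: "j \<in> {2..n}" for j
      using integrable_PiM_component_iff[OF P2.prob_space_axioms j borel_measurable_integrable[OF integrable_vertex_error[OF n, of y]]]
        integral_PiM_component[OF P2.prob_space_axioms j borel_measurable_integrable[OF integrable_vertex_error[OF n, of y]]]
        integrable_vertex_error[OF n, of y]
      by (simp only: has_bochner_integral_iff)
    have avg: "has_bochner_integral (?W n) (\<lambda>Y. \<bar>(\<Sum>j=2..n. Y j) / real n - b1\<bar>) (?L n)"
      using int_P2 integrable_PiM_component_iff[OF P2.prob_space_axioms _ borel_measurable_integrable[OF int_P2],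
          of _ "{2..n}"]
      by (intro has_bochner_integral_integrable integrable_abs Bochner_Integration.integrable_diff
          integrable_divide_zero Bochner_Integration.integrable_sum W.integrable_const) (simp only:)
    have const: "has_bochner_integral (?W n) (\<lambda>Y. c) c" for c :: real
      using W.prob_space by (simp add: has_bochner_integral_iff)
    have has: "has_bochner_integral (?W n) (deviation n y)
        ((\<Sum>j=2..n. \<integral>u. vertex_error n y u \<partial>P2) + 2 * \<bar>y\<bar> * a2 * ?L n + (effect_error n y + (norm ?c)\<^sup>2 / real (m n)))"
      unfolding deviation_def[abs_def]
      by (intro has_bochner_integral_add has_bochner_integral_sum has_bochner_integral_mult_right compF avg const)
    have "(\<integral>Y. min 2 (deviation n y Y) \<partial>?W n) \<le> (\<integral>Y. deviation n y Y \<partial>?W n)"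
      by (intro integral_mono integrable_min integrable.intros[OF has] W.integrable_const) simp
    also have "\<dots> = (\<Sum>j=2..n. \<integral>u. vertex_error n y u \<partial>P2) + 2 * \<bar>y\<bar> * a2 * ?L n + (effect_error n y + (norm ?c)\<^sup>2 / real (m n))"
      by (rule has_bochner_integral_integral_eq[OF has])
    also have "(\<Sum>j=2..n. \<integral>u. vertex_error n y u \<partial>P2) \<le> real n * (\<integral>u. vertex_error n y u \<partial>P2)"
      by (simp add: mult_right_mono vertex_error_nonneg)
    finally show ?case using y by simp
  qed
  have "(\<lambda>n. real n * (\<integral>u. vertex_error n y u \<partial>P2) + 2 * y * a2 * ?L n + (effect_error n y + (norm ?c)\<^sup>2 / real (m n))) \<longlonglongrightarrow>
      0 + 2 * y * a2 * 0 + (0 + 0)"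
  proof (intro tendsto_add tendsto_mult tendsto_const n_integral_vertex_error_tendsto_0 effect_error_tendsto_0 y)
    show "?L \<longlonglongrightarrow> 0"
      using weak_law_L1[OF P2 int_P2] unfolding b1_def .
    show "(\<lambda>n. (norm ?c)\<^sup>2 / real (m n)) \<longlonglongrightarrow> 0"
      by (intro tendsto_divide_0[OF tendsto_const] filterlim_at_top_imp_at_infinity
          filterlim_compose[OF filterlim_real_sequentially m_infinity])
  qed
  then show "(\<lambda>n. real n * (\<integral>u. vertex_error n y u \<partial>P2) + 2 * y * a2 * ?L n + (effect_error n y + (norm ?c)\<^sup>2 / real (m n))) \<longlonglongrightarrow> 0"
    by simp
qed

text \<open>
  The vertex weights other than \<open>Y\<^sub>1\<close> are integrated out first; dominated convergence in \<open>Y\<^sub>1\<close> finishes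
  the proof.
\<close>

theorem degree_generating_function_limit:
  "(\<lambda>n. \<integral>E. z ^ graph_degree n E 1 \<partial>rig P1 P2 n (m n)) \<longlonglongrightarrow>
     (\<integral>y. exp (- (complex_of_real y * \<kappa>)) \<partial>P2)"
proof -
  let ?J = "\<lambda>n y. \<integral>Y. min 2 (deviation n y Y) \<partial>(\<Pi>\<^sub>M j\<in>{2..n}. P2)"
  let ?e = "\<lambda>y. exp (- (complex_of_real y * \<kappa>))"
  have dev_meas: "(\<lambda>(y, Y). deviation n y Y) \<in> borel_measurable (borel \<Otimes>\<^sub>M (\<Pi>\<^sub>M j\<in>{2..n}. P2))" for n
  proof -
    have [measurable]: "(\<lambda>\<omega>. snd \<omega> j) \<in> borel_measurable (borel \<Otimes>\<^sub>M (\<Pi>\<^sub>M j\<in>{2..n}. P2))"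
      if "j \<in> {2..n}" for j
      using measurable_compose[OF measurable_snd measurable_component_singleton[OF that, of "\<lambda>_. P2"]]
      by (simp cong: measurable_cong_sets)
    show ?thesis
      unfolding deviation_def split_beta by measurable
  qed
  have J_meas [measurable]: "?J n \<in> borel_measurable borel" for n
  proof -
    interpret W: prob_space "\<Pi>\<^sub>M j\<in>{2..n}. P2" by (intro prob_space_PiM P2.prob_space_axioms)
    show ?thesis
      by (intro W.borel_measurable_lebesgue_integral)
        (use dev_meas[of n] in \<open>simp add: split_beta\<close>)
  qed
  have J_bound: "norm (?J n y) \<le> 2" for n y
  proof -
    interpret W: prob_space "\<Pi>\<^sub>M j\<in>{2..n}. P2" by (intro prob_space_PiM P2.prob_space_axioms)
    have "integrable (\<Pi>\<^sub>M j\<in>{2..n}. P2) (\<lambda>Y. min 2 (deviation n y Y))"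
      using measurable_compose[OF measurable_Pair1'[of y borel] dev_meas[of n]]
      by (intro W.integrable_const_bound[where B = 2] AE_I2 norm_min_deviation_le) simp
    then have "?J n y \<le> 2" by (intro W.integral_le_const AE_I2 min.cobounded1)
    moreover have "0 \<le> ?J n y" by (intro integral_nonneg_AE AE_I2) (simp add: deviation_nonneg)
    ultimately show ?thesis by simp
  qed
  have J_lim: "(\<lambda>n. \<integral>y. ?J n y \<partial>P2) \<longlonglongrightarrow> (\<integral>y. 0 \<partial>P2)"
  proof (rule integral_dominated_convergence[where w = "\<lambda>_. 2"])
    show "AE y in P2. (\<lambda>n. ?J n y) \<longlonglongrightarrow> 0"
      using P2_nonneg by eventually_elim (rule mean_deviation_tendsto_0)
  qed (use J_bound in auto)
  have bound: "norm ((\<integral>E. z ^ graph_degree n E 1 \<partial>rig P1 P2 n (m n)) - (\<integral>y. ?e y \<partial>P2)) \<le> (\<integral>y. ?J n y \<partial>P2)"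
    if n: "0 < n" "0 < m n" for n
  proof -
    let ?W = "\<Pi>\<^sub>M j\<in>{1..n}. P2" and ?W' = "\<Pi>\<^sub>M j\<in>{2..n}. P2"
    interpret W: prob_space ?W by (intro prob_space_PiM P2.prob_space_axioms)
    interpret W': prob_space ?W' by (intro prob_space_PiM P2.prob_space_axioms)
    interpret PW: pair_prob_space P2 ?W' ..
    have one: "1 \<in> {1..n}" and ins: "{1..n} = insert 1 {2..n}" using n by auto
    have rig: "(\<integral>E. z ^ graph_degree n E 1 \<partial>rig P1 P2 n (m n)) = (\<integral>Y. conditional_gf n Y \<partial>?W)"
      unfolding conditional_gf_def by (rule integral_rig[OF P1 P2 norm_z_power_le_1])
    have int_G: "integrable ?W (conditional_gf n)"
      unfolding conditional_gf_def[abs_def] by (rule integrable_graph_mean[OF P1 P2 norm_z_power_le_1])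
    have int_e: "integrable P2 ?e"
    proof (rule P2.integrable_const_bound[where B = 1])
      show "AE y in P2. norm (?e y) \<le> 1"
        using P2_nonneg by eventually_elim (rule norm_exp_\<kappa>_le_1)
    qed simp
    have e: "(\<integral>y. ?e y \<partial>P2) = (\<integral>Y. ?e (Y 1) \<partial>?W)"
      by (rule integral_PiM_component[OF P2.prob_space_axioms one borel_measurable_integrable[OF int_e], symmetric])
    have int_eW: "integrable ?W (\<lambda>Y. ?e (Y 1))"
      using integrable_PiM_component_iff[OF P2.prob_space_axioms one borel_measurable_integrable[OF int_e]] int_e
      by (simp only:)
    \<comment> \<open>Split the weight of vertex 1 off the product measure.\<close>
    have upd: "distr (P2 \<Otimes>\<^sub>M ?W') ?W (\<lambda>(y, Y). Y(1 := y)) = ?W"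
      using distr_pair_PiM_eq_PiM[of "{2..n}" "\<lambda>_. P2" 1] P2.prob_space_axioms unfolding ins by simp
    have upd_meas: "(\<lambda>(y, Y). Y(1 := y)) \<in> P2 \<Otimes>\<^sub>M ?W' \<rightarrow>\<^sub>M ?W"
      unfolding ins by measurable
    have dev_upd: "deviation n ((Y(1 := y)) 1) (Y(1 := y)) = deviation n y Y" for y Y
      unfolding deviation_def by simp
    have dev_W: "(\<lambda>Y. deviation n (Y 1) Y) \<in> borel_measurable ?W"
    proof -
      have comp: "(\<lambda>Y. Y j) \<in> borel_measurable ?W" if "j \<in> {1..n}" for j
        using measurable_component_singleton[OF that, of "\<lambda>_. P2"] by (simp cong: measurable_cong_sets)
      have [measurable]: "(\<lambda>Y. Y 1) \<in> borel_measurable ?W" by (rule comp[OF one])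
      have [measurable]: "(\<lambda>Y. Y j) \<in> borel_measurable ?W" if "j \<in> {2..n}" for j
        using that by (intro comp) auto
      show ?thesis
        unfolding deviation_def by measurable
    qed
    have int_dev: "integrable ?W (\<lambda>Y. min 2 (deviation n (Y 1) Y))"
      using dev_W by (intro W.integrable_const_bound[where B = 2] AE_I2 norm_min_deviation_le) simp
    have int_dev': "integrable (P2 \<Otimes>\<^sub>M ?W') (\<lambda>(y, Y). min 2 (deviation n y Y))"
    proof (rule PW.integrable_const_bound[where B = 2])
      show "AE \<omega> in P2 \<Otimes>\<^sub>M ?W'. norm (case \<omega> of (y, Y) \<Rightarrow> min 2 (deviation n y Y)) \<le> 2"
        unfolding split_beta by (intro AE_I2 norm_min_deviation_le)
      have "(\<lambda>(y, Y). deviation n y Y) \<in> borel_measurable (P2 \<Otimes>\<^sub>M ?W')"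
        using dev_meas[of n] by (simp cong: measurable_cong_sets sets_pair_measure_cong)
      then show "(\<lambda>(y, Y). min 2 (deviation n y Y)) \<in> borel_measurable (P2 \<Otimes>\<^sub>M ?W')"
        unfolding split_beta by measurable
    qed
    have "norm ((\<integral>E. z ^ graph_degree n E 1 \<partial>rig P1 P2 n (m n)) - (\<integral>y. ?e y \<partial>P2)) =
        norm (\<integral>Y. conditional_gf n Y - ?e (Y 1) \<partial>?W)"
      by (simp only: rig e Bochner_Integration.integral_diff[OF int_G int_eW])
    also have "\<dots> \<le> (\<integral>Y. norm (conditional_gf n Y - ?e (Y 1)) \<partial>?W)"
      by (rule integral_norm_bound)
    also have "\<dots> \<le> (\<integral>Y. min 2 (deviation n (Y 1) Y) \<partial>?W)"
    proof (rule integral_mono_AE)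
      show "AE Y in ?W. norm (conditional_gf n Y - ?e (Y 1)) \<le> min 2 (deviation n (Y 1) Y)"
        using AE_PiM_component[OF P2.prob_space_axioms one P2_nonneg] AE_space
        by eventually_elim (rule norm_conditional_gf_minus_exp_le[OF n])
    qed (intro integrable_norm Bochner_Integration.integrable_diff int_G int_eW int_dev)+
    also have "\<dots> = (\<integral>(y, Y). min 2 (deviation n y Y) \<partial>(P2 \<Otimes>\<^sub>M ?W'))"
      using integral_distr[OF upd_meas borel_measurable_integrable[OF int_dev]]
      unfolding upd split_beta dev_upd .
    also have "\<dots> = (\<integral>y. ?J n y \<partial>P2)"
      by (rule PW.integral_fst[OF int_dev', symmetric])
    finally show ?thesis .
  qed
  have "(\<lambda>n. (\<integral>E. z ^ graph_degree n E 1 \<partial>rig P1 P2 n (m n)) - (\<integral>y. ?e y \<partial>P2)) \<longlonglongrightarrow> 0"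
  proof (rule Lim_null_comparison)
    show "\<forall>\<^sub>F n in sequentially. norm ((\<integral>E. z ^ graph_degree n E 1 \<partial>rig P1 P2 n (m n)) - (\<integral>y. ?e y \<partial>P2))
        \<le> (\<integral>y. ?J n y \<partial>P2)"
      using eventually_pos by eventually_elim (rule bound, auto)
    show "(\<lambda>n. \<integral>y. ?J n y \<partial>P2) \<longlonglongrightarrow> 0" using J_lim by simp
  qed
  then show ?thesis by (rule LIM_zero_cancel)
qed

end

section \<open>Generating functions of the limit laws\<close>

lemma sums_expectation_pmf_nat:
  fixes g :: "nat \<Rightarrow> complex"
  assumes "\<And>k. norm (g k) \<le> 1"
  shows "(\<lambda>k. complex_of_real (pmf L k) * g k) sums measure_pmf.expectation L g"
proof -
  have int: "integrable (measure_pmf L) g"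
    by (intro measure_pmf.integrable_const_bound[where B = 1] AE_I2 assms) simp
  have "integrable (count_space UNIV) (\<lambda>k. pmf L k *\<^sub>R g k)"
    using int unfolding measure_pmf_eq_density by (subst (asm) integrable_density) auto
  from sums_integral_count_space_nat[OF this]
  have "(\<lambda>k. pmf L k *\<^sub>R g k) sums (\<integral>k. pmf L k *\<^sub>R g k \<partial>count_space UNIV)" .
  also have "(\<integral>k. pmf L k *\<^sub>R g k \<partial>count_space UNIV) = measure_pmf.expectation L g"
    unfolding measure_pmf_eq_density by (subst integral_density) auto
  finally show ?thesis by (simp add: scaleR_conv_of_real)
qed

lemma poisson_sums:
  fixes f :: real and w :: complex
  shows "(\<lambda>k. complex_of_real (exp (- f) * (f ^ k / fact k)) * w ^ k) sums exp (- (complex_of_real f * (1 - w)))"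
proof -
  have "(\<lambda>k. exp (- complex_of_real f) * ((complex_of_real f * w) ^ k /\<^sub>R fact k)) sums
      (exp (- complex_of_real f) * exp (complex_of_real f * w))"
    by (intro sums_mult exp_converges)
  also have "exp (- complex_of_real f) * exp (complex_of_real f * w) = exp (- (complex_of_real f * (1 - w)))"
    by (simp add: algebra_simps flip: exp_add)
  also have "(\<lambda>k. exp (- complex_of_real f) * ((complex_of_real f * w) ^ k /\<^sub>R fact k)) =
      (\<lambda>k. complex_of_real (exp (- f) * (f ^ k / fact k)) * w ^ k)"
    by (intro ext) (simp add: power_mult_distrib scaleR_conv_of_real exp_of_real[symmetric] field_simps)
  finally show ?thesis .
qed

text \<open>
  The weight \<open>h = 1\<close> gives the generating function of a mixed Poisson law and \<open>h = f\<close> that of its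
  size-biased version, since \<open>(k + 1) f ^ (k + 1) / (k + 1)! = f * f ^ k / k!\<close>.
\<close>

lemma weighted_mixed_poisson_sums:
  fixes w :: complex
  assumes P: "prob_space P" and f [measurable]: "f \<in> borel_measurable P" and nonneg: "AE x in P. 0 \<le> f x"
    and h: "integrable P h" and w: "norm w \<le> 1"
  shows "(\<lambda>k. complex_of_real (\<integral>x. h x * (exp (- f x) * (f x ^ k / fact k)) \<partial>P) * w ^ k) sums
      (\<integral>x. complex_of_real (h x) * exp (- (complex_of_real (f x) * (1 - w))) \<partial>P)"
proof -
  interpret prob_space P by (rule P)
  have [measurable]: "h \<in> borel_measurable P" using h by simp
  let ?p = "\<lambda>k x. exp (- f x) * (f x ^ k / fact k)"
  let ?F = "\<lambda>k x. complex_of_real (h x) * (complex_of_real (?p k x) * w ^ k)"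
  have p_sums: "(\<lambda>k. ?p k x) sums 1" for x
  proof -
    have "(\<lambda>k. exp (- f x) * (f x ^ k /\<^sub>R fact k)) sums (exp (- f x) * exp (f x))"
      by (intro sums_mult exp_converges)
    then show ?thesis by (simp add: divide_inverse mult_ac flip: exp_add)
  qed
  have p_sum_le: "(\<Sum>k<K. ?p k x) \<le> 1" if "0 \<le> f x" for K x
    using sum_le_suminf[OF sums_summable[OF p_sums[of x]], of "{..<K}"] that sums_unique[OF p_sums[of x]]
    by simp
  have F_le: "norm (?F k x) \<le> \<bar>h x\<bar> * ?p k x" if "0 \<le> f x" for k x
  proof -
    have "norm (?F k x) = \<bar>h x\<bar> * (?p k x * norm w ^ k)"
      using that by (simp add: norm_mult norm_power norm_divide)
    also have "\<dots> \<le> \<bar>h x\<bar> * (?p k x * 1)"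
      using that w by (intro mult_left_mono power_le_one) auto
    finally show ?thesis by simp
  qed
  have sum_le: "(\<Sum>k<K. \<bar>h x\<bar> * ?p k x) \<le> \<bar>h x\<bar>" if "0 \<le> f x" for K x
    using mult_left_mono[OF p_sum_le[OF that, of K], of "\<bar>h x\<bar>"] by (simp add: sum_distrib_left)
  have int_p: "integrable P (\<lambda>x. \<bar>h x\<bar> * ?p k x)" for k
  proof (rule Bochner_Integration.integrable_bound)
    show "integrable P (\<lambda>x. \<bar>h x\<bar>)" using h by (rule integrable_abs)
    show "AE x in P. norm (\<bar>h x\<bar> * ?p k x) \<le> norm \<bar>h x\<bar>"
      using nonneg
    proof eventually_elim
      case (elim x)
      have "?p k x \<le> (\<Sum>i<Suc k. ?p i x)"
        using elim by (simp add: sum_nonneg)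
      also have "\<dots> \<le> 1" by (rule p_sum_le[OF elim])
      finally have "\<bar>h x\<bar> * ?p k x \<le> \<bar>h x\<bar> * 1" by (intro mult_left_mono) auto
      then show ?case using elim by (simp add: abs_mult)
    qed
  qed simp
  have int_F: "integrable P (?F k)" for k
    by (rule Bochner_Integration.integrable_bound[OF int_p[of k]])
      (simp, use nonneg in eventually_elim, rule order_trans[OF F_le], simp_all add: abs_mult)
  have summ: "summable (\<lambda>k. \<integral>x. norm (?F k x) \<partial>P)"
  proof (rule summableI_nonneg_bounded[where x = "\<integral>x. \<bar>h x\<bar> \<partial>P"])
    fix K
    have "(\<Sum>k<K. \<integral>x. norm (?F k x) \<partial>P) = (\<integral>x. (\<Sum>k<K. norm (?F k x)) \<partial>P)"
      by (rule Bochner_Integration.integral_sum[symmetric]) (intro integrable_norm int_F)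
    also have "\<dots> \<le> (\<integral>x. \<bar>h x\<bar> \<partial>P)"
    proof (rule integral_mono_AE)
      show "AE x in P. (\<Sum>k<K. norm (?F k x)) \<le> \<bar>h x\<bar>"
        using nonneg by eventually_elim (rule order_trans[OF sum_mono[OF F_le] sum_le])
    qed (intro Bochner_Integration.integrable_sum integrable_norm int_F, rule integrable_abs[OF h])
    finally show "(\<Sum>k<K. \<integral>x. norm (?F k x) \<partial>P) \<le> (\<integral>x. \<bar>h x\<bar> \<partial>P)" .
  qed simp
  have AE_summ: "AE x in P. summable (\<lambda>k. norm (?F k x))"
    using nonneg
  proof eventually_elim
    case (elim x)
    show ?case
      by (rule summable_comparison_test'[OF summable_mult[OF sums_summable[OF p_sums[of x]], of "\<bar>h x\<bar>"], of 0])
        (use F_le[OF elim] in simp)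
  qed
  have "(\<lambda>k. \<integral>x. ?F k x \<partial>P) sums (\<integral>x. (\<Sum>k. ?F k x) \<partial>P)"
    by (rule sums_integral[OF int_F AE_summ summ])
  also have "(\<integral>x. (\<Sum>k. ?F k x) \<partial>P) =
      (\<integral>x. complex_of_real (h x) * exp (- (complex_of_real (f x) * (1 - w))) \<partial>P)"
    by (intro Bochner_Integration.integral_cong refl sums_unique[symmetric] sums_mult poisson_sums)
  also have "(\<lambda>k. \<integral>x. ?F k x \<partial>P) =
      (\<lambda>k. complex_of_real (\<integral>x. h x * ?p k x \<partial>P) * w ^ k)"
  proof
    fix k
    have "?F k x = complex_of_real (h x * ?p k x) * w ^ k" for x by (simp only: of_real_mult mult_ac)
    then show "(\<integral>x. ?F k x \<partial>P) = complex_of_real (\<integral>x. h x * ?p k x \<partial>P) * w ^ k"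
      by (simp only: integral_mult_left_zero integral_complex_of_real)
  qed
  finally show ?thesis .
qed

lemma mixed_poisson_generating_function:
  fixes w :: complex
  assumes "prob_space P" "f \<in> borel_measurable P" "AE x in P. 0 \<le> f x" "norm w \<le> 1"
  shows "measure_pmf.expectation (mixed_poisson P f) (\<lambda>k. w ^ k) =
      (\<integral>x. exp (- (complex_of_real (f x) * (1 - w))) \<partial>P)"
proof -
  interpret prob_space P by fact
  have "(\<lambda>k. complex_of_real (pmf (mixed_poisson P f) k) * w ^ k) sums
      measure_pmf.expectation (mixed_poisson P f) (\<lambda>k. w ^ k)"
    by (intro sums_expectation_pmf_nat) (use assms in \<open>simp add: norm_power power_le_one\<close>)
  moreover have "(\<lambda>k. complex_of_real (pmf (mixed_poisson P f) k) * w ^ k) sums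
      (\<integral>x. exp (- (complex_of_real (f x) * (1 - w))) \<partial>P)"
    using weighted_mixed_poisson_sums[OF assms(1-3) integrable_const[of 1] assms(4)]
    by (simp add: pmf_mixed_poisson(1)[OF assms(1-3)])
  ultimately show ?thesis by (rule sums_unique2)
qed

lemma shifted_size_biased_generating_function:
  fixes w :: complex
  assumes P: "prob_space P" and f: "f \<in> borel_measurable P" and nonneg: "AE x in P. 0 \<le> f x"
    and int: "integrable P f" and nz: "(\<integral>x. f x \<partial>P) \<noteq> 0" and w: "norm w \<le> 1"
  shows "complex_of_real (\<integral>x. f x \<partial>P) *
      measure_pmf.expectation (shifted_size_biased (mixed_poisson P f)) (\<lambda>k. w ^ k) =
      (\<integral>x. complex_of_real (f x) * exp (- (complex_of_real (f x) * (1 - w))) \<partial>P)"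
proof -
  let ?L = "mixed_poisson P f" and ?\<mu> = "\<integral>x. f x \<partial>P"
  have E: "measure_pmf.expectation ?L real = ?\<mu>"
    by (rule expectation_mixed_poisson[OF P f nonneg int])
  have pmf: "?\<mu> * pmf (shifted_size_biased ?L) k = (\<integral>x. f x * (exp (- f x) * (f x ^ k / fact k)) \<partial>P)" for k
  proof -
    have "?\<mu> * pmf (shifted_size_biased ?L) k = real (k + 1) * pmf ?L (k + 1)"
      using pmf_shifted_size_biased[OF integrable_mixed_poisson[OF P f nonneg int], of k] nz
      by (simp add: E)
    also have "\<dots> = (\<integral>x. real (k + 1) * (exp (- f x) * (f x ^ (k + 1) / fact (k + 1))) \<partial>P)"
      by (simp only: pmf_mixed_poisson(1)[OF P f nonneg] integral_mult_right_zero)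
    also have "\<dots> = (\<integral>x. f x * (exp (- f x) * (f x ^ k / fact k)) \<partial>P)"
      by (intro Bochner_Integration.integral_cong refl) (simp add: field_simps del: of_nat_Suc)
    finally show ?thesis .
  qed
  have "(\<lambda>k. complex_of_real ?\<mu> * (complex_of_real (pmf (shifted_size_biased ?L) k) * w ^ k)) sums
      (complex_of_real ?\<mu> * measure_pmf.expectation (shifted_size_biased ?L) (\<lambda>k. w ^ k))"
    by (intro sums_mult sums_expectation_pmf_nat) (use w in \<open>simp add: norm_power power_le_one\<close>)
  moreover have "(\<lambda>k. complex_of_real ?\<mu> * (complex_of_real (pmf (shifted_size_biased ?L) k) * w ^ k)) sums
      (\<integral>x. complex_of_real (f x) * exp (- (complex_of_real (f x) * (1 - w))) \<partial>P)"
    using weighted_mixed_poisson_sums[OF P f nonneg int w]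
    by (simp only: mult.assoc[symmetric] of_real_mult[symmetric] pmf)
  ultimately show ?thesis by (rule sums_unique2)
qed

text \<open>
  Only the coordinates up to \<open>k\<close> matter on the event that the number of summands is \<open>k\<close>, so the infinite
  product reduces to a finite one.
\<close>

lemma random_sum_generating_function:
  fixes z :: complex
  assumes z: "norm z \<le> 1"
  shows "(\<integral>\<omega>. z ^ random_sum \<omega> \<partial>(measure_pmf L \<Otimes>\<^sub>M (\<Pi>\<^sub>M j\<in>(UNIV :: nat set). measure_pmf T))) =
      measure_pmf.expectation L (\<lambda>k. measure_pmf.expectation T (\<lambda>k. z ^ k) ^ k)"
proof -
  let ?S = "\<Pi>\<^sub>M j\<in>(UNIV :: nat set). measure_pmf T"
  interpret T: product_prob_space "\<lambda>_ :: nat. measure_pmf T" UNIV ..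
  interpret S: prob_space ?S by (rule T.P.prob_space_axioms)
  interpret LS: pair_prob_space "measure_pmf L" ?S ..
  have z1: "norm (z ^ k) \<le> 1" for k using z by (simp add: norm_power power_le_one)
  have inner: "(\<integral>t. z ^ random_sum (k, t) \<partial>?S) = measure_pmf.expectation T (\<lambda>k. z ^ k) ^ k" for k
  proof -
    let ?J = "{1..k}"
    have meas: "(\<lambda>t. \<Prod>j\<in>?J. z ^ t j) \<in> borel_measurable (\<Pi>\<^sub>M j\<in>?J. measure_pmf T)"
    proof (rule borel_measurable_prod)
      fix j assume j: "j \<in> ?J"
      show "(\<lambda>t. z ^ t j) \<in> borel_measurable (\<Pi>\<^sub>M j\<in>?J. measure_pmf T)"
        by (rule measurable_compose[OF measurable_component_singleton[OF j]]) simp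
    qed
    have "(\<integral>t. z ^ random_sum (k, t) \<partial>?S) = (\<integral>t. (\<Prod>j\<in>?J. z ^ restrict t ?J j) \<partial>?S)"
      by (simp add: random_sum_def power_sum)
    also have "\<dots> = (\<integral>t. (\<Prod>j\<in>?J. z ^ t j) \<partial>distr ?S (\<Pi>\<^sub>M j\<in>?J. measure_pmf T) (\<lambda>t. restrict t ?J))"
      by (rule integral_distr[symmetric, OF _ meas]) (rule measurable_restrict_subset, simp)
    also have "distr ?S (\<Pi>\<^sub>M j\<in>?J. measure_pmf T) (\<lambda>t. restrict t ?J) = (\<Pi>\<^sub>M j\<in>?J. measure_pmf T)"
      by (rule T.distr_PiM_restrict_finite) auto
    also have "(\<integral>t. (\<Prod>j\<in>?J. z ^ t j) \<partial>(\<Pi>\<^sub>M j\<in>?J. measure_pmf T)) =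
        (\<Prod>j\<in>?J. measure_pmf.expectation T (\<lambda>k. z ^ k))"
      by (rule T.product_integral_prod)
        (simp_all add: measure_pmf.integrable_const_bound[where B = 1] z1)
    finally show ?thesis by simp
  qed
  have "integrable (measure_pmf L \<Otimes>\<^sub>M ?S) (\<lambda>\<omega>. z ^ random_sum \<omega>)"
    by (rule LS.integrable_const_bound[where B = 1])
      (use z1 measurable_compose[OF measurable_random_sum[of L T], of "\<lambda>k. z ^ k" borel] in auto)
  then have "(\<integral>\<omega>. z ^ random_sum \<omega> \<partial>(measure_pmf L \<Otimes>\<^sub>M ?S)) =
      measure_pmf.expectation L (\<lambda>k. \<integral>t. z ^ random_sum (k, t) \<partial>?S)"
    by (rule LS.integral_fst'[symmetric])
  then show ?thesis by (simp only: inner)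
qed

lemma iexp_nat: "iexp (t * real k) = iexp t ^ k"
  by (simp add: exp_of_nat2_mult[symmetric] mult_ac)

lemma char_random_sum_law:
  "char (random_sum_law L T) t =
     measure_pmf.expectation L (\<lambda>k. measure_pmf.expectation T (\<lambda>k. iexp t ^ k) ^ k)"
proof -
  have "char (random_sum_law L T) t = (\<integral>\<omega>. iexp (t * real (random_sum \<omega>))
      \<partial>(measure_pmf L \<Otimes>\<^sub>M (\<Pi>\<^sub>M j\<in>(UNIV :: nat set). measure_pmf T)))"
    unfolding char_def random_sum_law_def
    by (rule integral_distr) (use measurable_compose[OF measurable_random_sum[of L T], of real borel] in auto)
  also have "\<dots> = measure_pmf.expectation L (\<lambda>k. measure_pmf.expectation T (\<lambda>k. iexp t ^ k) ^ k)"
    unfolding iexp_nat by (rule random_sum_generating_function) simp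
  finally show ?thesis .
qed

section \<open>Few attributes: isolated vertices\<close>

text \<open>
  The weight of \<open>v\<^sub>1\<close> may have infinite mean, so the first-moment bound \<open>2 r Y\<^sub>1 E X\<close> on \<open>\<bar>m \<phi>\<bar>\<close> is truncated
  at 2 before it is averaged over \<open>Y\<^sub>1\<close>.
\<close>

lemma isolated_vertex_limit:
  assumes P1: "real_distribution P1" and P2: "real_distribution P2"
    and int: "integrable P1 (\<lambda>x. x)" and m_infinity: "filterlim m at_top sequentially"
    and ratio: "(\<lambda>n. real (m n) / real n) \<longlonglongrightarrow> 0"
  shows "(\<lambda>n. measure (rig P1 P2 n (m n)) {E. graph_degree n E 1 = 0}) \<longlonglongrightarrow> 1"
proof -
  interpret P1: real_distribution P1 by (rule P1)
  interpret P2: real_distribution P2 by (rule P2)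
  define A where "A = (\<integral>x. \<bar>x\<bar> \<partial>P1)"
  have A: "0 \<le> A" unfolding A_def by simp
  let ?r = "\<lambda>n. sqrt (real (m n) / real n)"
  let ?J = "\<lambda>n y. min 2 (2 * A * \<bar>y\<bar> * ?r n)"
  have J_le: "norm (?J n y) \<le> 2" for n y
  proof -
    have "0 \<le> 2 * A * \<bar>y\<bar> * ?r n" using A by (intro mult_nonneg_nonneg) auto
    then show ?thesis by (simp add: min_def)
  qed
  have J_lim: "(\<lambda>n. \<integral>y. ?J n y \<partial>P2) \<longlonglongrightarrow> (\<integral>y. 0 \<partial>P2)"
  proof (rule integral_dominated_convergence[where w = "\<lambda>_. 2"])
    show "AE y in P2. (\<lambda>n. ?J n y) \<longlonglongrightarrow> 0"
    proof (rule AE_I2)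
      fix y :: real
      have "(\<lambda>n. ?J n y) \<longlonglongrightarrow> min 2 (2 * A * \<bar>y\<bar> * sqrt 0)"
        by (intro tendsto_intros ratio)
      then show "(\<lambda>n. ?J n y) \<longlonglongrightarrow> 0" by simp
    qed
    show "AE y in P2. norm (?J n y) \<le> 2" for n
      by (intro AE_I2 J_le)
  qed simp_all
  have bound: "\<bar>measure (rig P1 P2 n (m n)) {E. graph_degree n E 1 = 0} - 1\<bar> \<le> (\<integral>y. ?J n y \<partial>P2)"
    if n: "0 < n" "0 < m n" for n
  proof -
    let ?s = "sqrt (real n * real (m n))"
    let ?W1 = "\<Pi>\<^sub>M i\<in>{1..m n}. P1" and ?W = "\<Pi>\<^sub>M j\<in>{1..n}. P2"
    interpret R: prob_space "rig P1 P2 n (m n)" by (rule prob_space_rig) fact+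
    interpret W: prob_space ?W by (intro prob_space_PiM P2.prob_space_axioms)
    have one: "1 \<in> {1..n}" using n by auto
    have s: "0 < ?s" using n by simp
    let ?G = "\<lambda>Y. \<integral>X. graph_mean (\<lambda>E. 0 ^ graph_degree n E 1) n (m n) X Y \<partial>?W1"
    have n0: "norm ((0 :: complex) ^ k) \<le> 1" for k by (simp add: power_0_left)
    have "complex_of_real (measure (rig P1 P2 n (m n)) {E. graph_degree n E 1 = 0}) =
        (\<integral>E. 0 ^ graph_degree n E 1 \<partial>rig P1 P2 n (m n))"
    proof -
      have "(0 :: complex) ^ graph_degree n E 1 = complex_of_real (indicator {E. graph_degree n E 1 = 0} E)" for E
        by (simp add: indicator_def power_0_left)
      then show ?thesis
        using sets_rig[OF P1 P2, of n "m n"] by (simp add: sets_eq_imp_space_eq)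
    qed
    also have "\<dots> = (\<integral>Y. ?G Y \<partial>?W)"
      by (rule integral_rig[OF P1 P2 n0])
    finally have rig: "complex_of_real (measure (rig P1 P2 n (m n)) {E. graph_degree n E 1 = 0}) = (\<integral>Y. ?G Y \<partial>?W)" .
    have int_G: "integrable ?W ?G"
      by (rule integrable_graph_mean[OF P1 P2 n0])
    have norm_0: "norm (0 :: complex) \<le> 1" by simp
    have G: "?G Y = (1 - attribute_effect P1 ?s n 0 Y) ^ m n" for Y
    proof -
      have "?G Y = (\<integral>X. (\<Prod>i=1..m n. 1 - complex_of_real (link_prob ?s (X i) (Y 1)) *
          (1 - (\<Prod>j=2..n. 1 - (1 - 0) * complex_of_real (link_prob ?s (X i) (Y j))))) \<partial>?W1)"
        unfolding graph_mean_def by (subst expectation_degree_eq_0) simp_all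
      also have "\<dots> = (1 - attribute_effect P1 ?s n 0 Y) ^ m n"
        by (subst integral_prod_attribute_weights[OF P1])
          (rule integrable_attribute_factor[OF P1 norm_0], simp, unfold integral_attribute_factor[OF P1 norm_0], simp)
      finally show ?thesis .
    qed
    have eff: "norm (attribute_effect P1 ?s n 0 Y) \<le> 2 * (A * \<bar>Y 1\<bar> / ?s)" for Y
    proof -
      have "norm (attribute_effect P1 ?s n 0 Y) \<le>
          (\<integral>x. norm (complex_of_real (link_prob ?s x (Y 1)) *
            (1 - (\<Prod>j=2..n. 1 - (1 - 0) * complex_of_real (link_prob ?s x (Y j))))) \<partial>P1)"
        unfolding attribute_effect_def by (rule integral_norm_bound)
      also have "\<dots> \<le> (\<integral>x. \<bar>x\<bar> * (\<bar>Y 1\<bar> / ?s * 2) \<partial>P1)"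
      proof (rule integral_mono')
        show "integrable P1 (\<lambda>x. \<bar>x\<bar> * (\<bar>Y 1\<bar> / ?s * 2))"
          using int by (intro integrable_mult_left integrable_abs)
        fix x
        let ?U = "\<Prod>j=2..n. 1 - (1 - 0) * complex_of_real (link_prob ?s x (Y j))"
        have "norm ?U \<le> (\<Prod>j=2..n. 1)"
          unfolding prod_norm[symmetric] by (intro prod_mono conjI norm_thin_le_1 norm_ge_zero) simp_all
        then have "norm (1 - ?U) \<le> 1 + 1"
          by (intro order_trans[OF norm_triangle_ineq4] add_mono) simp_all
        then have "norm (complex_of_real (link_prob ?s x (Y 1)) * (1 - ?U)) \<le> (\<bar>x\<bar> * \<bar>Y 1\<bar> / ?s) * 2"
          unfolding norm_mult by (intro mult_mono) (use link_prob_le[OF s] in simp_all)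
        then show "norm (complex_of_real (link_prob ?s x (Y 1)) * (1 - ?U)) \<le> \<bar>x\<bar> * (\<bar>Y 1\<bar> / ?s * 2)"
          by (simp add: mult.assoc)
      qed (use s in simp)
      also have "\<dots> = 2 * (A * \<bar>Y 1\<bar> / ?s)"
        by (simp add: A_def)
      finally show ?thesis .
    qed
    have ms: "real (m n) / ?s = ?r n"
    proof -
      have "real (m n) = sqrt (real (m n)) * sqrt (real (m n))" by simp
      then show ?thesis using n by (simp add: real_sqrt_mult real_sqrt_divide field_simps)
    qed
    have G1: "norm (?G Y - 1) \<le> ?J n (Y 1)" for Y
    proof -
      let ?e = "1 - attribute_effect P1 ?s n 0 Y"
      have e1: "norm ?e \<le> 1" by (rule norm_one_minus_attribute_effect_le_1[OF P1]) simp
      have "norm (?e ^ m n - 1 ^ m n) \<le> real (m n) * norm (?e - 1)"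
        using e1 by (intro norm_power_diff) auto
      also have "\<dots> \<le> real (m n) * (2 * (A * \<bar>Y 1\<bar> / ?s))"
        using eff[of Y] by (intro mult_left_mono) simp_all
      also have "\<dots> = 2 * A * \<bar>Y 1\<bar> * (real (m n) / ?s)" by simp
      finally have "norm (?e ^ m n - 1) \<le> 2 * A * \<bar>Y 1\<bar> * ?r n" unfolding ms by simp
      moreover have "norm (?e ^ m n - 1) \<le> 1 + 1"
        using e1 by (intro order_trans[OF norm_triangle_ineq4] add_mono) (simp_all add: norm_power power_le_one)
      ultimately show ?thesis unfolding G by simp
    qed
    have J_meas: "?J n \<in> borel_measurable P2" by simp
    have int_J: "integrable P2 (?J n)"
      by (intro P2.integrable_const_bound[where B = 2] AE_I2 J_meas J_le)
    have int_JW: "integrable ?W (\<lambda>Y. ?J n (Y 1))"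
      using integrable_PiM_component_iff[OF P2.prob_space_axioms one J_meas] int_J by (simp only:)
    have "\<bar>measure (rig P1 P2 n (m n)) {E. graph_degree n E 1 = 0} - 1\<bar> =
        norm (complex_of_real (measure (rig P1 P2 n (m n)) {E. graph_degree n E 1 = 0}) - 1)"
      using norm_of_real[of "measure (rig P1 P2 n (m n)) {E. graph_degree n E 1 = 0} - 1", where 'a = complex]
      by simp
    also have "\<dots> = norm (\<integral>Y. ?G Y - 1 \<partial>?W)"
      unfolding rig Bochner_Integration.integral_diff[OF int_G W.integrable_const[of 1]]
      using W.prob_space by simp
    also have "\<dots> \<le> (\<integral>Y. norm (?G Y - 1) \<partial>?W)"
      by (rule integral_norm_bound)
    also have "\<dots> \<le> (\<integral>Y. ?J n (Y 1) \<partial>?W)"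
      by (intro integral_mono integrable_norm Bochner_Integration.integrable_diff int_G W.integrable_const int_JW G1)
    also have "\<dots> = (\<integral>y. ?J n y \<partial>P2)"
      by (rule integral_PiM_component[OF P2.prob_space_axioms one J_meas])
    finally show ?thesis .
  qed
  have "(\<lambda>n. measure (rig P1 P2 n (m n)) {E. graph_degree n E 1 = 0} - 1) \<longlonglongrightarrow> 0"
  proof (rule Lim_null_comparison)
    show "\<forall>\<^sub>F n in sequentially. norm (measure (rig P1 P2 n (m n)) {E. graph_degree n E 1 = 0} - 1) \<le> (\<integral>y. ?J n y \<partial>P2)"
      using eventually_gt_at_top[of 0] eventually_compose_filterlim[OF eventually_gt_at_top[of 0] m_infinity]
      by eventually_elim (simp only: real_norm_def bound)
    show "(\<lambda>n. \<integral>y. ?J n y \<partial>P2) \<longlonglongrightarrow> 0" using J_lim by simp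
  qed
  then show ?thesis by (rule LIM_zero_cancel)
qed

section \<open>The limit laws of the degree\<close>

lemma
  assumes "real_distribution P1" "real_distribution P2"
  shows real_distribution_degree_law:
      "real_distribution (distr (rig P1 P2 n k) borel (\<lambda>E. real (graph_degree n E 1)))"
    and char_degree_law:
      "char (distr (rig P1 P2 n k) borel (\<lambda>E. real (graph_degree n E 1))) t =
        (\<integral>E. iexp t ^ graph_degree n E 1 \<partial>rig P1 P2 n k)"
proof -
  interpret R: prob_space "rig P1 P2 n k" by (rule prob_space_rig) fact+
  have meas: "f \<in> borel_measurable (rig P1 P2 n k)" for f :: "nat set set \<Rightarrow> 'b :: topological_space"
    using sets_rig[OF assms, of n k] by (auto simp: measurable_def)
  show "real_distribution (distr (rig P1 P2 n k) borel (\<lambda>E. real (graph_degree n E 1)))"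
    by (intro R.real_distribution_distr meas)
  show "char (distr (rig P1 P2 n k) borel (\<lambda>E. real (graph_degree n E 1))) t =
        (\<integral>E. iexp t ^ graph_degree n E 1 \<partial>rig P1 P2 n k)"
    unfolding char_def iexp_nat[symmetric] by (rule integral_distr[OF meas]) simp
qed

context sparse_weights
begin

text \<open>
  The common part of the regimes in which \<open>m / n\<close> has a positive limit or tends to infinity: only the pointwise limit and the characteristic function of the
  target law have to be supplied.
\<close>

lemma degree_law_weak_conv:
  assumes M: "real_distribution M"
    and \<Psi>_meas: "\<And>z. \<Psi> z \<in> borel_measurable borel"
    and \<Psi>_limit: "\<And>z x. norm z \<le> 1 \<Longrightarrow> 0 \<le> x \<Longrightarrow>
      (\<lambda>n. complex_of_real (r n) * (1 - exp (- ((1 - z) * complex_of_real (x * b1 / r n))))) \<longlonglongrightarrow> \<Psi> z x"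
    and char_M: "\<And>t. char M t =
      (\<integral>y. exp (- (complex_of_real y * (\<integral>x. complex_of_real x * \<Psi> (iexp t) x \<partial>P1))) \<partial>P2)"
  shows "weak_conv_m (\<lambda>n. distr (rig P1 P2 n (m n)) borel (\<lambda>E. real (graph_degree n E 1))) M"
proof (rule levy_continuity[OF real_distribution_degree_law[OF P1 P2] M])
  fix t
  interpret sparse_weights_limit P1 P2 m "iexp t" "\<Psi> (iexp t)"
    by unfold_locales (simp, rule \<Psi>_meas, rule \<Psi>_limit, simp_all)
  show "(\<lambda>n. char (distr (rig P1 P2 n (m n)) borel (\<lambda>E. real (graph_degree n E 1))) t) \<longlonglongrightarrow> char M t"
    unfolding char_degree_law[OF P1 P2] char_M
    using degree_generating_function_limit unfolding \<kappa>_def .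
qed

definition a1 :: real where "a1 = (\<integral>x. x \<partial>P1)"

lemma a1_nonneg: "0 \<le> a1"
  unfolding a1_def by (rule integral_nonneg_AE[OF P1_nonneg])

text \<open>
  With \<open>f = x b\<^sub>1 / c\<close> the generating function \<open>\<tau>\<close> of the size-biased summands satisfies
  \<open>(E f) (1 - \<tau>) = E (f (1 - exp (- (1 - z) f)))\<close>, and \<open>E f = a\<^sub>1 b\<^sub>1 / c\<close>; cancelling \<open>b\<^sub>1 / c\<^sup>2\<close> shows that
  \<open>y a\<^sub>1 c (1 - \<tau>)\<close>, the exponent of the mixed Poisson law, is the exponent on the right. If
  \<open>a\<^sub>1 b\<^sub>1 = 0\<close>, nothing can be cancelled, but then both sides equal 1.
\<close>

lemma char_d_star_law:
  assumes c: "0 < c"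
  shows "char (d_star_law (mixed_poisson P2 (\<lambda>y. y * a1 * c)) (mixed_poisson P1 (\<lambda>x. x * b1 / c))) t =
    (\<integral>y. exp (- (complex_of_real y * (\<integral>x. complex_of_real x * (complex_of_real c *
      (1 - exp (- ((1 - iexp t) * complex_of_real (x * b1 / c))))) \<partial>P1))) \<partial>P2)"
proof -
  let ?f = "\<lambda>x. x * b1 / c" and ?g = "\<lambda>y. y * a1 * c" and ?z = "iexp t"
  let ?e = "\<lambda>x. exp (- ((1 - ?z) * complex_of_real (?f x)))"
  let ?K = "\<integral>x. complex_of_real x * (complex_of_real c * (1 - ?e x)) \<partial>P1"
  let ?L1 = "mixed_poisson P2 ?g" and ?L2 = "mixed_poisson P1 ?f"
  have f_nonneg: "AE x in P1. 0 \<le> ?f x" using P1_nonneg by eventually_elim (use b1_nonneg c in simp)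
  have g_nonneg: "AE y in P2. 0 \<le> ?g y" using P2_nonneg by eventually_elim (use a1_nonneg c in simp)
  have int_f: "integrable P1 ?f" using int_P1 by simp
  have Ef: "(\<integral>x. ?f x \<partial>P1) = a1 * b1 / c" by (simp add: a1_def)
  have E2: "measure_pmf.expectation ?L2 real = a1 * b1 / c"
    using expectation_mixed_poisson[OF P1.prob_space_axioms _ f_nonneg int_f] Ef by simp
  show ?thesis
  proof (cases "a1 * b1 = 0")
    case True
    \<comment> \<open>If b1 = 0 the exponent vanishes, and if a1 = 0 then X vanishes almost surely.\<close>
    have "AE x in P1. complex_of_real x * (complex_of_real c * (1 - ?e x)) = 0"
    proof (cases "b1 = 0")
      case False
      then have "(\<integral>x. x \<partial>P1) = 0" using True by (simp add: a1_def)
      then have "AE x in P1. x = 0"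
        using integral_nonneg_eq_0_iff_AE[OF int_P1 P1_nonneg] by simp
      then show ?thesis by eventually_elim simp
    qed simp
    then have "?K = (\<integral>x. 0 \<partial>P1)" by (intro integral_cong_AE) auto
    then have K: "?K = 0" by simp
    have "char (return borel 0) t = 1"
      unfolding char_def by (subst integral_return) auto
    then show ?thesis
      unfolding K using True E2 P2.prob_space by (simp add: d_star_law_def)
  next
    case False
    let ?\<tau> = "measure_pmf.expectation (shifted_size_biased ?L2) (\<lambda>k. ?z ^ k)"
    have \<tau>: "norm ?\<tau> \<le> 1"
      by (rule order_trans[OF integral_norm_bound], rule measure_pmf.integral_le_const)
        (simp_all add: norm_power measure_pmf.integrable_const_bound[where B = 1])
    have int_fe: "integrable P1 (\<lambda>x. complex_of_real (?f x) * ?e x)"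
    proof (rule Bochner_Integration.integrable_bound[OF int_f])
      show "AE x in P1. norm (complex_of_real (?f x) * ?e x) \<le> norm (?f x)"
        using f_nonneg
      proof eventually_elim
        case (elim x)
        have "0 \<le> (1 - Re ?z) * ?f x"
          using elim complex_Re_le_cmod[of ?z] by (intro mult_nonneg_nonneg) simp_all
        then have "norm (?e x) \<le> 1"
          by (simp add: norm_exp_eq_Re)
        then show ?case
          unfolding norm_mult norm_of_real real_norm_def by (rule mult_left_le[OF _ abs_ge_zero])
      qed
    qed simp
    have "complex_of_real (a1 * b1 / c) * (1 - ?\<tau>) =
        (\<integral>x. complex_of_real (?f x) \<partial>P1) - (\<integral>x. complex_of_real (?f x) * ?e x \<partial>P1)"
    proof -
      have z1: "norm ?z \<le> 1" by simp
      have nz: "(\<integral>x. ?f x \<partial>P1) \<noteq> 0" unfolding Ef using False c by simp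
      have "(\<integral>x. complex_of_real (?f x) * ?e x \<partial>P1) = complex_of_real (a1 * b1 / c) * ?\<tau>"
        using shifted_size_biased_generating_function[OF P1.prob_space_axioms
            borel_measurable_integrable[OF int_f] f_nonneg int_f nz z1]
        unfolding Ef mult.commute[of _ "1 - ?z"] by (rule sym)
      then show ?thesis
        unfolding integral_complex_of_real Ef by (simp only: right_diff_distrib mult_1_right)
    qed
    also have "\<dots> = (\<integral>x. complex_of_real (?f x) - complex_of_real (?f x) * ?e x \<partial>P1)"
      using int_f int_fe by (intro Bochner_Integration.integral_diff[symmetric] integrable_of_real)
    also have "\<dots> = (\<integral>x. complex_of_real (b1 / c\<^sup>2) * (complex_of_real x * (complex_of_real c * (1 - ?e x))) \<partial>P1)"
      using c by (intro Bochner_Integration.integral_cong refl) (simp add: field_simps power2_eq_square)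
    also have "\<dots> = complex_of_real (b1 / c\<^sup>2) * ?K"
      by (rule integral_mult_right_zero)
    finally have "complex_of_real (a1 * b1 / c) * (1 - ?\<tau>) = complex_of_real (b1 / c\<^sup>2) * ?K" .
    moreover have "complex_of_real (a1 * b1 / c) = complex_of_real (b1 / c\<^sup>2) * complex_of_real (a1 * c)"
      unfolding of_real_mult[symmetric] using c by (simp add: power2_eq_square)
    ultimately have "complex_of_real (b1 / c\<^sup>2) * (complex_of_real (a1 * c) * (1 - ?\<tau>)) =
        complex_of_real (b1 / c\<^sup>2) * ?K"
      by (simp only: mult.assoc)
    moreover have "complex_of_real (b1 / c\<^sup>2) \<noteq> 0" using False c by simp
    ultimately have K: "complex_of_real (a1 * c) * (1 - ?\<tau>) = ?K"
      by (rule mult_left_cancel[THEN iffD1, rotated])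
    have "char (d_star_law ?L1 ?L2) t = measure_pmf.expectation ?L1 (\<lambda>k. ?\<tau> ^ k)"
      using False c by (simp add: d_star_law_def E2 char_random_sum_law)
    also have "\<dots> = (\<integral>y. exp (- (complex_of_real (?g y) * (1 - ?\<tau>))) \<partial>P2)"
      by (rule mixed_poisson_generating_function[OF P2.prob_space_axioms _ g_nonneg \<tau>]) simp
    also have "\<dots> = (\<integral>y. exp (- (complex_of_real y * ?K)) \<partial>P2)"
      unfolding K[symmetric] by (simp only: of_real_mult mult.assoc)
    finally show ?thesis .
  qed
qed

lemma real_distribution_d_star_law: "real_distribution (d_star_law L1 L2)"
proof (cases "measure_pmf.expectation L2 real = 0")
  case True
  then show ?thesis
    by (simp add: d_star_law_def real_distribution_def real_distribution_axioms_def prob_space_return)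
next
  case False
  then show ?thesis
    by (simp add: d_star_law_def real_distribution_random_sum_law)
qed

lemma balanced_limit:
  assumes \<beta>: "0 < \<beta>" and ratio: "(\<lambda>n. real (m n) / real n) \<longlonglongrightarrow> \<beta>"
  shows "weak_conv_m (\<lambda>n. distr (rig P1 P2 n (m n)) borel (\<lambda>E. real (graph_degree n E 1)))
    (d_star_law (mixed_poisson P2 (\<lambda>y. y * a1 * sqrt \<beta>)) (mixed_poisson P1 (\<lambda>x. x * b1 / sqrt \<beta>)))"
proof (rule degree_law_weak_conv[OF real_distribution_d_star_law])
  show "char (d_star_law (mixed_poisson P2 (\<lambda>y. y * a1 * sqrt \<beta>)) (mixed_poisson P1 (\<lambda>x. x * b1 / sqrt \<beta>))) t =
    (\<integral>y. exp (- (complex_of_real y * (\<integral>x. complex_of_real x * (\<lambda>z x. complex_of_real (sqrt \<beta>) *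
      (1 - exp (- ((1 - z) * complex_of_real (x * b1 / sqrt \<beta>))))) (iexp t) x \<partial>P1))) \<partial>P2)" for t
    using \<beta> by (subst char_d_star_law) simp_all
  fix z :: complex and x :: real
  have r: "r \<longlonglongrightarrow> sqrt \<beta>"
    unfolding r_def[abs_def] by (intro tendsto_intros ratio)
  show "(\<lambda>n. complex_of_real (r n) * (1 - exp (- ((1 - z) * complex_of_real (x * b1 / r n))))) \<longlonglongrightarrow>
      complex_of_real (sqrt \<beta>) * (1 - exp (- ((1 - z) * complex_of_real (x * b1 / sqrt \<beta>))))"
    by (intro tendsto_intros r) (use \<beta> in simp)
qed simp

text \<open>
  For large \<open>r\<close> an attribute of \<open>v\<^sub>1\<close> has with high probability at most one further vertex, so
  \<open>r (1 - exp (- (1 - z) x b\<^sub>1 / r))\<close> becomes linear in \<open>1 - z\<close> and the compound law degenerates to a mixed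
  Poisson law.
\<close>

lemma many_attributes_limit:
  assumes ratio: "filterlim (\<lambda>n. real (m n) / real n) at_top sequentially"
  shows "weak_conv_m (\<lambda>n. distr (rig P1 P2 n (m n)) borel (\<lambda>E. real (graph_degree n E 1)))
    (distr (measure_pmf (mixed_poisson P2 (\<lambda>y. y * a2 * b1))) borel real)"
proof (rule degree_law_weak_conv)
  show "real_distribution (distr (measure_pmf (mixed_poisson P2 (\<lambda>y. y * a2 * b1))) borel real)"
    by (intro prob_space.real_distribution_distr prob_space_measure_pmf) simp
  have nonneg: "AE y in P2. 0 \<le> y * a2 * b1"
    using P2_nonneg by eventually_elim (use a2_nonneg b1_nonneg in simp)
  show "char (distr (measure_pmf (mixed_poisson P2 (\<lambda>y. y * a2 * b1))) borel real) t =
    (\<integral>y. exp (- (complex_of_real y * (\<integral>x. complex_of_real x * (\<lambda>z x. (1 - z) * complex_of_real (x * b1)) (iexp t) x \<partial>P1))) \<partial>P2)" for t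
  proof -
    have "(\<integral>x. complex_of_real x * ((1 - iexp t) * complex_of_real (x * b1)) \<partial>P1) =
        (\<integral>x. complex_of_real (x\<^sup>2) * ((1 - iexp t) * complex_of_real b1) \<partial>P1)"
      by (intro Bochner_Integration.integral_cong refl) (simp add: power2_eq_square)
    also have "\<dots> = complex_of_real a2 * ((1 - iexp t) * complex_of_real b1)"
      unfolding integral_mult_left_zero integral_complex_of_real a2_def ..
    finally have K: "(\<integral>x. complex_of_real x * ((1 - iexp t) * complex_of_real (x * b1)) \<partial>P1) =
        complex_of_real a2 * ((1 - iexp t) * complex_of_real b1)" .
    have "char (distr (measure_pmf (mixed_poisson P2 (\<lambda>y. y * a2 * b1))) borel real) t =
        measure_pmf.expectation (mixed_poisson P2 (\<lambda>y. y * a2 * b1)) (\<lambda>k. iexp t ^ k)"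
      unfolding char_def by (subst integral_distr) (simp_all only: iexp_nat, simp_all)
    also have "\<dots> = (\<integral>y. exp (- (complex_of_real (y * a2 * b1) * (1 - iexp t))) \<partial>P2)"
      by (rule mixed_poisson_generating_function[OF P2.prob_space_axioms _ nonneg]) simp_all
    finally show ?thesis
      unfolding K by (simp add: mult_ac)
  qed
  fix z :: complex and x :: real assume z: "norm z \<le> 1" and x: "0 \<le> x"
  let ?c = "(1 - z) * complex_of_real (x * b1)"
  have r: "filterlim r at_top sequentially"
    unfolding r_def[abs_def] by (rule filterlim_compose[OF sqrt_at_top ratio])
  have Re: "0 \<le> Re ?c"
    using z x b1_nonneg complex_Re_le_cmod[of z] by simp
  have "(\<lambda>n. complex_of_real (r n) * (1 - exp (- ((1 - z) * complex_of_real (x * b1 / r n)))) - ?c) \<longlonglongrightarrow> 0"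
  proof (rule Lim_null_comparison)
    show "(\<lambda>n. (norm ?c)\<^sup>2 / r n) \<longlonglongrightarrow> 0"
      by (intro tendsto_divide_0[OF tendsto_const] filterlim_at_top_imp_at_infinity r)
    show "\<forall>\<^sub>F n in sequentially. norm (complex_of_real (r n) *
        (1 - exp (- ((1 - z) * complex_of_real (x * b1 / r n)))) - ?c) \<le> (norm ?c)\<^sup>2 / r n"
      using eventually_pos
    proof eventually_elim
      case (elim n)
      then have rn: "0 < r n" using r_pos by auto
      let ?w = "?c / complex_of_real (r n)"
      have w: "(1 - z) * complex_of_real (x * b1 / r n) = ?w" by simp
      have "complex_of_real (r n) * (1 - exp (- ?w)) - ?c = complex_of_real (r n) * (1 - ?w - exp (- ?w))"
        using rn by (simp add: right_diff_distrib)
      then have "norm (complex_of_real (r n) * (1 - exp (- ?w)) - ?c) = r n * norm (1 - ?w - exp (- ?w))"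
        using rn by (simp only: norm_mult norm_of_real abs_of_pos)
      also have "\<dots> \<le> r n * (norm ?w)\<^sup>2"
        using rn Re by (intro mult_left_mono norm_one_minus_minus_exp_le) simp_all
      also have "\<dots> = (norm ?c)\<^sup>2 / r n"
        using rn by (simp add: norm_divide power_divide power2_eq_square)
      finally show ?case by (simp only: w)
    qed
  qed
  then show "(\<lambda>n. complex_of_real (r n) * (1 - exp (- ((1 - z) * complex_of_real (x * b1 / r n))))) \<longlonglongrightarrow> ?c"
    by (rule LIM_zero_cancel)
qed simp

end

theorem theorem1:
  fixes P1 P2 :: "real measure" and m :: "nat \<Rightarrow> nat"
  assumes "real_distribution P1" and "AE x in P1. 0 \<le> x"
    and "real_distribution P2" and "AE y in P2. 0 \<le> y"
    and "filterlim m at_top sequentially"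
  defines "a \<equiv> \<lambda>i::nat. \<integral>x. x ^ i \<partial>P1"
    and "b \<equiv> \<lambda>i::nat. \<integral>y. y ^ i \<partial>P2"
    and "degree_law \<equiv> \<lambda>n. distr (rig P1 P2 n (m n)) borel (\<lambda>E. real (graph_degree n E 1))"
  shows
    "((\<lambda>n. real (m n) / real n) \<longlonglongrightarrow> 0 \<and> integrable P1 (\<lambda>x. x) \<longrightarrow>
        (\<lambda>n. measure (rig P1 P2 n (m n)) {E. graph_degree n E 1 = 0}) \<longlonglongrightarrow> 1)
     \<and> (\<forall>\<beta>>0. (\<lambda>n. real (m n) / real n) \<longlonglongrightarrow> \<beta> \<and>
          integrable P1 (\<lambda>x. x ^ 2) \<and> integrable P2 (\<lambda>y. y) \<longrightarrow>
          weak_conv_m degree_law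
            (d_star_law
              (mixed_poisson P2 (\<lambda>y. y * a 1 * \<beta> powr (1/2)))
              (mixed_poisson P1 (\<lambda>x. x * b 1 * \<beta> powr (-1/2)))))
     \<and> (filterlim (\<lambda>n. real (m n) / real n) at_top sequentially \<and>
          integrable P1 (\<lambda>x. x ^ 2) \<and> integrable P2 (\<lambda>y. y) \<longrightarrow>
          weak_conv_m degree_law
            (distr (measure_pmf (mixed_poisson P2 (\<lambda>y. y * a 2 * b 1))) borel real))"
proof (intro conjI allI impI)
  assume "(\<lambda>n. real (m n) / real n) \<longlonglongrightarrow> 0 \<and> integrable P1 (\<lambda>x. x)"
  then show "(\<lambda>n. measure (rig P1 P2 n (m n)) {E. graph_degree n E 1 = 0}) \<longlonglongrightarrow> 1"
    using assms(1,3,5) by (intro isolated_vertex_limit) auto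
next
  fix \<beta> :: real
  assume \<beta>: "0 < \<beta>"
    and *: "(\<lambda>n. real (m n) / real n) \<longlonglongrightarrow> \<beta> \<and> integrable P1 (\<lambda>x. x ^ 2) \<and> integrable P2 (\<lambda>y. y)"
  interpret sparse_weights P1 P2 m
    by (intro sparse_weights.intro) (use assms(1-5) * in auto)
  have half: "sqrt \<beta> = \<beta> powr (1/2)"
    using \<beta> by (simp add: powr_half_sqrt)
  have "\<beta> powr (-1/2) = inverse (\<beta> powr (1/2))"
    using powr_minus[of \<beta> "1/2"] by simp
  then have minus_half: "x / \<beta> powr (1/2) = x * \<beta> powr (-1/2)" for x
    by (simp only: divide_inverse)
  show "weak_conv_m degree_law
      (d_star_law (mixed_poisson P2 (\<lambda>y. y * a 1 * \<beta> powr (1/2)))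
        (mixed_poisson P1 (\<lambda>x. x * b 1 * \<beta> powr (-1/2))))"
    using balanced_limit[OF \<beta> conjunct1[OF *]]
    unfolding degree_law_def a_def b_def a1_def b1_def power_one_right half minus_half .
next
  assume *: "filterlim (\<lambda>n. real (m n) / real n) at_top sequentially \<and>
      integrable P1 (\<lambda>x. x ^ 2) \<and> integrable P2 (\<lambda>y. y)"
  interpret sparse_weights P1 P2 m
    by (intro sparse_weights.intro) (use assms(1-5) * in auto)
  show "weak_conv_m degree_law (distr (measure_pmf (mixed_poisson P2 (\<lambda>y. y * a 2 * b 1))) borel real)"
    using many_attributes_limit[OF conjunct1[OF *]]
    unfolding degree_law_def a_def b_def a2_def b1_def power_one_right .
qed

end
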